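(* Let $\Gamma\subset \mathrm{PSL}_2(\mathbb Z)$ be a Fuchsian group of the first kind with parabolic elements and without elliptic elements, let $g$ be the genus of $\Gamma\backslash\mathfrak H$ and $m$ the number of cusps, let $\gamma_1,\dots,\gamma_{2g+m}$ be a system of Fricke–Klein generators of $\Gamma$, let $k$ be an even integer and $s\ge 1$ an integer. Let $$\psi: M_k^{s+1}(\Gamma)\to \bigoplus_{i=1}^{(2g+m-1)^s} M_k^1(\Gamma)$$ be defined by $$\psi(f)=\bigl(f|_k(\gamma_{i_1}-1)\cdots(\gamma_{i_s}-1)\bigr)_{1\le i_1,\dots,i_s\le 2g+m-1}.$$ Then $$0\to M_k^s(\Gamma)\hookrightarrow M_k^{s+1}(\Gamma)\xrightarrow{\ \psi\ }\bigoplus_{i=1}^{(2g+m-1)^s} M_k^1(\Gamma)\to 0$$ is an exact sequence, where the first map is the inclusion.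
   Context: $\mathfrak H$ is the upper half-plane, on which $\Gamma$ acts by Möbius transformations. Fricke–Klein generators (no elliptic elements): $\gamma_1,\dots,\gamma_{2g}$ are hyperbolic, $\gamma_{2g+1},\dots,\gamma_{2g+m}$ are parabolic, together they generate $\Gamma$, and they satisfy the single defining relation $[\gamma_1,\gamma_{g+1}]\cdots[\gamma_g,\gamma_{2g}]\gamma_{2g+1}\cdots\gamma_{2g+m}=1$, where $[a,b]=aba^{-1}b^{-1}$. For a complex function $f$ on $\mathfrak H$, an even integer $k$ and $\gamma=\begin{pmatrix}a&b\\c&d\end{pmatrix}\in\Gamma$, set $(f|_k\gamma)(z)=(cz+d)^{-k}f(\gamma z)$. This is a right action of $\Gamma$ on complex functions on $\mathfrak H$, extended linearly to $\mathbb C[\Gamma]$. $J$ is the augmentation ideal of $\mathbb Z[\Gamma]$ (the kernel of the degree map $\mathbb Z[\Gamma]\to\mathbb Z$). For $s\ge 0$, $M_k^s(\Gamma)$ is the complex vector space of smooth functions $f:\mathfrak H\to\mathbb C$ such that $f|_k\delta=0$ for all $\delta\in J^s$ (no growth condition is imposed). Thus $M_k^s(\Gamma)\subseteq M_k^{s+1}(\Gamma)$. *)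

theory Defs
  imports
    "HOL-Analysis.Analysis"
    "HOL-Algebra.Ideal_Product"
    "HOL-Algebra.Generated_Groups"
    "HOL-Algebra.IntRing"
    "HOL-Algebra.Module"
begin

section \<open>PSL(2,R), PSL(2,Z) and the action on the upper half-plane\<close>

definition SL2R :: "(real^2^2) monoid" where
  "SL2R = \<lparr>carrier = {A. det A = 1}, monoid.mult = (**), one = mat 1\<rparr>"

text \<open>The elements of PSL(2,R) are the cosets \<open>{A, -A}\<close>.\<close>

definition PSL2R :: "(real^2^2) set monoid" where
  "PSL2R = SL2R Mod {mat 1, - mat 1}"

definition PSL2Z :: "(real^2^2) set set" where
  "PSL2Z = {\<gamma> \<in> carrier PSL2R. \<forall>A\<in>\<gamma>. \<forall>i j. A $ i $ j \<in> \<int>}"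

text \<open>A matrix representing \<open>\<gamma>\<close>.  It is determined up to sign, and everything defined
  through it below is insensitive to the sign (for the slash action: when the weight is even).\<close>

definition rep :: "(real^2^2) set \<Rightarrow> real^2^2" where
  "rep \<gamma> = (SOME A. A \<in> \<gamma>)"

definition hyperbolic :: "(real^2^2) set \<Rightarrow> bool" where
  "hyperbolic \<gamma> \<longleftrightarrow> \<bar>trace (rep \<gamma>)\<bar> > 2"

definition parabolic :: "(real^2^2) set \<Rightarrow> bool" where
  "parabolic \<gamma> \<longleftrightarrow> \<gamma> \<noteq> \<one>\<^bsub>PSL2R\<^esub> \<and> \<bar>trace (rep \<gamma>)\<bar> = 2"

definition elliptic :: "(real^2^2) set \<Rightarrow> bool" where
  "elliptic \<gamma> \<longleftrightarrow> \<bar>trace (rep \<gamma>)\<bar> < 2"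

definition uhp :: "complex set" where
  "uhp = {z. Im z > 0}"

definition autfactor :: "(real^2^2) set \<Rightarrow> complex \<Rightarrow> complex" where
  "autfactor \<gamma> z = of_real (rep \<gamma> $ 2 $ 1) * z + of_real (rep \<gamma> $ 2 $ 2)"

definition moebius :: "(real^2^2) set \<Rightarrow> complex \<Rightarrow> complex" where
  "moebius \<gamma> z = (of_real (rep \<gamma> $ 1 $ 1) * z + of_real (rep \<gamma> $ 1 $ 2)) / autfactor \<gamma> z"

definition orbit :: "(real^2^2) set set \<Rightarrow> complex \<Rightarrow> complex set" where
  "orbit \<Gamma> z = (\<lambda>\<gamma>. moebius \<gamma> z) ` \<Gamma>"


section \<open>Fuchsian groups of the first kind, genus and cusps\<close>

text \<open>A subgroup is Fuchsian if it is discrete; equivalently its preimage \<open>\<Union>\<Gamma>\<close> in SL(2,R) is.\<close>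

definition fuchsian :: "(real^2^2) set set \<Rightarrow> bool" where
  "fuchsian \<Gamma> \<longleftrightarrow> subgroup \<Gamma> PSL2R \<and> discrete (\<Union>\<Gamma>)"

text \<open>First kind: every point of the boundary \<open>\<real> \<union> {\<infinity>}\<close> is a limit point of the group.  The point
  at infinity is an accumulation point of an orbit iff the orbit is unbounded in the complex plane.
  For finitely generated groups this is the same as having finite covolume.\<close>

definition fuchsian_first_kind :: "(real^2^2) set set \<Rightarrow> bool" where
  "fuchsian_first_kind \<Gamma> \<longleftrightarrow> fuchsian \<Gamma> \<and>
     (\<forall>x::real. \<exists>z\<in>uhp. complex_of_real x islimpt orbit \<Gamma> z) \<and>
     (\<exists>z\<in>uhp. \<not> bounded (orbit \<Gamma> z))"

text \<open>The quotient of the upper half-plane by \<open>\<Gamma>\<close>, with the quotient topology.\<close>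

definition orbit_space :: "(real^2^2) set set \<Rightarrow> complex set topology" where
  "orbit_space \<Gamma> = topology (\<lambda>U. U \<subseteq> orbit \<Gamma> ` uhp \<and> open {z\<in>uhp. orbit \<Gamma> z \<in> U})"

lemma openin_orbit_space:
  "openin (orbit_space \<Gamma>) U \<longleftrightarrow> U \<subseteq> orbit \<Gamma> ` uhp \<and> open {z\<in>uhp. orbit \<Gamma> z \<in> U}"
proof -
  have "istopology (\<lambda>U. U \<subseteq> orbit \<Gamma> ` uhp \<and> open {z\<in>uhp. orbit \<Gamma> z \<in> U})"
    unfolding istopology_def
  proof (intro conjI allI impI; (elim conjE)?)
    fix S T
    assume "open {z \<in> uhp. orbit \<Gamma> z \<in> S}" "open {z \<in> uhp. orbit \<Gamma> z \<in> T}"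
    then have "open ({z \<in> uhp. orbit \<Gamma> z \<in> S} \<inter> {z \<in> uhp. orbit \<Gamma> z \<in> T})"
      by (rule open_Int)
    also have "{z \<in> uhp. orbit \<Gamma> z \<in> S} \<inter> {z \<in> uhp. orbit \<Gamma> z \<in> T}
        = {z \<in> uhp. orbit \<Gamma> z \<in> S \<inter> T}" by auto
    finally show "open {z \<in> uhp. orbit \<Gamma> z \<in> S \<inter> T}" .
  next
    fix \<K> assume *: "\<forall>K\<in>\<K>. K \<subseteq> orbit \<Gamma> ` uhp \<and> open {z \<in> uhp. orbit \<Gamma> z \<in> K}"
    have "{z \<in> uhp. orbit \<Gamma> z \<in> \<Union>\<K>} = (\<Union>K\<in>\<K>. {z \<in> uhp. orbit \<Gamma> z \<in> K})" by auto
    then show "open {z \<in> uhp. orbit \<Gamma> z \<in> \<Union>\<K>}" using * by auto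
  qed auto
  then show ?thesis unfolding orbit_space_def by (simp add: topology_inverse')
qed

definition simple_closed_curve_in :: "'a topology \<Rightarrow> 'a set \<Rightarrow> bool" where
  "simple_closed_curve_in X C \<longleftrightarrow> C \<subseteq> topspace X \<and>
     subtopology X C homeomorphic_space top_of_set (sphere (0::complex) 1)"

text \<open>The genus of a connected orientable surface, compact or not: the largest number of pairwise
  disjoint simple closed curves which together do not disconnect it.  Punctures do not contribute,
  so this is also the genus of the compactification of a punctured surface.\<close>

definition genus :: "'a topology \<Rightarrow> nat" where
  "genus X = (GREATEST n. \<exists>\<C>. finite \<C> \<and> card \<C> = n \<and> pairwise disjnt \<C> \<and>
     (\<forall>C\<in>\<C>. simple_closed_curve_in X C) \<and> connectedin X (topspace X - \<Union>\<C>))"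

text \<open>The boundary \<open>\<real> \<union> {\<infinity>}\<close> is the set of lines through the origin in the real plane
  (\<open>x\<close> is the line spanned by \<open>(x,1)\<close>, infinity the one spanned by \<open>(1,0)\<close>), on which matrices act
  linearly.\<close>

definition line_act :: "(real^2^2) set \<Rightarrow> (real^2) set \<Rightarrow> (real^2) set" where
  "line_act \<gamma> L = (\<lambda>v. rep \<gamma> *v v) ` L"

definition cusp_points :: "(real^2^2) set set \<Rightarrow> (real^2) set set" where
  "cusp_points \<Gamma> = {L. (\<exists>v. v \<noteq> 0 \<and> L = span {v}) \<and> (\<exists>\<gamma>\<in>\<Gamma>. parabolic \<gamma> \<and> line_act \<gamma> L = L)}"

definition number_of_cusps :: "(real^2^2) set set \<Rightarrow> nat" where
  "number_of_cusps \<Gamma> = card ((\<lambda>L. (\<lambda>\<gamma>. line_act \<gamma> L) ` \<Gamma>) ` cusp_points \<Gamma>)"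


section \<open>Group presentations and Fricke--Klein generators\<close>

text \<open>A word in the generators \<open>x\<^sub>i\<close> and their inverses; \<open>(i, True)\<close> is \<open>x\<^sub>i\<close> and
  \<open>(i, False)\<close> its inverse.\<close>

type_synonym word = "(nat \<times> bool) list"

definition eval_word :: "('a, 'b) monoid_scheme \<Rightarrow> (nat \<Rightarrow> 'a) \<Rightarrow> word \<Rightarrow> 'a" where
  "eval_word G x w =
     foldr (\<lambda>(i, b) y. (if b then x i else inv\<^bsub>G\<^esub> (x i)) \<otimes>\<^bsub>G\<^esub> y) w \<one>\<^bsub>G\<^esub>"

text \<open>Equality of words in the group with generators \<open>x\<^sub>i\<close> (\<open>i \<in> I\<close>) and relators \<open>R\<close>.\<close>

inductive pres_eq :: "nat set \<Rightarrow> word set \<Rightarrow> word \<Rightarrow> word \<Rightarrow> bool" for I R where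
  refl: "pres_eq I R w w"
| sym: "pres_eq I R v w \<Longrightarrow> pres_eq I R w v"
| trans: "pres_eq I R u v \<Longrightarrow> pres_eq I R v w \<Longrightarrow> pres_eq I R u w"
| cancel: "i \<in> I \<Longrightarrow> pres_eq I R (u @ [(i, b), (i, \<not> b)] @ v) (u @ v)"
| relator: "r \<in> R \<Longrightarrow> pres_eq I R (u @ r @ v) (u @ v)"

text \<open>The elements \<open>x i\<close> (\<open>i \<in> I\<close>) generate \<open>G\<close> with \<open>R\<close> as a system of defining relators.\<close>

definition presents :: "('a, 'b) monoid_scheme \<Rightarrow> nat set \<Rightarrow> (nat \<Rightarrow> 'a) \<Rightarrow> word set \<Rightarrow> bool" where
  "presents G I x R \<longleftrightarrow> x ` I \<subseteq> carrier G \<and> generate G (x ` I) = carrier G \<and>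
     (\<forall>w \<in> lists (I \<times> UNIV). eval_word G x w = \<one>\<^bsub>G\<^esub> \<longleftrightarrow> pres_eq I R w [])"

definition fricke_klein_relator :: "nat \<Rightarrow> nat \<Rightarrow> word" where
  "fricke_klein_relator g m =
     concat (map (\<lambda>j. [(j, True), (g + j, True), (j, False), (g + j, False)]) [1..<g+1])
     @ map (\<lambda>i. (i, True)) [2*g+1..<2*g+m+1]"

definition fricke_klein_generators ::
    "(real^2^2) set set \<Rightarrow> nat \<Rightarrow> nat \<Rightarrow> (nat \<Rightarrow> (real^2^2) set) \<Rightarrow> bool" where
  "fricke_klein_generators \<Gamma> g m \<gamma> \<longleftrightarrow>
     (\<forall>i\<in>{1..2*g}. hyperbolic (\<gamma> i)) \<and> (\<forall>i\<in>{2*g+1..2*g+m}. parabolic (\<gamma> i)) \<and>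
     presents (PSL2R\<lparr>carrier := \<Gamma>\<rparr>) {1..2*g+m} \<gamma> {fricke_klein_relator g m}"


section \<open>Group rings and the augmentation ideal\<close>

text \<open>Elements are finitely supported coefficient functions, extended by zero outside the group;
  multiplication is convolution.\<close>

definition group_ring :: "('a, 'b) monoid_scheme \<Rightarrow> ('a \<Rightarrow> 'r::comm_ring_1) ring" where
  "group_ring G =
     \<lparr>carrier = {f. finite {x. f x \<noteq> 0} \<and> {x. f x \<noteq> 0} \<subseteq> carrier G},
      monoid.mult = (\<lambda>f h x. \<Sum>(y, z) | f y \<noteq> 0 \<and> h z \<noteq> 0 \<and> y \<otimes>\<^bsub>G\<^esub> z = x. f y * h z),
      one = (\<lambda>x. if x = \<one>\<^bsub>G\<^esub> then 1 else 0),
      zero = (\<lambda>x. 0),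
      add = (\<lambda>f h x. f x + h x)\<rparr>"

definition gr_single :: "'a \<Rightarrow> 'a \<Rightarrow> 'r::comm_ring_1" where
  "gr_single y = (\<lambda>x. if x = y then 1 else 0)"

definition gr_degree :: "('a \<Rightarrow> 'r::comm_ring_1) \<Rightarrow> 'r" where
  "gr_degree f = (\<Sum>x | f x \<noteq> 0. f x)"

definition augmentation_ideal :: "('a, 'b) monoid_scheme \<Rightarrow> ('a \<Rightarrow> int) set" where
  "augmentation_ideal G = a_kernel (group_ring G) int_ring gr_degree"

primrec ideal_pow :: "('a, 'b) ring_scheme \<Rightarrow> 'a set \<Rightarrow> nat \<Rightarrow> 'a set" where
  "ideal_pow R I 0 = carrier R"
| "ideal_pow R I (Suc n) = ideal_prod R (ideal_pow R I n) I"


section \<open>The slash action and higher-order modular forms\<close>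

text \<open>Infinite real differentiability on an open set: all iterated directional derivatives are
  (Frechet) differentiable.\<close>

primrec times_differentiable_on ::
    "nat \<Rightarrow> 'a::real_normed_vector set \<Rightarrow> ('a \<Rightarrow> 'b::real_normed_vector) \<Rightarrow> bool" where
  "times_differentiable_on 0 S f \<longleftrightarrow> continuous_on S f"
| "times_differentiable_on (Suc n) S f \<longleftrightarrow> (\<forall>x\<in>S. f differentiable (at x)) \<and>
     (\<forall>v. times_differentiable_on n S (\<lambda>x. frechet_derivative f (at x) v))"

definition smooth_on :: "'a::real_normed_vector set \<Rightarrow> ('a \<Rightarrow> 'b::real_normed_vector) \<Rightarrow> bool" where
  "smooth_on S f \<longleftrightarrow> (\<forall>n. times_differentiable_on n S f)"

text \<open>Functions on the upper half-plane are represented by functions on the complex plane that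
  vanish outside it.\<close>

definition slash :: "int \<Rightarrow> (complex \<Rightarrow> complex) \<Rightarrow> (real^2^2) set \<Rightarrow> complex \<Rightarrow> complex" where
  "slash k f \<gamma> z = (if z \<in> uhp then autfactor \<gamma> z powi (- k) * f (moebius \<gamma> z) else 0)"

definition slash_ring ::
    "int \<Rightarrow> (complex \<Rightarrow> complex) \<Rightarrow> ((real^2^2) set \<Rightarrow> complex) \<Rightarrow> complex \<Rightarrow> complex" where
  "slash_ring k f \<delta> z = (\<Sum>\<gamma> | \<delta> \<gamma> \<noteq> 0. \<delta> \<gamma> * slash k f \<gamma> z)"

text \<open>The action of integral group ring elements, through the inclusion of the integral group ring
  in the complex one.\<close>

abbreviation slash_int ::
    "int \<Rightarrow> (complex \<Rightarrow> complex) \<Rightarrow> ((real^2^2) set \<Rightarrow> int) \<Rightarrow> complex \<Rightarrow> complex" where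
  "slash_int k f \<delta> \<equiv> slash_ring k f (\<lambda>\<gamma>. of_int (\<delta> \<gamma>))"

definition complex_ring :: "complex ring" where
  "complex_ring = \<lparr>carrier = UNIV, monoid.mult = (*), one = 1, zero = 0, add = (+)\<rparr>"

text \<open>The ring multiplication is a field of every module record; it plays no role for modules.\<close>

definition M_forms ::
    "int \<Rightarrow> (real^2^2) set set \<Rightarrow> nat \<Rightarrow> (complex, complex \<Rightarrow> complex) module" where
  "M_forms k \<Gamma> s =
     \<lparr>carrier = {f. smooth_on uhp f \<and> (\<forall>z. z \<notin> uhp \<longrightarrow> f z = 0) \<and>
        (\<forall>\<delta> \<in> ideal_pow (group_ring (PSL2R\<lparr>carrier := \<Gamma>\<rparr>))
                 (augmentation_ideal (PSL2R\<lparr>carrier := \<Gamma>\<rparr>)) s. slash_int k f \<delta> = (\<lambda>z. 0))},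
      monoid.mult = undefined, one = undefined,
      zero = (\<lambda>z. 0), add = (\<lambda>f h z. f z + h z), smult = (\<lambda>c f z. c * f z)\<rparr>"


section \<open>Direct sums and short exact sequences of modules\<close>

definition direct_sum :: "'i set \<Rightarrow> ('i \<Rightarrow> ('a, 'b) module) \<Rightarrow> ('a, 'i \<Rightarrow> 'b) module" where
  "direct_sum I N =
     \<lparr>carrier = {x \<in> (\<Pi>\<^sub>E i\<in>I. carrier (N i)). finite {i\<in>I. x i \<noteq> \<zero>\<^bsub>N i\<^esub>}},
      monoid.mult = undefined, one = undefined,
      zero = (\<lambda>i\<in>I. \<zero>\<^bsub>N i\<^esub>),
      add = (\<lambda>x y. \<lambda>i\<in>I. x i \<oplus>\<^bsub>N i\<^esub> y i),
      smult = (\<lambda>c x. \<lambda>i\<in>I. c \<odot>\<^bsub>N i\<^esub> x i)\<rparr>"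

definition linear_map ::
    "('a, 'r) ring_scheme \<Rightarrow> ('a, 'b) module \<Rightarrow> ('a, 'c) module \<Rightarrow> ('b \<Rightarrow> 'c) \<Rightarrow> bool" where
  "linear_map R M N h \<longleftrightarrow> module R M \<and> module R N \<and> h \<in> carrier M \<rightarrow> carrier N \<and>
     (\<forall>x\<in>carrier M. \<forall>y\<in>carrier M. h (x \<oplus>\<^bsub>M\<^esub> y) = h x \<oplus>\<^bsub>N\<^esub> h y) \<and>
     (\<forall>c\<in>carrier R. \<forall>x\<in>carrier M. h (c \<odot>\<^bsub>M\<^esub> x) = c \<odot>\<^bsub>N\<^esub> h x)"

text \<open>Exactness of \<open>0 \<rightarrow> A \<rightarrow> B \<rightarrow> C \<rightarrow> 0\<close>.\<close>

definition short_exact ::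
    "('r, 'z) ring_scheme \<Rightarrow> ('r, 'a) module \<Rightarrow> ('r, 'b) module \<Rightarrow> ('r, 'c) module
      \<Rightarrow> ('a \<Rightarrow> 'b) \<Rightarrow> ('b \<Rightarrow> 'c) \<Rightarrow> bool" where
  "short_exact R A B C \<iota> \<pi> \<longleftrightarrow> linear_map R A B \<iota> \<and> linear_map R B C \<pi> \<and>
     inj_on \<iota> (carrier A) \<and> \<iota> ` carrier A = a_kernel B C \<pi> \<and> \<pi> ` carrier B = carrier C"


section \<open>The map \<open>\<psi>\<close>\<close>

definition multi_indices :: "nat \<Rightarrow> nat \<Rightarrow> nat list set" where
  "multi_indices n s = {is. length is = s \<and> set is \<subseteq> {1..n}}"

text \<open>The product \<open>(\<gamma> i\<^sub>1 - 1) \<cdots> (\<gamma> i\<^sub>s - 1)\<close> in the integral group ring of \<open>\<Gamma>\<close>.\<close>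

definition gen_prod ::
    "(real^2^2) set set \<Rightarrow> (nat \<Rightarrow> (real^2^2) set) \<Rightarrow> nat list \<Rightarrow> (real^2^2) set \<Rightarrow> int" where
  "gen_prod \<Gamma> \<gamma> is = (let Z = group_ring (PSL2R\<lparr>carrier := \<Gamma>\<rparr>) in
     foldr (\<lambda>i p. (gr_single (\<gamma> i) \<ominus>\<^bsub>Z\<^esub> \<one>\<^bsub>Z\<^esub>) \<otimes>\<^bsub>Z\<^esub> p) is \<one>\<^bsub>Z\<^esub>)"

definition psi ::
    "int \<Rightarrow> (real^2^2) set set \<Rightarrow> (nat \<Rightarrow> (real^2^2) set) \<Rightarrow> nat \<Rightarrow> nat
      \<Rightarrow> (complex \<Rightarrow> complex) \<Rightarrow> nat list \<Rightarrow> complex \<Rightarrow> complex" where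
  "psi k \<Gamma> \<gamma> n s f = (\<lambda>is\<in>multi_indices n s. slash_int k f (gen_prod \<Gamma> \<gamma> is))"

end

theory Submission
  imports Defs "HOL-Library.Function_Algebras"
begin

text \<open>
  Call \<open>f\<close> invariant modulo a \<open>\<Gamma>\<close>-stable space \<open>W\<close> of smooth functions if \<open>f|c - f \<in> W\<close> for all
  \<open>c \<in> \<Gamma>\<close>, and write \<open>T W\<close> for the space of these \<open>f\<close>.  Since \<open>J\<close> is spanned by the elements
  \<open>c - 1\<close>, a function is mapped into \<open>W\<close> by \<open>J\<^sup>s\<close> iff it lies in the \<open>s\<close>-fold iterate \<open>T\<^sup>s W\<close>
  (\<open>annihilated_by_augmentation_power\<close>); in particular forms of order \<open>s\<close> make up \<open>T\<^sup>s 0\<close>.  Membership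
  in \<open>T W\<close> only has to be tested on generators of \<open>\<Gamma>\<close>, so \<open>f \<in> T\<^sup>s W\<close> says that all \<open>s\<close>-fold differences
  \<open>f|(\<gamma>\<^bsub>i1\<^esub> - 1)...(\<gamma>\<^bsub>is\<^esub> - 1)\<close> lie in \<open>W\<close> (\<open>inv_mod_power_iff_diffs\<close>).  The last generator ends the
  relator and occurs nowhere else in it, so the first \<open>2g+m-1\<close> ones generate \<open>\<Gamma>\<close>.  With \<open>W = 0\<close> this
  computes the kernel of \<open>\<psi>\<close>, with \<open>W = T 0\<close> it shows that \<open>\<psi>\<close> takes its values in forms of order \<open>1\<close>
  and that every smooth \<open>f\<close> whose \<open>s\<close>-fold differences are such forms has order \<open>s+1\<close>.

  Surjectivity therefore reduces, by induction on \<open>s\<close> (\<open>diffs_surjective\<close>), to solving the equations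
  \<open>f|\<gamma>\<^sub>i - f = \<phi>\<^sub>i\<close> for \<open>i \<le> 2g+m-1\<close> with arbitrary smooth \<open>\<phi>\<^sub>i\<close>.  The relator leaves the values of a
  cocycle on these generators free, because the value on the last generator can be chosen to make the
  cocycle vanish on the relator (\<open>cocycle_extension_free\<close>).  And every cocycle \<open>c\<close> with values in smooth
  functions is a coboundary (\<open>smooth_cocycle_is_coboundary\<close>): this is where the absence of a growth
  condition enters.  For a partition of unity \<open>\<rho>\<^sub>b\<close> of the upper half-plane that is permuted by \<open>\<Gamma>\<close>, and an
  equivariant choice of \<open>a b \<in> \<Gamma>\<close>, the function \<open>f = - \<Sum>\<^sub>b \<rho>\<^sub>b c(a b)\<close> satisfies \<open>f|d - f = c(d)\<close>.  The
  partition of unity is indexed by the full modular group and built from one bump function supported in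
  a strip that meets every orbit; local finiteness is the reduction theory of the modular group.

  All this presupposes \<open>m \<ge> 1\<close>.  The parabolic element provides a cusp, but as the cardinality of
  an infinite set is \<open>0\<close>, one also has to know that there are only finitely many cusps.  This follows from
  finite generation of \<open>\<Gamma>\<close> (\<open>number_of_cusps_pos\<close>).
\<close>

section \<open>Matrices and their classes in PSL(2,R)\<close>

definition cls :: "real^2^2 \<Rightarrow> (real^2^2) set" where
  "cls A = {A, - A}"

lemma mat2_mult:
  "(A ** B) $ i $ j = A $ i $ 1 * B $ 1 $ j + A $ i $ 2 * B $ 2 $ j" for A B :: "real^2^2"
  by (simp add: matrix_matrix_mult_def sum_2)

lemma mat2_eq_iff:
  "A = B \<longleftrightarrow> A$1$1 = B$1$1 \<and> A$1$2 = B$1$2 \<and> A$2$1 = B$2$1 \<and> A$2$2 = B$2$2"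
  for A B :: "real^2^2"
  by (auto simp: vec_eq_iff forall_2)

lemma mat2_one: "(mat 1 :: real^2^2) $ i $ j = (if i = j then 1 else 0)"
  by (simp add: mat_def)

lemma uminus_matrix_mult [simp]:
  "(- A) ** B = - (A ** B)" "A ** (- B) = - (A ** B)" for A B :: "real^2^2"
  by (simp_all add: mat2_eq_iff mat2_mult)

lemma det_uminus2 [simp]: "det (- A) = det A" for A :: "real^2^2"
  by (simp add: det_2)

lemma group_SL2R: "group SL2R"
proof (rule groupI)
  fix A assume "A \<in> carrier SL2R"
  then have d: "det A = 1" by (simp add: SL2R_def)
  then obtain B where B: "B ** A = mat 1"
    by (metis invertible_det_nz invertible_def zero_neq_one)
  moreover from this have "det B = 1"
    using d by (metis det_I det_mul mult.right_neutral)
  ultimately show "\<exists>B\<in>carrier SL2R. B \<otimes>\<^bsub>SL2R\<^esub> A = \<one>\<^bsub>SL2R\<^esub>"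
    by (auto simp: SL2R_def)
qed (auto simp: SL2R_def det_mul matrix_mul_assoc)

lemma normal_pm1: "{mat 1, - mat 1} \<lhd> SL2R"
proof -
  interpret group SL2R by (rule group_SL2R)
  have "subgroup {mat 1, - mat 1} SL2R"
  proof (rule subgroupI)
    have "inv\<^bsub>SL2R\<^esub> (- mat 1) = - mat 1"
      by (rule inv_equality) (auto simp: SL2R_def)
    moreover have "inv\<^bsub>SL2R\<^esub> (mat 1) = mat 1"
      by (rule inv_equality) (auto simp: SL2R_def)
    ultimately show "inv\<^bsub>SL2R\<^esub> A \<in> {mat 1, - mat 1}" if "A \<in> {mat 1, - mat 1}" for A
      using that by auto
  qed (auto simp: SL2R_def)
  then show ?thesis
    by (intro normalI) (auto simp: r_coset_def l_coset_def SL2R_def)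
qed

lemma group_PSL2R: "group PSL2R"
  unfolding PSL2R_def by (rule normal.factorgroup_is_group[OF normal_pm1])

lemma carrier_PSL2R: "carrier PSL2R = cls ` {A. det A = 1}"
  by (auto simp: PSL2R_def carrier_FactGroup r_coset_def SL2R_def cls_def image_def)

lemma cls_in_PSL2R [simp]: "det A = 1 \<Longrightarrow> cls A \<in> carrier PSL2R"
  by (simp add: carrier_PSL2R)

lemma one_PSL2R: "\<one>\<^bsub>PSL2R\<^esub> = cls (mat 1)"
  by (simp add: PSL2R_def cls_def)

lemma mult_PSL2R: "cls A \<otimes>\<^bsub>PSL2R\<^esub> cls B = cls (A ** B)"
  by (auto simp: PSL2R_def set_mult_def SL2R_def cls_def)

lemma cls_eq_iff: "cls A = cls B \<longleftrightarrow> A = B \<or> A = - B"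
  by (auto simp: cls_def doubleton_eq_iff)

lemma rep_cls: "rep (cls A) = A \<or> rep (cls A) = - A"
proof -
  have "rep (cls A) \<in> cls A" unfolding rep_def by (rule someI[of _ A]) (simp add: cls_def)
  then show ?thesis by (auto simp: cls_def)
qed

lemma rep_PSL2R:
  assumes "\<alpha> \<in> carrier PSL2R"
  shows "det (rep \<alpha>) = 1" "cls (rep \<alpha>) = \<alpha>"
proof -
  obtain A where A: "det A = 1" "\<alpha> = cls A" using assms by (auto simp: carrier_PSL2R)
  with rep_cls[of A] show "det (rep \<alpha>) = 1" by auto
  from A rep_cls[of A] show "cls (rep \<alpha>) = \<alpha>" by (simp add: cls_eq_iff)
qed

lemma rep_mult:
  assumes "\<alpha> \<in> carrier PSL2R" "\<beta> \<in> carrier PSL2R"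
  shows "rep (\<alpha> \<otimes>\<^bsub>PSL2R\<^esub> \<beta>) = rep \<alpha> ** rep \<beta> \<or> rep (\<alpha> \<otimes>\<^bsub>PSL2R\<^esub> \<beta>) = - (rep \<alpha> ** rep \<beta>)"
  using rep_cls mult_PSL2R rep_PSL2R(2) assms by metis

section \<open>The action on the upper half-plane and the slash action\<close>

definition den :: "real^2^2 \<Rightarrow> complex \<Rightarrow> complex" where
  "den A z = of_real (A $ 2 $ 1) * z + of_real (A $ 2 $ 2)"

definition num :: "real^2^2 \<Rightarrow> complex \<Rightarrow> complex" where
  "num A z = of_real (A $ 1 $ 1) * z + of_real (A $ 1 $ 2)"

definition mat_moebius :: "real^2^2 \<Rightarrow> complex \<Rightarrow> complex" where
  "mat_moebius A z = num A z / den A z"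

lemma autfactor_den: "autfactor \<gamma> = den (rep \<gamma>)"
  by (simp add: fun_eq_iff autfactor_def den_def)

lemma moebius_eq_mat_moebius: "moebius \<gamma> = mat_moebius (rep \<gamma>)"
  by (simp add: fun_eq_iff moebius_def autfactor_den mat_moebius_def num_def)

lemma den_uminus [simp]: "den (- A) z = - den A z"
  by (simp add: den_def)

lemma num_uminus [simp]: "num (- A) z = - num A z"
  by (simp add: num_def)

lemma mat_moebius_uminus [simp]: "mat_moebius (- A) z = mat_moebius A z"
  by (simp add: mat_moebius_def)

lemma mo_one [simp]: "mat_moebius (mat 1) z = z" 
  by (simp add: mat_moebius_def den_def num_def mat2_one)

lemma den_nonzero:
  assumes "det A = 1" "z \<in> uhp"
  shows "den A z \<noteq> 0"
proof
  assume "den A z = 0"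
  then have "Im (den A z) = 0" "Re (den A z) = 0" by simp_all
  then have "A$2$1 = 0" "A$2$2 = 0" using assms by (auto simp: den_def uhp_def)
  then show False using assms by (simp add: det_2)
qed

lemma Im_mat_moebius:
  assumes "det A = 1"
  shows "Im (mat_moebius A z) = Im z / (cmod (den A z))\<^sup>2"
proof -
  have "Im (num A z * cnj (den A z)) = det A * Im z"
    by (simp add: num_def den_def det_2 algebra_simps)
  then show ?thesis
    unfolding mat_moebius_def complex_div_cnj[of "num A z"] of_real_power[symmetric] Im_divide_of_real
    using assms by simp
qed

lemma mat_moebius_in_uhp: "det A = 1 \<Longrightarrow> z \<in> uhp \<Longrightarrow> mat_moebius A z \<in> uhp"
  using den_nonzero[of A z] by (simp add: uhp_def Im_mat_moebius)

lemma den_mult: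
  assumes "den B z \<noteq> 0"
  shows "den (A ** B) z = den A (mat_moebius B z) * den B z"
  using assms by (simp add: mat_moebius_def den_def num_def mat2_mult field_simps)

lemma mat_moebius_mult:
  assumes "den B z \<noteq> 0"
  shows "mat_moebius (A ** B) z = mat_moebius A (mat_moebius B z)"
proof -
  have "num (A ** B) z = num A (mat_moebius B z) * den B z"
    using assms by (simp add: mat_moebius_def den_def num_def mat2_mult field_simps)
  then show ?thesis using assms by (simp add: mat_moebius_def[of "A ** B"] mat_moebius_def[of A] den_mult)
qed

lemma moebius_in_uhp: "\<alpha> \<in> carrier PSL2R \<Longrightarrow> z \<in> uhp \<Longrightarrow> moebius \<alpha> z \<in> uhp"
  by (simp add: moebius_eq_mat_moebius mat_moebius_in_uhp rep_PSL2R)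

lemma autfactor_nonzero: "\<alpha> \<in> carrier PSL2R \<Longrightarrow> z \<in> uhp \<Longrightarrow> autfactor \<alpha> z \<noteq> 0"
  by (simp add: autfactor_den den_nonzero rep_PSL2R)

lemma moebius_cls: "moebius (cls A) = mat_moebius A"
  using rep_cls[of A] by (auto simp: moebius_eq_mat_moebius fun_eq_iff)

lemma moebius_mult:
  assumes "\<alpha> \<in> carrier PSL2R" "\<beta> \<in> carrier PSL2R" "z \<in> uhp"
  shows "moebius (\<alpha> \<otimes>\<^bsub>PSL2R\<^esub> \<beta>) z = moebius \<alpha> (moebius \<beta> z)"
  using rep_mult[OF assms(1,2)] den_nonzero[OF rep_PSL2R(1)[OF assms(2)] assms(3)]
  by (auto simp: moebius_eq_mat_moebius mat_moebius_mult)

lemma moebius_one [simp]: "moebius \<one>\<^bsub>PSL2R\<^esub> z = z"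
  by (simp add: one_PSL2R moebius_cls)

text \<open>The factor of automorphy is only a cocycle up to sign, because representatives of classes are chosen
  arbitrarily; an even weight removes the sign.\<close>

lemma autfactor_powi_mult:
  assumes "\<alpha> \<in> carrier PSL2R" "\<beta> \<in> carrier PSL2R" "z \<in> uhp" "even k"
  shows "autfactor (\<alpha> \<otimes>\<^bsub>PSL2R\<^esub> \<beta>) z powi (- k)
       = autfactor \<beta> z powi (- k) * autfactor \<alpha> (moebius \<beta> z) powi (- k)"
  using rep_mult[OF assms(1,2)] den_nonzero[OF rep_PSL2R(1)[OF assms(2)] assms(3)] assms(4)
  by (auto simp: autfactor_den moebius_eq_mat_moebius den_mult power_int_mult_distrib power_int_minus_left)

lemma slash_slash:
  assumes "\<alpha> \<in> carrier PSL2R" "\<beta> \<in> carrier PSL2R" "even k"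
  shows "slash k (slash k f \<alpha>) \<beta> = slash k f (\<alpha> \<otimes>\<^bsub>PSL2R\<^esub> \<beta>)"
proof
  fix z
  show "slash k (slash k f \<alpha>) \<beta> z = slash k f (\<alpha> \<otimes>\<^bsub>PSL2R\<^esub> \<beta>) z"
    by (cases "z \<in> uhp")
      (use assms in \<open>simp_all add: slash_def moebius_in_uhp autfactor_powi_mult moebius_mult\<close>)
qed

lemma slash_one:
  assumes "\<forall>z. z \<notin> uhp \<longrightarrow> f z = 0" "even k"
  shows "slash k f \<one>\<^bsub>PSL2R\<^esub> = f"
proof -
  have "autfactor \<one>\<^bsub>PSL2R\<^esub> z = 1 \<or> autfactor \<one>\<^bsub>PSL2R\<^esub> z = - 1" for z
    using rep_cls[of "mat 1"] by (auto simp: one_PSL2R autfactor_den den_def mat2_one)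
  then have "autfactor \<one>\<^bsub>PSL2R\<^esub> z powi (- k) = 1" for z
    using assms(2) by (metis even_minus power_int_1_left power_int_minus_left)
  then show ?thesis using assms(1) by (auto simp: slash_def fun_eq_iff)
qed

section \<open>Calculus of smooth functions\<close>

text \<open>Smoothness is handled order by order: the closure properties below are proved by induction on the
  number of derivatives, since the derivative of a sum, product or composite is again built from the
  parts and their derivatives.\<close>

abbreviation td :: "nat \<Rightarrow> 'a::real_normed_vector set \<Rightarrow> ('a \<Rightarrow> 'b::real_normed_vector) \<Rightarrow> bool" where
  "td \<equiv> times_differentiable_on"

lemma td_cong:
  assumes "open S" "\<And>x. x \<in> S \<Longrightarrow> f x = g x" "td n S f"
  shows "td n S g"
  using assms(2,3)
proof (induction n arbitrary: f g)
  case 0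
  then show ?case by (auto cong: continuous_on_cong)
next
  case (Suc n)
  have g: "(g has_derivative frechet_derivative f (at x)) (at x)" if "x \<in> S" for x
    by (rule has_derivative_transform_within_open[of f _ x UNIV S g])
      (use Suc.prems that assms(1) in \<open>auto simp flip: frechet_derivative_works\<close>)
  then have eq: "frechet_derivative f (at x) = frechet_derivative g (at x)" if "x \<in> S" for x
    using that frechet_derivative_at by blast
  have "td n S (\<lambda>x. frechet_derivative g (at x) v)" for v
    by (rule Suc.IH[of "\<lambda>x. frechet_derivative f (at x) v"]) (use eq Suc.prems in auto)
  then show ?case using g by (auto simp: differentiable_def)
qed

lemma td_SucI:
  assumes "open S" "\<And>x. x \<in> S \<Longrightarrow> (f has_derivative f' x) (at x)" "\<And>v. td n S (\<lambda>x. f' x v)"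
  shows "td (Suc n) S f"
proof -
  have "f' x = frechet_derivative f (at x)" if "x \<in> S" for x
    using assms(2)[OF that] frechet_derivative_at by blast
  then have "td n S (\<lambda>x. frechet_derivative f (at x) v)" for v
    using td_cong[OF assms(1) _ assms(3)[of v]] by simp
  then show ?thesis using assms(2) by (auto simp: differentiable_def)
qed

lemma td_SucD:
  assumes "td (Suc n) S f"
  shows "x \<in> S \<Longrightarrow> (f has_derivative frechet_derivative f (at x)) (at x)"
    and "td n S (\<lambda>x. frechet_derivative f (at x) v)"
  using assms by (auto simp flip: frechet_derivative_works)

lemma td_mono: "td (Suc n) S f \<Longrightarrow> td n S f"
proof (induction n arbitrary: f)
  case 0
  then show ?case
    by (auto intro!: continuous_at_imp_continuous_on differentiable_imp_continuous_within)
next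
  case (Suc n)
  then show ?case by (metis times_differentiable_on.simps(2))
qed

text \<open>For locally finite sums, which near each point agree with finite ones.\<close>

lemma td_local:
  assumes "\<And>x. x \<in> S \<Longrightarrow> \<exists>U. open U \<and> x \<in> U \<and> td n U f"
  shows "td n S f"
  using assms
proof (induction n arbitrary: f)
  case 0
  then show ?case
    by (metis continuous_at_imp_continuous_on continuous_on_eq_continuous_at times_differentiable_on.simps(1))
next
  case (Suc n)
  have "f differentiable (at x)" if "x \<in> S" for x
    using Suc.prems[OF that] by auto
  moreover have "td n S (\<lambda>x. frechet_derivative f (at x) v)" for v
    by (rule Suc.IH) (use Suc.prems in fastforce)
  ultimately show ?case by simp
qed

lemma td_subset:
  assumes "open T" "T \<subseteq> S" "td n S f"
  shows "td n T f"
  using assms(3)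
proof (induction n arbitrary: f)
  case 0
  then show ?case using assms by (auto intro: continuous_on_subset)
next
  case (Suc n)
  then show ?case using assms by auto
qed

lemma td_const: "open S \<Longrightarrow> td n S (\<lambda>x. c)"
proof (induction n arbitrary: c)
  case (Suc n)
  show ?case by (rule td_SucI[where f' = "\<lambda>x v. 0"]) (use Suc in auto)
qed simp

lemma td_bounded_linear:
  assumes "open S" "bounded_linear L" "td n S f"
  shows "td n S (\<lambda>x. L (f x))"
  using assms(3)
proof (induction n arbitrary: f)
  case 0
  then show ?case using bounded_linear.continuous_on[OF assms(2)] by auto
next
  case (Suc n)
  show ?case
    by (rule td_SucI[OF assms(1)])
      (use Suc td_SucD[OF Suc.prems] bounded_linear.has_derivative[OF assms(2)] in blast)+
qed

lemma td_ident: "open S \<Longrightarrow> td n S (\<lambda>x. x)"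
  by (cases n) (simp, metis td_SucI[OF _ has_derivative_ident] td_const)

lemma td_add:
  assumes "open S" "td n S f" "td n S g"
  shows "td n S (\<lambda>x. f x + g x)"
  using assms(2,3)
proof (induction n arbitrary: f g)
  case 0
  then show ?case by (auto intro: continuous_on_add)
next
  case (Suc n)
  show ?case
    by (rule td_SucI[OF assms(1) has_derivative_add[OF td_SucD(1)[OF Suc.prems(1)] td_SucD(1)[OF Suc.prems(2)]]])
      (use Suc.IH td_SucD(2)[OF Suc.prems(1)] td_SucD(2)[OF Suc.prems(2)] in auto)
qed

lemma td_sum:
  assumes "open S" "\<And>i. i \<in> I \<Longrightarrow> td n S (f i)"
  shows "td n S (\<lambda>x. \<Sum>i\<in>I. f i x)"
  using assms(2)
  by (induction I rule: infinite_finite_induct) (use assms(1) in \<open>auto intro!: td_const td_add\<close>)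

lemma td_bilinear:
  assumes "open S" "bounded_bilinear B" "td n S f" "td n S g"
  shows "td n S (\<lambda>x. B (f x) (g x))"
  using assms(3,4)
proof (induction n arbitrary: f g)
  case 0
  then show ?case using bounded_bilinear.continuous_on[OF assms(2)] by auto
next
  case (Suc n)
  have "td n S (\<lambda>x. B (f x) (frechet_derivative g (at x) v) + B (frechet_derivative f (at x) v) (g x))" for v
    by (intro td_add[OF assms(1)] Suc.IH td_mono[OF Suc.prems(1)] td_mono[OF Suc.prems(2)]
        td_SucD(2)[OF Suc.prems(1)] td_SucD(2)[OF Suc.prems(2)])
  then show ?case
    by (rule td_SucI[OF assms(1) bounded_bilinear.FDERIV[OF assms(2)
          td_SucD(1)[OF Suc.prems(1)] td_SucD(1)[OF Suc.prems(2)]], rotated 2])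
qed

lemmas td_mult = td_bilinear[OF _ bounded_bilinear_mult]

text \<open>The derivative of \<open>f\<close> at \<open>u x\<close> in the varying direction \<open>u' x v\<close> is expanded along a basis.  This
  exhibits it as a sum of products of directional derivatives of \<open>f\<close> in fixed directions, composed with
  \<open>u\<close>, and components of \<open>u'\<close>, to which the induction hypothesis applies.\<close>

lemma td_compose:
  fixes f :: "'a::euclidean_space \<Rightarrow> 'b::real_normed_vector"
  assumes "open S" "open T" "\<And>x. x \<in> S \<Longrightarrow> u x \<in> T" "td n T f" "td n S u"
  shows "td n S (\<lambda>x. f (u x))"
  using assms(4,5)
proof (induction n arbitrary: f)
  case 0
  then show ?case using continuous_on_compose2[of T f S u] assms(3) by auto
next
  case (Suc n)
  let ?D = "\<lambda>y. frechet_derivative f (at y)"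
  define u' where "u' x = frechet_derivative u (at x)" for x
  have D: "(f has_derivative ?D (u x)) (at (u x))" if "x \<in> S" for x
    using td_SucD(1)[OF Suc.prems(1)] assms(3)[OF that] by blast
  have u': "(u has_derivative u' x) (at x)" if "x \<in> S" for x
    using td_SucD(1)[OF Suc.prems(2) that] by (simp add: u'_def)
  have "((\<lambda>x. f (u x)) has_derivative (\<lambda>v. \<Sum>b\<in>Basis. (u' x v \<bullet> b) *\<^sub>R ?D (u x) b)) (at x)"
    if x: "x \<in> S" for x
  proof -
    interpret L: bounded_linear "?D (u x)"
      using D[OF x] by (rule has_derivative_bounded_linear)
    have "?D (u x) (u' x v) = (\<Sum>b\<in>Basis. (u' x v \<bullet> b) *\<^sub>R ?D (u x) b)" for v
      by (subst euclidean_representation[of "u' x v", symmetric]) (simp only: L.sum L.scaleR)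
    moreover have "((\<lambda>x. f (u x)) has_derivative (\<lambda>v. ?D (u x) (u' x v))) (at x)"
      using has_derivative_compose[OF u'[OF x] D[OF x]] .
    ultimately show ?thesis by simp
  qed
  then show ?case
  proof (rule td_SucI[OF assms(1)])
    fix v
    have "td n S (\<lambda>x. ?D (u x) b)" for b
      by (rule Suc.IH) (use td_SucD(2)[OF Suc.prems(1)] td_mono[OF Suc.prems(2)] in auto)
    moreover have "td n S (\<lambda>x. u' x v \<bullet> b)" for b
      unfolding u'_def
      by (rule td_bounded_linear[OF assms(1) bounded_linear_inner_left td_SucD(2)[OF Suc.prems(2)]])
    ultimately show "td n S (\<lambda>x. \<Sum>b\<in>Basis. (u' x v \<bullet> b) *\<^sub>R ?D (u x) b)"
      by (intro td_sum[OF assms(1)] td_bilinear[OF assms(1) bounded_bilinear_scaleR])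
  qed
qed

lemma td_inverse:
  fixes f :: "'a::real_normed_vector \<Rightarrow> 'b::real_normed_field"
  assumes "open S" "\<And>x. x \<in> S \<Longrightarrow> f x \<noteq> 0" "td n S f"
  shows "td n S (\<lambda>x. inverse (f x))"
  using assms(3)
proof (induction n)
  case 0
  then show ?case using assms(2) by (auto intro: continuous_on_inverse)
next
  case (Suc n)
  have "td n S (\<lambda>x. - (inverse (f x) * frechet_derivative f (at x) v * inverse (f x)))" for v
    using Suc.IH[OF td_mono[OF Suc.prems]] td_SucD(2)[OF Suc.prems] assms(1)
    by (intro td_bounded_linear[OF assms(1) bounded_linear_minus[OF bounded_linear_ident]] td_mult) auto
  then show ?case
    by (intro td_SucI[OF assms(1) Deriv.has_derivative_inverse[OF assms(2) td_SucD(1)[OF Suc.prems]]])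
qed

lemma td_power:
  fixes f :: "'a::real_normed_vector \<Rightarrow> 'b::real_normed_field"
  assumes "open S" "td n S f"
  shows "td n S (\<lambda>x. f x ^ j)"
  by (induction j) (use assms in \<open>auto intro!: td_const td_mult\<close>)

lemma td_power_int:
  fixes f :: "'a::real_normed_vector \<Rightarrow> 'b::real_normed_field"
  assumes "open S" "\<And>x. x \<in> S \<Longrightarrow> f x \<noteq> 0" "td n S f"
  shows "td n S (\<lambda>x. f x powi j)"
  by (cases "j \<ge> 0") (use assms in \<open>auto simp: power_int_def intro!: td_power td_inverse\<close>)

subsection \<open>A smooth cut-off function\<close>

text \<open>The functions \<open>t\<^bsup>-n\<^esup> exp (-1/t)\<close>, extended by zero.  Taken together they are closed under
  differentiation, so all of them are smooth as soon as each is differentiable at \<open>0\<close>.\<close>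

definition bump :: "nat \<Rightarrow> real \<Rightarrow> real" where
  "bump n t = (if t > 0 then inverse t ^ n * exp (- inverse t) else 0)"

text \<open>From \<open>exp (1/t) \<ge> (1/(k t))\<^sup>k\<close> with \<open>k = n + 2\<close>; the two spare factors \<open>t\<close> make the derivative
  at \<open>0\<close> vanish.\<close>

lemma bump_bound:
  obtains C where "\<And>t. \<bar>bump n t\<bar> \<le> C * t\<^sup>2"
proof
  fix t :: real
  let ?k = "n + 2"
  show "\<bar>bump n t\<bar> \<le> real ?k ^ ?k * t\<^sup>2"
  proof (cases "t > 0")
    case True
    have "inverse t / ?k \<le> exp (inverse t / ?k)"
      using exp_ge_add_one_self[of "inverse t / ?k"] by linarith
    then have "(inverse t / ?k) ^ ?k \<le> exp (inverse t / ?k) ^ ?k"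
      using True by (intro power_mono) auto
    also have "\<dots> = exp (inverse t)" by (subst exp_of_nat_mult[symmetric]) simp
    finally have "(inverse t / ?k) ^ ?k \<le> exp (inverse t)" .
    then have *: "inverse t ^ ?k \<le> ?k ^ ?k * exp (inverse t)"
      unfolding power_divide by (subst (asm) pos_divide_le_eq) (simp_all add: mult.commute del: power_add_numeral2 power_Suc)
    have "inverse t ^ n * exp (- inverse t) = inverse t ^ ?k * (exp (- inverse t) * t\<^sup>2)"
      using True by (simp add: power_add power2_eq_square field_simps)
    also have "\<dots> \<le> (?k ^ ?k * exp (inverse t)) * (exp (- inverse t) * t\<^sup>2)"
      by (rule mult_right_mono[OF *]) simp
    also have "\<dots> = ?k ^ ?k * t\<^sup>2" by (simp add: exp_minus)
    finally have "inverse t ^ n * exp (- inverse t) \<le> ?k ^ ?k * t\<^sup>2" .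
    moreover have "\<bar>bump n t\<bar> = inverse t ^ n * exp (- inverse t)"
      using True by (simp add: bump_def)
    ultimately show ?thesis by (simp only: of_nat_power)
  qed (simp add: bump_def)
qed

lemma bump_DERIV: "(bump n has_real_derivative bump (n + 2) t - n * bump (n + 1) t) (at t)"
proof -
  consider "t > 0" | "t < 0" | "t = 0" by linarith
  then show ?thesis
  proof cases
    case 1
    have "((\<lambda>t. inverse t ^ n * exp (- inverse t)) has_real_derivative bump (n + 2) t - n * bump (n + 1) t) (at t)"
      using 1 by (auto intro!: derivative_eq_intros simp: bump_def power2_eq_square)
        (cases n; simp add: algebra_simps)
    then show ?thesis
      by (rule has_field_derivative_transform_within_open[of _ _ _ "{0<..}"]) (use 1 in \<open>auto simp: bump_def\<close>)
  next
    case 2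
    have "((\<lambda>t. 0) has_real_derivative bump (n + 2) t - n * bump (n + 1) t) (at t)"
      using 2 by (simp add: bump_def)
    then show ?thesis
      by (rule has_field_derivative_transform_within_open[of _ _ _ "{..<0}"]) (use 2 in \<open>auto simp: bump_def\<close>)
  next
    case 3
    obtain C where C: "\<And>t. \<bar>bump n t\<bar> \<le> C * t\<^sup>2" using bump_bound[of n] by blast
    have "norm (bump n h / h) \<le> C * \<bar>h\<bar>" for h
      using C[of h] by (cases "h = 0") (auto simp: field_simps power2_eq_square abs_mult)
    then have "\<forall>\<^sub>F h in at 0. norm (bump n h / h) \<le> C * \<bar>h\<bar>" by simp
    then have "((\<lambda>h. bump n h / h) \<longlongrightarrow> 0) (at 0)"
      by (rule Lim_null_comparison) (rule tendsto_mult_right_zero[OF tendsto_rabs_zero[OF tendsto_ident_at]])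
    then show ?thesis using 3 by (simp add: DERIV_def) (simp add: bump_def)
  qed
qed

lemma td_bump: "td j UNIV (bump n)"
proof (induction j arbitrary: n)
  case 0
  show ?case using DERIV_continuous_on[OF bump_DERIV] by simp
next
  case (Suc j)
  have d: "(bump n has_derivative (\<lambda>v. (bump (n + 2) t - n * bump (n + 1) t) * v)) (at t)" for t
    using bump_DERIV[of n t] by (simp add: has_field_derivative_def)
  have "td j UNIV (\<lambda>t. (bump (n + 2) t + (- real n) * bump (n + 1) t) * v)" for v
    by (intro td_add td_mult td_const Suc.IH open_UNIV)
  then show ?case by (intro td_SucI[OF open_UNIV d]) simp
qed

subsection \<open>Smoothness and the slash action\<close>

lemma open_uhp: "open uhp"
  by (simp add: uhp_def open_halfspace_Im_gt)

lemma td_autfactor: "td n uhp (autfactor \<gamma>)"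
  unfolding autfactor_def [abs_def]
  by (intro td_add td_mult td_const td_ident open_uhp)

lemma td_moebius: "\<gamma> \<in> carrier PSL2R \<Longrightarrow> td n uhp (moebius \<gamma>)"
  unfolding moebius_def [abs_def] divide_inverse
  by (intro td_add td_mult td_const td_ident open_uhp td_inverse td_autfactor
        autfactor_nonzero)

lemma smooth_on_slash:
  assumes "\<gamma> \<in> carrier PSL2R" "smooth_on uhp f"
  shows "smooth_on uhp (slash k f \<gamma>)"
  unfolding smooth_on_def
proof
  fix n
  have "td n uhp (\<lambda>z. autfactor \<gamma> z powi (- k) * f (moebius \<gamma> z))"
  proof (intro td_mult open_uhp)
    show "td n uhp (\<lambda>z. autfactor \<gamma> z powi (- k))"
      using assms(1) by (intro td_power_int td_autfactor open_uhp autfactor_nonzero)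
    show "td n uhp (\<lambda>z. f (moebius \<gamma> z))"
      using assms
      by (intro td_compose[OF open_uhp open_uhp moebius_in_uhp _ td_moebius]) (auto simp: smooth_on_def)
  qed
  then show "td n uhp (slash k f \<gamma>)"
    by (rule td_cong[OF open_uhp, rotated]) (simp add: slash_def)
qed

section \<open>Group rings acting on functions\<close>

lemma carrier_group_ring:
  "carrier (group_ring G) = {f. finite {x. f x \<noteq> 0} \<and> {x. f x \<noteq> 0} \<subseteq> carrier G}"
  and mult_group_ring: "p \<otimes>\<^bsub>group_ring G\<^esub> q =
    (\<lambda>x. \<Sum>(y, z) | p y \<noteq> 0 \<and> q z \<noteq> 0 \<and> y \<otimes>\<^bsub>G\<^esub> z = x. p y * q z)"
  and one_group_ring: "\<one>\<^bsub>group_ring G\<^esub> = gr_single \<one>\<^bsub>G\<^esub>"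
  and zero_group_ring: "\<zero>\<^bsub>group_ring G\<^esub> = (\<lambda>x. 0)"
  and add_group_ring: "p \<oplus>\<^bsub>group_ring G\<^esub> q = (\<lambda>x. p x + q x)"
  by (simp_all add: group_ring_def gr_single_def fun_eq_iff)

lemma add_in_group_ring:
  assumes "p \<in> carrier (group_ring G)" "q \<in> carrier (group_ring G)"
  shows "p \<oplus>\<^bsub>group_ring G\<^esub> q \<in> carrier (group_ring G)"
proof -
  have "{x. p x + q x \<noteq> 0} \<subseteq> {x. p x \<noteq> 0} \<union> {x. q x \<noteq> 0}" by auto
  then show ?thesis
    using assms by (auto simp: carrier_group_ring add_group_ring intro: finite_subset)
qed

lemma single_in_group_ring: "c \<in> carrier G \<Longrightarrow> gr_single c \<in> carrier (group_ring G)"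
  by (simp add: carrier_group_ring gr_single_def)

lemma mult_group_ring_support:
  "{x. (p \<otimes>\<^bsub>group_ring G\<^esub> q) x \<noteq> 0}
     \<subseteq> (\<lambda>(y, z). y \<otimes>\<^bsub>G\<^esub> z) ` ({x. p x \<noteq> 0} \<times> {x. q x \<noteq> 0})"
proof
  fix x assume "x \<in> {x. (p \<otimes>\<^bsub>group_ring G\<^esub> q) x \<noteq> 0}"
  then have "{(y, z). p y \<noteq> 0 \<and> q z \<noteq> 0 \<and> y \<otimes>\<^bsub>G\<^esub> z = x} \<noteq> {}"
    unfolding mult_group_ring by (metis (mono_tags, lifting) mem_Collect_eq sum.empty)
  then show "x \<in> (\<lambda>(y, z). y \<otimes>\<^bsub>G\<^esub> z) ` ({x. p x \<noteq> 0} \<times> {x. q x \<noteq> 0})"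
    by auto
qed

context group
begin

lemma mult_in_group_ring:
  assumes "p \<in> carrier (group_ring G)" "q \<in> carrier (group_ring G)"
  shows "p \<otimes>\<^bsub>group_ring G\<^esub> q \<in> carrier (group_ring G)"
proof -
  let ?A = "(\<lambda>(y, z). y \<otimes> z) ` ({x. p x \<noteq> 0} \<times> {x. q x \<noteq> 0})"
  have "finite ?A" "?A \<subseteq> carrier G"
    using assms by (auto simp: carrier_group_ring)
  then show ?thesis
    using finite_subset[OF mult_group_ring_support[of G p q]] mult_group_ring_support[of G p q]
    unfolding carrier_group_ring by blast
qed

lemma minus_group_ring:
  assumes "p \<in> carrier (group_ring G)" "q \<in> carrier (group_ring G)"
  shows "p \<ominus>\<^bsub>group_ring G\<^esub> q = (\<lambda>x. p x - q x)"
proof -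
  have neg: "(\<lambda>x. - r x) \<in> carrier (group_ring G)" if "r \<in> carrier (group_ring G)"
    for r :: "'a \<Rightarrow> 'c::comm_ring_1"
    using that by (simp add: carrier_group_ring)
  have "abelian_group (group_ring G :: ('a \<Rightarrow> 'c) ring)"
  proof (rule abelian_groupI)
    fix r :: "'a \<Rightarrow> 'c" assume "r \<in> carrier (group_ring G)"
    then show "\<exists>r'\<in>carrier (group_ring G). r' \<oplus>\<^bsub>group_ring G\<^esub> r = \<zero>\<^bsub>group_ring G\<^esub>"
      by (intro bexI[OF _ neg]) (auto simp: add_group_ring zero_group_ring)
  qed (auto simp: add_in_group_ring, auto simp: carrier_group_ring add_group_ring zero_group_ring ac_simps)
  then have "\<ominus>\<^bsub>group_ring G\<^esub> q = (\<lambda>x. - q x)"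
    by (rule abelian_group.minus_equality)
      (use assms neg in \<open>auto simp: add_group_ring zero_group_ring\<close>)
  then show ?thesis by (simp add: a_minus_def add_group_ring)
qed

lemma augmentation_ideal_eq:
  "augmentation_ideal G = {p \<in> carrier (group_ring G). gr_degree p = 0}"
  by (simp add: augmentation_ideal_def a_kernel_def kernel_def)

lemma single_minus_one_in_augmentation_ideal:
  assumes "c \<in> carrier G"
  shows "gr_single c \<ominus>\<^bsub>group_ring G\<^esub> \<one>\<^bsub>group_ring G\<^esub> \<in> augmentation_ideal G"
proof -
  let ?p = "\<lambda>x. gr_single c x - gr_single \<one> x :: int"
  have p: "gr_single c \<ominus>\<^bsub>group_ring G\<^esub> \<one>\<^bsub>group_ring G\<^esub> = ?p"
    using assms by (simp add: minus_group_ring single_in_group_ring one_group_ring)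
  have "gr_degree ?p = (\<Sum>x\<in>{c, \<one>}. ?p x)"
    unfolding gr_degree_def by (rule sum.mono_neutral_left) (auto simp: gr_single_def)
  then have "gr_degree ?p = 0" by (cases "c = \<one>") (auto simp: gr_single_def)
  moreover have "?p \<in> carrier (group_ring G)"
    using assms by (auto simp: carrier_group_ring gr_single_def split: if_splits
        intro: finite_subset[of _ "{c, \<one>}"])
  ultimately show ?thesis by (simp add: augmentation_ideal_eq p)
qed

lemma ideal_pow_in_group_ring: "ideal_pow (group_ring G) (augmentation_ideal G) s \<subseteq> carrier (group_ring G)"
proof (induction s)
  case (Suc s)
  have "p \<in> carrier (group_ring G)"
    if "p \<in> ideal_prod (group_ring G) (ideal_pow (group_ring G) (augmentation_ideal G) s) (augmentation_ideal G)" for p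
    using that
    by induction (use Suc in \<open>auto simp: augmentation_ideal_eq intro: add_in_group_ring mult_in_group_ring\<close>)
  then show ?case by auto
qed simp

end

text \<open>A right action by linear maps on all functions, together with a stable subspace \<open>V\<close> on which the
  unit acts trivially.  For the slash action the unit kills values outside the upper half-plane, so it is
  the identity only on functions that vanish there.\<close>

locale function_action = group G for G (structure) +
  fixes act :: "('x \<Rightarrow> complex) \<Rightarrow> 'a \<Rightarrow> 'x \<Rightarrow> complex" and V :: "('x \<Rightarrow> complex) set"
  assumes act_add: "act (f + h) a = act f a + act h a"
    and act_scale: "act (\<lambda>z. c * f z) a = (\<lambda>z. c * act f a z)"
    and act_act: "a \<in> carrier G \<Longrightarrow> b \<in> carrier G \<Longrightarrow> act (act f a) b = act f (a \<otimes> b)"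
    and act_one: "f \<in> V \<Longrightarrow> act f \<one> = f"
    and V_zero: "0 \<in> V"
    and V_add: "f \<in> V \<Longrightarrow> h \<in> V \<Longrightarrow> f + h \<in> V"
    and V_scale: "f \<in> V \<Longrightarrow> (\<lambda>z. c * f z) \<in> V"
    and V_act: "f \<in> V \<Longrightarrow> a \<in> carrier G \<Longrightarrow> act f a \<in> V"
begin

definition subrep :: "('x \<Rightarrow> complex) set \<Rightarrow> bool" where
  "subrep W \<longleftrightarrow> W \<subseteq> V \<and> 0 \<in> W \<and> (\<forall>f\<in>W. \<forall>h\<in>W. f + h \<in> W) \<and>
     (\<forall>f\<in>W. \<forall>c. (\<lambda>z. c * f z) \<in> W) \<and> (\<forall>f\<in>W. \<forall>a\<in>carrier G. act f a \<in> W)"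

lemma subrep_V: "subrep V"
  by (simp add: subrep_def V_zero V_add V_scale V_act)

lemma act_zero: "act 0 a = 0"
  using act_scale[of 0 "\<lambda>_. 0" a] by (simp add: zero_fun_def)

lemma subrep_zero: "subrep {0}"
  by (auto simp: subrep_def V_zero act_zero)

lemma subrep_uminus: "subrep W \<Longrightarrow> f \<in> W \<Longrightarrow> - f \<in> W"
proof -
  have "- f = (\<lambda>z. - 1 * f z)" by (simp add: fun_eq_iff)
  then show "subrep W \<Longrightarrow> f \<in> W \<Longrightarrow> - f \<in> W" by (metis subrep_def)
qed

lemma subrep_add: "subrep W \<Longrightarrow> f \<in> W \<Longrightarrow> h \<in> W \<Longrightarrow> f + h \<in> W"
  unfolding subrep_def by blast

lemma subrep_diff: "subrep W \<Longrightarrow> f \<in> W \<Longrightarrow> h \<in> W \<Longrightarrow> f - h \<in> W"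
  using subrep_uminus[of W h] by (auto simp: subrep_def simp del: add_uminus_conv_diff
    simp flip: add_uminus_conv_diff)

lemma act_uminus: "act (- f) a = - act f a"
  using act_scale[of "-1" f a] by (simp add: fun_Compl_def)

lemma act_diff: "act (f - h) a = act f a - act h a"
  using act_add[of f "- h" a] by (simp add: act_uminus)

lemma act_sum: "act (\<lambda>z. \<Sum>i\<in>I. c i * f i z) a = (\<lambda>z. \<Sum>i\<in>I. c i * act (f i) a z)"
proof (induction I rule: infinite_finite_induct)
  case (insert i I)
  have "(\<lambda>z. \<Sum>i\<in>insert i I. c i * f i z) = (\<lambda>z. c i * f i z) + (\<lambda>z. \<Sum>i\<in>I. c i * f i z)"
    using insert by (simp add: fun_eq_iff)
  then show ?case using insert by (simp only: act_add act_scale) (simp add: fun_eq_iff)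
qed (use act_zero in \<open>auto simp: zero_fun_def\<close>)

lemma subrep_sum:
  assumes "subrep W" "\<And>i. i \<in> I \<Longrightarrow> f i \<in> W"
  shows "(\<lambda>z. \<Sum>i\<in>I. c i * f i z) \<in> W"
  using assms(2)
proof (induction I rule: infinite_finite_induct)
  case (insert i I)
  have "(\<lambda>z. \<Sum>i\<in>insert i I. c i * f i z) = (\<lambda>z. c i * f i z) + (\<lambda>z. \<Sum>i\<in>I. c i * f i z)"
    using insert by (simp add: fun_eq_iff)
  then show ?case using insert assms(1) by (simp add: subrep_def)
qed (use assms in \<open>auto simp: subrep_def zero_fun_def\<close>)

subsection \<open>The group ring\<close>

definition ring_act :: "('x \<Rightarrow> complex) \<Rightarrow> ('a \<Rightarrow> int) \<Rightarrow> 'x \<Rightarrow> complex" where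
  "ring_act f p = (\<lambda>z. \<Sum>c | p c \<noteq> 0. of_int (p c) * act f c z)"

lemma ring_act_superset:
  assumes "finite A" "{c. p c \<noteq> 0} \<subseteq> A"
  shows "ring_act f p = (\<lambda>z. \<Sum>c\<in>A. of_int (p c) * act f c z)"
  unfolding ring_act_def by (intro ext sum.mono_neutral_left) (use assms in auto)

lemma ring_act_add:
  assumes "p \<in> carrier (group_ring G)" "q \<in> carrier (group_ring G)"
  shows "ring_act f (p \<oplus>\<^bsub>group_ring G\<^esub> q) = ring_act f p + ring_act f q"
proof -
  let ?A = "{x. p x \<noteq> 0} \<union> {x. q x \<noteq> 0}"
  have fin: "finite ?A" using assms by (simp add: carrier_group_ring)
  show ?thesis
    unfolding add_group_ring
    by (subst (1 2 3) ring_act_superset[OF fin]) (auto simp: fun_eq_iff sum.distrib ring_distribs)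
qed

lemma ring_act_mult:
  assumes p: "p \<in> carrier (group_ring G)" and q: "q \<in> carrier (group_ring G)"
  shows "ring_act f (p \<otimes>\<^bsub>group_ring G\<^esub> q) = ring_act (ring_act f p) q"
proof
  fix z
  let ?P = "{x. p x \<noteq> 0}" and ?Q = "{x. q x \<noteq> 0}" and ?m = "\<lambda>(y, z). y \<otimes> z"
  have fin: "finite ?P" "finite ?Q" and sub: "?P \<subseteq> carrier G" "?Q \<subseteq> carrier G"
    using assms by (auto simp: carrier_group_ring)
  let ?t = "\<lambda>(c, d). of_int (p c) * of_int (q d) * act f (c \<otimes> d) z"
  have "ring_act f (p \<otimes>\<^bsub>group_ring G\<^esub> q) z
      = (\<Sum>x\<in>?m ` (?P \<times> ?Q). of_int ((p \<otimes>\<^bsub>group_ring G\<^esub> q) x) * act f x z)"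
    using ring_act_superset[OF _ mult_group_ring_support[of G p q], of f] fin by simp
  also have "\<dots> = (\<Sum>x\<in>?m ` (?P \<times> ?Q). \<Sum>y\<in>{y \<in> ?P \<times> ?Q. ?m y = x}. ?t y)"
  proof (rule sum.cong[OF HOL.refl])
    fix x
    have "{(y, z). p y \<noteq> 0 \<and> q z \<noteq> 0 \<and> y \<otimes> z = x} = {y \<in> ?P \<times> ?Q. ?m y = x}" by auto
    then show "of_int ((p \<otimes>\<^bsub>group_ring G\<^esub> q) x) * act f x z = (\<Sum>y\<in>{y \<in> ?P \<times> ?Q. ?m y = x}. ?t y)"
      unfolding mult_group_ring by (simp add: sum_distrib_right case_prod_beta)
  qed
  also have "\<dots> = (\<Sum>y\<in>?P \<times> ?Q. ?t y)"
    by (rule sum.image_gen[symmetric]) (use fin in simp)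
  also have "\<dots> = (\<Sum>d\<in>?Q. \<Sum>c\<in>?P. of_int (p c) * of_int (q d) * act f (c \<otimes> d) z)"
    by (subst sum.swap) (simp add: sum.cartesian_product)
  also have "\<dots> = ring_act (ring_act f p) q z"
    unfolding ring_act_def act_sum sum_distrib_left
    using sub by (intro sum.cong HOL.refl) (auto simp: act_act subset_iff)
  finally show "ring_act f (p \<otimes>\<^bsub>group_ring G\<^esub> q) z = ring_act (ring_act f p) q z" .
qed

lemma ring_act_in_subrep:
  assumes "subrep W" "f \<in> W" "p \<in> carrier (group_ring G)"
  shows "ring_act f p \<in> W"
  unfolding ring_act_def using assms
  by (intro subrep_sum) (auto simp: subrep_def carrier_group_ring)

lemma ring_act_one: "f \<in> V \<Longrightarrow> ring_act f \<one>\<^bsub>group_ring G\<^esub> = f"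
  by (simp add: ring_act_def one_group_ring gr_single_def act_one)

lemma ring_act_single_minus_one:
  assumes "f \<in> V" "c \<in> carrier G"
  shows "ring_act f (gr_single c \<ominus>\<^bsub>group_ring G\<^esub> \<one>\<^bsub>group_ring G\<^esub>) = act f c - f"
proof -
  have "ring_act f (gr_single c \<ominus>\<^bsub>group_ring G\<^esub> \<one>\<^bsub>group_ring G\<^esub>)
     = (\<lambda>z. \<Sum>x\<in>{c, \<one>}. of_int (gr_single c x - gr_single \<one> x) * act f x z)"
    using assms
    by (simp add: minus_group_ring single_in_group_ring one_group_ring)
      (subst ring_act_superset[of "{c, \<one>}"], auto simp: gr_single_def split: if_splits)
  then show ?thesis
    by (cases "c = \<one>") (use assms in \<open>auto simp: gr_single_def fun_eq_iff act_one\<close>)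
qed

subsection \<open>Functions invariant modulo a subrepresentation\<close>

definition inv_mod :: "('x \<Rightarrow> complex) set \<Rightarrow> ('x \<Rightarrow> complex) set" where
  "inv_mod W = {f \<in> V. \<forall>c\<in>carrier G. act f c - f \<in> W}"

lemma subrep_inv_mod:
  assumes W: "subrep W"
  shows "subrep (inv_mod W)"
proof -
  have "act f a \<in> inv_mod W" if "f \<in> inv_mod W" "a \<in> carrier G" for f a
  proof -
    have "act (act f a) c - act f a \<in> W" if c: "c \<in> carrier G" for c
    proof -
      have "act (act f a) c - act f a = (act f (a \<otimes> c) - f) - (act f a - f)"
        using \<open>a \<in> carrier G\<close> c by (simp add: act_act)
      also have "\<dots> \<in> W"
        by (rule subrep_diff[OF W]) (use \<open>f \<in> inv_mod W\<close> \<open>a \<in> carrier G\<close> c in \<open>auto simp: inv_mod_def\<close>)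
      finally show ?thesis .
    qed
    then show ?thesis using that by (simp add: inv_mod_def V_act)
  qed
  moreover have "f + h \<in> inv_mod W" if "f \<in> inv_mod W" "h \<in> inv_mod W" for f h
  proof -
    have "act (f + h) c - (f + h) = (act f c - f) + (act h c - h)" for c by (simp add: act_add)
    then show ?thesis
      using that subrep_add[OF W] V_add[of f h] by (simp only: inv_mod_def mem_Collect_eq) blast
  qed
  moreover have "(\<lambda>z. e * f z) \<in> inv_mod W" if "f \<in> inv_mod W" for f e
  proof -
    have "act (\<lambda>z. e * f z) c - (\<lambda>z. e * f z) = (\<lambda>z. e * (act f c - f) z)" for c
      by (simp add: act_scale fun_eq_iff right_diff_distrib)
    moreover have "(\<lambda>z. e * (act f c - f) z) \<in> W" if "c \<in> carrier G" for c
      using \<open>f \<in> inv_mod W\<close> that W unfolding subrep_def inv_mod_def by blast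
    ultimately show ?thesis using that V_scale[of f] by (simp only: inv_mod_def mem_Collect_eq) blast
  qed
  moreover have "act 0 c - 0 = (0 :: 'x \<Rightarrow> complex)" for c by (simp only: act_zero diff_self)
  then have "0 \<in> inv_mod W" using W V_zero by (simp only: inv_mod_def mem_Collect_eq subrep_def) blast
  moreover have "inv_mod W \<subseteq> V" by (auto simp: inv_mod_def)
  ultimately show ?thesis unfolding subrep_def by blast
qed

lemma subrep_inv_mod_power: "subrep W \<Longrightarrow> subrep ((inv_mod ^^ s) W)"
  by (induction s) (auto intro: subrep_inv_mod)

text \<open>If \<open>p\<close> has degree zero then \<open>\<Sum>\<^sub>c p c (f|c) = \<Sum>\<^sub>c p c (f|c - f)\<close>.\<close>

lemma augmentation_ideal_inv_mod:
  assumes W: "subrep W" and "f \<in> inv_mod W" "p \<in> augmentation_ideal G"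
  shows "ring_act f p \<in> W"
proof -
  have p: "{c. p c \<noteq> 0} \<subseteq> carrier G" "gr_degree p = 0"
    using assms by (auto simp: augmentation_ideal_eq carrier_group_ring)
  have "ring_act f p = (\<lambda>z. \<Sum>c | p c \<noteq> 0. of_int (p c) * (act f c - f) z)"
  proof
    fix z
    have "(\<Sum>c | p c \<noteq> 0. of_int (p c)) = (of_int (gr_degree p) :: complex)"
      by (simp add: gr_degree_def)
    then have "(\<Sum>c | p c \<noteq> 0. of_int (p c) * f z) = 0"
      using p by (simp flip: sum_distrib_right)
    then show "ring_act f p z = (\<Sum>c | p c \<noteq> 0. of_int (p c) * (act f c - f) z)"
      by (simp add: ring_act_def right_diff_distrib sum_subtractf)
  qed
  also have "\<dots> \<in> W"
    by (rule subrep_sum[OF W, where f = "\<lambda>c. act f c - f"])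
      (use p assms in \<open>auto simp: inv_mod_def\<close>)
  finally show ?thesis .
qed

text \<open>The induction on \<open>s\<close> is over all \<open>W\<close> simultaneously.  An element of \<open>J\<^bsup>s+1\<^esup>\<close> is a sum of products
  \<open>a b\<close> with \<open>a \<in> J\<^sup>s\<close> and \<open>b \<in> J\<close>, so \<open>J\<^bsup>s+1\<^esup>\<close> maps \<open>f\<close> into \<open>W\<close> iff \<open>J\<^sup>s\<close> maps \<open>f\<close> into the functions that are
  invariant modulo \<open>W\<close>; the induction hypothesis is used for that larger space.\<close>

theorem annihilated_by_augmentation_power:
  assumes "subrep W"
  shows "{f \<in> V. \<forall>p\<in>ideal_pow (group_ring G) (augmentation_ideal G) s. ring_act f p \<in> W}
     = (inv_mod ^^ s) W"
  using assms
proof (induction s arbitrary: W)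
  case 0
  have "\<one>\<^bsub>group_ring G\<^esub> \<in> carrier (group_ring G)"
    by (simp add: one_group_ring single_in_group_ring)
  then have "f \<in> W" if "f \<in> V" "\<forall>p\<in>carrier (group_ring G). ring_act f p \<in> W" for f
    using that ring_act_one by metis
  then show ?case
    using ring_act_in_subrep[OF 0] 0 by (auto simp: subrep_def)
next
  case (Suc s)
  let ?R = "group_ring G :: ('a \<Rightarrow> int) ring" and ?J = "augmentation_ideal G"
  have "(\<forall>p\<in>ideal_prod ?R (ideal_pow ?R ?J s) ?J. ring_act f p \<in> W)
    \<longleftrightarrow> (\<forall>p\<in>ideal_pow ?R ?J s. ring_act f p \<in> inv_mod W)" if f: "f \<in> V" for f
  proof (intro iffI ballI)
    fix p assume *: "\<forall>p\<in>ideal_prod ?R (ideal_pow ?R ?J s) ?J. ring_act f p \<in> W"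
      and p: "p \<in> ideal_pow ?R ?J s"
    have pc: "p \<in> carrier ?R" using p ideal_pow_in_group_ring by blast
    then have fp: "ring_act f p \<in> V" using f ring_act_in_subrep subrep_V by blast
    have "act (ring_act f p) c - ring_act f p \<in> W" if c: "c \<in> carrier G" for c
    proof -
      let ?d = "gr_single c \<ominus>\<^bsub>?R\<^esub> \<one>\<^bsub>?R\<^esub>"
      have d: "?d \<in> ?J" using c by (rule single_minus_one_in_augmentation_ideal)
      then have "ring_act (ring_act f p) ?d = ring_act f (p \<otimes>\<^bsub>?R\<^esub> ?d)"
        using pc by (simp add: ring_act_mult augmentation_ideal_eq)
      then show ?thesis
        using bspec[OF * ideal_prod.prod[OF p d]] fp c by (simp add: ring_act_single_minus_one)
    qed
    then show "ring_act f p \<in> inv_mod W" using fp by (simp add: inv_mod_def)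
  next
    fix q assume *: "\<forall>p\<in>ideal_pow ?R ?J s. ring_act f p \<in> inv_mod W"
      and "q \<in> ideal_prod ?R (ideal_pow ?R ?J s) ?J"
    from this(2) have "ring_act f q \<in> W \<and> q \<in> carrier ?R"
    proof induction
      case (prod a b)
      then have "a \<in> carrier ?R" "b \<in> carrier ?R"
        using ideal_pow_in_group_ring by (auto simp: augmentation_ideal_eq)
      then show ?case
        using prod * augmentation_ideal_inv_mod[OF Suc.prems] by (auto simp: ring_act_mult mult_in_group_ring)
    next
      case (sum a b)
      then show ?case
        using subrep_add[OF Suc.prems] by (metis ring_act_add add_in_group_ring)
    qed
    then show "ring_act f q \<in> W" ..
  qed
  then have "{f \<in> V. \<forall>p\<in>ideal_pow ?R ?J (Suc s). ring_act f p \<in> W}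
    = {f \<in> V. \<forall>p\<in>ideal_pow ?R ?J s. ring_act f p \<in> inv_mod W}" by auto
  then show ?case
    using Suc.IH[OF subrep_inv_mod[OF Suc.prems]] by (simp add: funpow_Suc_right del: funpow.simps)
qed

lemma inv_mod_mono: "W \<subseteq> W' \<Longrightarrow> inv_mod W \<subseteq> inv_mod W'"
  by (auto simp: inv_mod_def)

lemma inv_mod_power_mono: "(inv_mod ^^ s) {0} \<subseteq> (inv_mod ^^ Suc s) {0}"
proof (induction s)
  case 0
  have "0 \<in> inv_mod {0}" using subrep_inv_mod[OF subrep_zero] by (simp add: subrep_def)
  then show ?case by (simp only: funpow.simps id_apply comp_apply) blast
next
  case (Suc s)
  then show ?case using inv_mod_mono by simp
qed

text \<open>The group elements \<open>c\<close> with \<open>f|c - f \<in> W\<close> form a subgroup, since \<open>W\<close> is stable.\<close>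

lemma inv_mod_from_generators:
  assumes W: "subrep W" and "f \<in> V" "X \<subseteq> carrier G" "generate G X = carrier G"
    and X: "\<And>x. x \<in> X \<Longrightarrow> act f x - f \<in> W"
  shows "f \<in> inv_mod W"
proof -
  have "act f c - f \<in> W \<and> c \<in> carrier G" if "c \<in> generate G X" for c
    using that
  proof induction
    case one
    have "act f \<one> - f = 0" using assms by (simp only: act_one diff_self)
    then show ?case using W by (metis subrep_def one_closed)
  next
    case (incl h)
    then show ?case using X assms(3) by blast
  next
    case (inv h)
    then have h: "h \<in> carrier G" using assms(3) by blast
    have "act f (inv h) - f = - act (act f h - f) (inv h)"
      using h \<open>f \<in> V\<close> by (simp only: act_diff act_act act_one inv_closed r_inv minus_diff_eq)
    moreover have "act (act f h - f) (inv h) \<in> W"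
      using X[OF inv] h W unfolding subrep_def by blast
    ultimately show ?case using subrep_uminus[OF W] h by (metis inv_closed)
  next
    case (eng a b)
    have "act f (a \<otimes> b) - f = act (act f a - f) b + (act f b - f)"
      using eng by (simp only: act_diff act_act) simp
    moreover have "act (act f a - f) b \<in> W" using eng W unfolding subrep_def by blast
    ultimately show ?case using eng subrep_add[OF W] by (metis m_closed)
  qed
  then show ?thesis using assms(2,4) unfolding inv_mod_def by blast
qed

subsection \<open>Iterated differences\<close>

definition diffs :: "(nat \<Rightarrow> 'a) \<Rightarrow> nat list \<Rightarrow> ('x \<Rightarrow> complex) \<Rightarrow> 'x \<Rightarrow> complex" where
  "diffs \<gamma> is = fold (\<lambda>i f. act f (\<gamma> i) - f) is"

lemma diffs_simps [simp]:
  "diffs \<gamma> [] f = f" "diffs \<gamma> (i # is) f = diffs \<gamma> is (act f (\<gamma> i) - f)"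
  by (simp_all add: diffs_def)

lemma difference_in_V: "f \<in> V \<Longrightarrow> c \<in> carrier G \<Longrightarrow> act f c - f \<in> V"
  using subrep_diff[OF subrep_V] V_act by blast

lemma ring_act_gen_prod:
  assumes "f \<in> V" "\<And>i. i \<in> set is \<Longrightarrow> \<gamma> i \<in> carrier G"
  shows "ring_act f (foldr (\<lambda>i p. (gr_single (\<gamma> i) \<ominus>\<^bsub>group_ring G\<^esub> \<one>\<^bsub>group_ring G\<^esub>) \<otimes>\<^bsub>group_ring G\<^esub> p)
           is \<one>\<^bsub>group_ring G\<^esub>) = diffs \<gamma> is f"
    (is "ring_act f (?P is) = _")
  using assms
proof (induction "is" arbitrary: f)
  case Nil
  then show ?case by (simp add: ring_act_one)
next
  case (Cons i "is")
  let ?d = "gr_single (\<gamma> i) \<ominus>\<^bsub>group_ring G\<^esub> \<one>\<^bsub>group_ring G\<^esub> :: 'a \<Rightarrow> int"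
  have d: "gr_single (\<gamma> i) \<ominus>\<^bsub>group_ring G\<^esub> \<one>\<^bsub>group_ring G\<^esub> \<in> (carrier (group_ring G) :: ('a \<Rightarrow> int) set)" if "\<gamma> i \<in> carrier G"
    for i using single_minus_one_in_augmentation_ideal[OF that] by (simp add: augmentation_ideal_eq)
  have "?P js \<in> carrier (group_ring G)" if "\<And>i. i \<in> set js \<Longrightarrow> \<gamma> i \<in> carrier G" for js
    using that by (induction js)
      (simp add: one_group_ring single_in_group_ring, simp add: mult_in_group_ring d)
  then show ?case
    using Cons.IH[OF difference_in_V[OF Cons.prems(1), of "\<gamma> i"]] Cons.prems d
    by (simp add: ring_act_mult ring_act_single_minus_one del: minus_apply)
qed

lemma inv_mod_power_iff_diffs:
  assumes W: "subrep W" and "f \<in> V"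
    and \<gamma>: "\<And>i. i \<in> {1..n} \<Longrightarrow> \<gamma> i \<in> carrier G" "generate G (\<gamma> ` {1..n}) = carrier G"
  shows "f \<in> (inv_mod ^^ s) W \<longleftrightarrow> (\<forall>is\<in>multi_indices n s. diffs \<gamma> is f \<in> W)"
  using assms(2)
proof (induction s arbitrary: f)
  case 0
  then show ?case by (simp add: multi_indices_def)
next
  case (Suc s)
  have multi: "multi_indices n (Suc s) = (\<Union>i\<in>{1..n}. (#) i ` multi_indices n s)"
    by (auto simp: multi_indices_def length_Suc_conv)
  have "f \<in> (inv_mod ^^ Suc s) W \<longleftrightarrow> (\<forall>i\<in>{1..n}. act f (\<gamma> i) - f \<in> (inv_mod ^^ s) W)"
  proof
    assume "\<forall>i\<in>{1..n}. act f (\<gamma> i) - f \<in> (inv_mod ^^ s) W"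
    then have "f \<in> inv_mod ((inv_mod ^^ s) W)"
      using inv_mod_from_generators[OF subrep_inv_mod_power[OF W] Suc.prems _ \<gamma>(2)] \<gamma>(1) by blast
    then show "f \<in> (inv_mod ^^ Suc s) W" by simp
  next
    assume "f \<in> (inv_mod ^^ Suc s) W"
    then have "f \<in> inv_mod ((inv_mod ^^ s) W)" by simp
    then show "\<forall>i\<in>{1..n}. act f (\<gamma> i) - f \<in> (inv_mod ^^ s) W"
      using \<gamma>(1) unfolding inv_mod_def by blast
  qed
  also have "\<dots> \<longleftrightarrow> (\<forall>i\<in>{1..n}. \<forall>is\<in>multi_indices n s. diffs \<gamma> (i # is) f \<in> W)"
  proof (rule ball_cong[OF HOL.refl])
    fix i assume "i \<in> {1..n}"
    then show "act f (\<gamma> i) - f \<in> (inv_mod ^^ s) W \<longleftrightarrow> (\<forall>is\<in>multi_indices n s. diffs \<gamma> (i # is) f \<in> W)"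
      unfolding diffs_simps by (intro Suc.IH difference_in_V Suc.prems \<gamma>(1))
  qed
  also have "\<dots> \<longleftrightarrow> (\<forall>is\<in>multi_indices n (Suc s). diffs \<gamma> is f \<in> W)"
    unfolding multi by blast
  finally show ?case .
qed

text \<open>The first difference is solved for last: the induction hypothesis produces functions \<open>\<phi>\<^sub>i\<close> whose
  differences of order \<open>s\<close> are the given \<open>H (i # is)\<close>, and then \<open>f\<close> is chosen with \<open>f|\<gamma>\<^sub>i - f = \<phi>\<^sub>i\<close>.\<close>

lemma diffs_surjective:
  assumes solve: "\<And>\<phi>. (\<And>i. i \<in> {1..n} \<Longrightarrow> \<phi> i \<in> V) \<Longrightarrow> \<exists>f\<in>V. \<forall>i\<in>{1..n}. act f (\<gamma> i) - f = \<phi> i"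
    and "\<And>is. is \<in> multi_indices n s \<Longrightarrow> H is \<in> V"
  shows "\<exists>f\<in>V. \<forall>is\<in>multi_indices n s. diffs \<gamma> is f = H is"
  using assms(2)
proof (induction s arbitrary: H)
  case 0
  have "multi_indices n 0 = {[]}" by (auto simp: multi_indices_def)
  then show ?case using 0 by (intro bexI[of _ "H []"]) simp_all
next
  case (Suc s)
  have "\<exists>f\<in>V. \<forall>is\<in>multi_indices n s. diffs \<gamma> is f = H (i # is)" if "i \<in> {1..n}" for i
    by (rule Suc.IH) (use that Suc.prems in \<open>auto simp: multi_indices_def\<close>)
  then have "\<forall>i\<in>{1..n}. \<exists>f. f \<in> V \<and> (\<forall>is\<in>multi_indices n s. diffs \<gamma> is f = H (i # is))"
    by blast
  from bchoice[OF this] obtain \<phi> where \<phi>: "\<And>i. i \<in> {1..n} \<Longrightarrow> \<phi> i \<in> V"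
      "\<And>i is. i \<in> {1..n} \<Longrightarrow> is \<in> multi_indices n s \<Longrightarrow> diffs \<gamma> is (\<phi> i) = H (i # is)"
    by blast
  obtain f where "f \<in> V" "\<forall>i\<in>{1..n}. act f (\<gamma> i) - f = \<phi> i" using solve[of \<phi>] \<phi>(1) by auto
  moreover from this(2) have "diffs \<gamma> is f = H is" if js: "is \<in> multi_indices n (Suc s)" for "is"
  proof -
    obtain i js where "is = i # js" "i \<in> {1..n}" "js \<in> multi_indices n s"
      using js by (auto simp: multi_indices_def length_Suc_conv)
    then show ?thesis using \<phi>(2) \<open>\<forall>i\<in>{1..n}. act f (\<gamma> i) - f = \<phi> i\<close> by simp
  qed
  ultimately show ?case by blast
qed

end

section \<open>Cocycles from a presentation\<close>

lemma eval_word_simps [simp]: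
  "eval_word G x [] = \<one>\<^bsub>G\<^esub>"
  "eval_word G x ((i, b) # w) = (if b then x i else inv\<^bsub>G\<^esub> (x i)) \<otimes>\<^bsub>G\<^esub> eval_word G x w"
  by (simp_all add: eval_word_def)

definition inv_word :: "word \<Rightarrow> word" where
  "inv_word w = rev (map (\<lambda>(i, b). (i, \<not> b)) w)"

context group
begin

lemma eval_word_closed:
  "x ` I \<subseteq> carrier G \<Longrightarrow> w \<in> lists (I \<times> UNIV) \<Longrightarrow> eval_word G x w \<in> carrier G"
  by (induction w) auto

lemma eval_word_append:
  assumes "x ` I \<subseteq> carrier G" "u \<in> lists (I \<times> UNIV)" "v \<in> lists (I \<times> UNIV)"
  shows "eval_word G x (u @ v) = eval_word G x u \<otimes> eval_word G x v"
  using assms(2)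
proof (induction u)
  case Nil
  then show ?case using eval_word_closed[OF assms(1,3)] by simp
next
  case (Cons a u)
  then show ?case
    using assms(1) eval_word_closed[OF assms(1,3)] eval_word_closed[OF assms(1), of u]
    by (cases a) (auto simp: m_assoc)
qed

lemma inv_word_in: "w \<in> lists (I \<times> UNIV) \<Longrightarrow> inv_word w \<in> lists (I \<times> UNIV)"
  by (auto simp: inv_word_def in_lists_conv_set)

lemma eval_inv_word:
  assumes "x ` I \<subseteq> carrier G" "w \<in> lists (I \<times> UNIV)"
  shows "eval_word G x (inv_word w) = inv (eval_word G x w)"
  using assms(2)
proof (induction w)
  case (Cons a w)
  obtain i b where a: "a = (i, b)" "i \<in> I" using Cons.hyps by auto
  have w: "w \<in> lists (I \<times> UNIV)" using Cons by auto
  have xi: "x i \<in> carrier G" using assms(1) a by auto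
  have "eval_word G x (inv_word (a # w)) = eval_word G x (inv_word w @ [(i, \<not> b)])"
    by (simp add: inv_word_def a)
  also have "\<dots> = inv (eval_word G x w) \<otimes> eval_word G x [(i, \<not> b)]"
    using eval_word_append[OF assms(1) inv_word_in[OF w], of "[(i, \<not> b)]"] a Cons.IH by simp
  also have "\<dots> = inv (eval_word G x (a # w))"
    using xi eval_word_closed[OF assms(1) w] by (simp add: a inv_mult_group)
  finally show ?case .
qed (simp add: inv_word_def)

lemma generated_by_words:
  assumes "x ` I \<subseteq> carrier G" "c \<in> generate G (x ` I)"
  shows "\<exists>w\<in>lists (I \<times> UNIV). eval_word G x w = c"
  using assms(2)
proof induction
  case one
  show ?case by (rule bexI[of _ "[]"]) auto
next
  case (incl h)
  then obtain i where "i \<in> I" "h = x i" by auto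
  then show ?case using assms(1) by (intro bexI[of _ "[(i, True)]"]) auto
next
  case (inv h)
  then obtain i where "i \<in> I" "h = x i" by auto
  then show ?case using assms(1) by (intro bexI[of _ "[(i, False)]"]) auto
next
  case (eng a b)
  then obtain u v where "u \<in> lists (I \<times> UNIV)" "eval_word G x u = a"
    "v \<in> lists (I \<times> UNIV)" "eval_word G x v = b" by blast
  then show ?case
    using eval_word_append[OF assms(1)] by (intro bexI[of _ "u @ v"]) auto
qed

end

lemma pres_eq_in_lists:
  assumes "pres_eq I R u v" "R \<subseteq> lists (I \<times> UNIV)"
  shows "u \<in> lists (I \<times> UNIV) \<longleftrightarrow> v \<in> lists (I \<times> UNIV)"
  using assms by induction auto

context function_action
begin

text \<open>The Fox derivation on words with prescribed values \<open>\<phi>\<^sub>i\<close> on the generators.  If it vanishes on the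
  relators, it descends to a cocycle on the group.  The value on an inverse generator is forced by the
  cocycle identity for \<open>x\<^sub>i x\<^sub>i\<^sup>-\<^sup>1 = 1\<close>.\<close>

fun fox :: "(nat \<Rightarrow> 'a) \<Rightarrow> (nat \<Rightarrow> 'x \<Rightarrow> complex) \<Rightarrow> word \<Rightarrow> 'x \<Rightarrow> complex" where
  "fox x \<phi> [] = 0"
| "fox x \<phi> ((i, b) # w) =
     act (if b then \<phi> i else - act (\<phi> i) (inv (x i))) (eval_word G x w) + fox x \<phi> w"

lemma fox_in_V:
  assumes "x ` I \<subseteq> carrier G" "\<And>i. i \<in> I \<Longrightarrow> \<phi> i \<in> V" "w \<in> lists (I \<times> UNIV)"
  shows "fox x \<phi> w \<in> V"
  using assms(3)
proof (induction w)
  case (Cons a w)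
  obtain i b where a: "a = (i, b)" "i \<in> I" using Cons.hyps by auto
  have "- act (\<phi> i) (inv (x i)) \<in> V"
    by (rule subrep_uminus[OF subrep_V]) (use a assms in \<open>auto intro!: V_act\<close>)
  then have "(if b then \<phi> i else - act (\<phi> i) (inv (x i))) \<in> V" using a assms(2) by simp
  moreover have "w \<in> lists (I \<times> UNIV)" using Cons by simp
  ultimately show ?case
    unfolding a fox.simps using Cons.IH eval_word_closed[OF assms(1), of w] by (intro V_add V_act)
qed (simp only: fox.simps V_zero)

lemma fox_append:
  assumes "x ` I \<subseteq> carrier G" "u \<in> lists (I \<times> UNIV)" "v \<in> lists (I \<times> UNIV)"
  shows "fox x \<phi> (u @ v) = act (fox x \<phi> u) (eval_word G x v) + fox x \<phi> v"
  using assms(2)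
proof (induction u)
  case (Cons a u)
  obtain i b where a: "a = (i, b)" "i \<in> I" using Cons.hyps by auto
  have u: "u \<in> lists (I \<times> UNIV)" using Cons by auto
  note cl = eval_word_closed[OF assms(1) u] eval_word_closed[OF assms(1,3)]
  show ?case
    by (simp only: a append_Cons fox.simps Cons.IH eval_word_append[OF assms(1) u assms(3)]
        act_add act_act[OF cl] add.assoc)
qed (simp only: append_Nil fox.simps act_zero add_0_left)

lemma fox_cancel:
  assumes "x i \<in> carrier G" "\<phi> i \<in> V"
  shows "fox x \<phi> [(i, b), (i, \<not> b)] = 0"
  using assms by (cases b) (simp_all add: act_uminus act_act act_one)

text \<open>Deleting a subword that represents \<open>1\<close> and on which the derivation vanishes changes neither the
  value of a word in the group nor the value of the derivation.\<close>

lemma fox_respects: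
  assumes "pres_eq I R u v" "R \<subseteq> lists (I \<times> UNIV)" "x ` I \<subseteq> carrier G"
    and \<phi>: "\<And>i. i \<in> I \<Longrightarrow> \<phi> i \<in> V"
    and R: "\<And>r. r \<in> R \<Longrightarrow> fox x \<phi> r = 0" "\<And>r. r \<in> R \<Longrightarrow> eval_word G x r = \<one>"
    and u: "u \<in> lists (I \<times> UNIV)"
  shows "fox x \<phi> u = fox x \<phi> v \<and> eval_word G x u = eval_word G x v"
proof -
  have del: "fox x \<phi> (u @ r @ v) = fox x \<phi> (u @ v) \<and> eval_word G x (u @ r @ v) = eval_word G x (u @ v)"
    if r: "fox x \<phi> r = 0" "eval_word G x r = \<one>" and l: "u @ r @ v \<in> lists (I \<times> UNIV)" for u r v
  proof -
    have l': "u \<in> lists (I \<times> UNIV)" "r \<in> lists (I \<times> UNIV)" "v \<in> lists (I \<times> UNIV)"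
      "r @ v \<in> lists (I \<times> UNIV)" using l by auto
    note cl = eval_word_closed[OF assms(3) l'(1)] eval_word_closed[OF assms(3) l'(3)]
    show ?thesis
      by (simp only: fox_append[OF assms(3) l'(1,4)] fox_append[OF assms(3) l'(2,3)]
          fox_append[OF assms(3) l'(1,3)] eval_word_append[OF assms(3) l'(1,4)]
          eval_word_append[OF assms(3) l'(2,3)] eval_word_append[OF assms(3) l'(1,3)]
          r act_zero l_one cl add_0_left simp_thms)
  qed
  show ?thesis
    using assms(1) u
  proof induction
    case (sym v w)
    then show ?case using pres_eq_in_lists[OF sym.hyps(1) assms(2)] by simp
  next
    case (trans u v w)
    then show ?case using pres_eq_in_lists[OF trans.hyps(1) assms(2)] by simp
  next
    case (cancel i u b v)
    have "x i \<in> carrier G" "\<phi> i \<in> V" using cancel assms by auto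
    then show ?case
      using fox_cancel[of x i \<phi> b] cancel by (intro del) (auto split: if_splits)
  next
    case (relator r u v)
    then show ?case using R by (intro del) auto
  qed simp
qed

text \<open>Two words \<open>u\<close> and \<open>v\<close> for the same element have the same derivation, because it vanishes on
  both \<open>u v'\<close> and \<open>v v'\<close> where \<open>v'\<close> is the inverse word of \<open>v\<close>.\<close>

theorem cocycle_extension:
  assumes pres: "presents G I x R" and R: "R \<subseteq> lists (I \<times> UNIV)"
    and \<phi>: "\<And>i. i \<in> I \<Longrightarrow> \<phi> i \<in> V"
    and fox_R: "\<And>r. r \<in> R \<Longrightarrow> fox x \<phi> r = 0"
  obtains c where "\<And>a. a \<in> carrier G \<Longrightarrow> c a \<in> V"
    "\<And>a b. a \<in> carrier G \<Longrightarrow> b \<in> carrier G \<Longrightarrow> c (a \<otimes> b) = act (c a) b + c b"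
    "\<And>i. i \<in> I \<Longrightarrow> c (x i) = \<phi> i"
proof -
  have x: "x ` I \<subseteq> carrier G" and gen: "generate G (x ` I) = carrier G"
    and rel: "\<And>w. w \<in> lists (I \<times> UNIV) \<Longrightarrow> eval_word G x w = \<one> \<longleftrightarrow> pres_eq I R w []"
    using pres by (auto simp: presents_def)
  have eval_R: "eval_word G x r = \<one>" if "r \<in> R" for r
  proof -
    have "pres_eq I R ([] @ r @ []) ([] @ [])" using that by (rule pres_eq.relator)
    then show ?thesis using rel[of r] that R by auto
  qed
  have well: "fox x \<phi> u = fox x \<phi> v"
    if u: "u \<in> lists (I \<times> UNIV)" and v: "v \<in> lists (I \<times> UNIV)" and eq: "eval_word G x u = eval_word G x v" for u v
  proof -
    note iv = inv_word_in[OF v] and evc = eval_word_closed[OF x v]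
    have zero: "fox x \<phi> w = 0" if "w \<in> lists (I \<times> UNIV)" "eval_word G x w = \<one>" for w
    proof -
      have "pres_eq I R w []" using rel that by blast
      from fox_respects[of I R w "[]" x \<phi>, OF this R x \<phi> fox_R eval_R that(1)] show ?thesis by simp
    qed
    have e: "eval_word G x (inv_word v) = inv (eval_word G x v)"
      by (rule eval_inv_word[OF x v])
    have "fox x \<phi> (u @ inv_word v) = 0"
      using eval_word_append[OF x u iv] u iv evc by (intro zero) (simp_all only: e eq r_inv append_in_lists_conv simp_thms)
    moreover have "fox x \<phi> (v @ inv_word v) = 0"
      using eval_word_append[OF x v iv] v iv evc by (intro zero) (simp_all only: e r_inv append_in_lists_conv simp_thms)
    ultimately have "act (fox x \<phi> u) (inv (eval_word G x v)) = act (fox x \<phi> v) (inv (eval_word G x v))"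
      using fox_append[OF x u iv, of \<phi>] fox_append[OF x v iv, of \<phi>] e by (metis add_right_cancel)
    then have "act (act (fox x \<phi> u) (inv (eval_word G x v))) (eval_word G x v)
        = act (act (fox x \<phi> v) (inv (eval_word G x v))) (eval_word G x v)" by simp
    then show ?thesis
      using fox_in_V[of x I \<phi>, OF x \<phi> u] fox_in_V[of x I \<phi>, OF x \<phi> v]
      by (simp only: act_act[OF inv_closed[OF evc] evc] l_inv[OF evc] act_one)
  qed
  define W where "W a = (SOME w. w \<in> lists (I \<times> UNIV) \<and> eval_word G x w = a)" for a
  have W: "W a \<in> lists (I \<times> UNIV)" "eval_word G x (W a) = a" if "a \<in> carrier G" for a
  proof -
    have "\<exists>w. w \<in> lists (I \<times> UNIV) \<and> eval_word G x w = a"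
      using generated_by_words[OF x, of a] gen that by blast
    from someI_ex[OF this] show "W a \<in> lists (I \<times> UNIV)" "eval_word G x (W a) = a"
      unfolding W_def by auto
  qed
  show thesis
  proof (rule that[of "\<lambda>a. fox x \<phi> (W a)"])
    fix a assume a: "a \<in> carrier G"
    then show "fox x \<phi> (W a) \<in> V" using fox_in_V[of x I \<phi>, OF x \<phi>] W by blast
    fix b assume b: "b \<in> carrier G"
    have "fox x \<phi> (W (a \<otimes> b)) = fox x \<phi> (W a @ W b)"
      using a b W eval_word_append[OF x W(1)[OF a] W(1)[OF b]]
      by (intro well) (simp_all only: m_closed append_in_lists_conv simp_thms)
    then show "fox x \<phi> (W (a \<otimes> b)) = act (fox x \<phi> (W a)) b + fox x \<phi> (W b)"
      using fox_append[OF x W(1)[OF a] W(1)[OF b]] W(2)[OF b] by simp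
  next
    fix i assume i: "i \<in> I"
    then have xi: "x i \<in> carrier G" using x by auto
    have "fox x \<phi> (W (x i)) = fox x \<phi> [(i, True)]"
      by (rule well[OF W(1)[OF xi]]) (simp_all add: i xi W(2))
    then show "fox x \<phi> (W (x i)) = \<phi> i" using act_one[OF \<phi>[OF i]] by simp
  qed
qed

lemma fox_cong:
  "(\<And>i b. (i, b) \<in> set w \<Longrightarrow> \<phi> i = \<phi>' i) \<Longrightarrow> fox x \<phi> w = fox x \<phi>' w"
proof (induction w)
  case (Cons a w)
  obtain i b where a: "a = (i, b)" by (cases a)
  have "fox x \<phi> w = fox x \<phi>' w" by (rule Cons.IH) (use Cons.prems in auto)
  moreover have "\<phi> i = \<phi>' i" using Cons.prems a by auto
  ultimately show ?case by (simp add: a)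
qed simp

text \<open>A one-relator group whose relator ends in a generator that occurs nowhere else in it is free on the
  other generators.  For cocycles this means: the value on the last generator is chosen to be
  \<open>- c(u)|x\<^bsub>n+1\<^esub>\<close>, which makes the derivation vanish on the relator \<open>u x\<^bsub>n+1\<^esub>\<close>.\<close>

corollary cocycle_extension_free:
  assumes pres: "presents G {1..Suc n} x {u @ [(Suc n, True)]}" and u: "u \<in> lists ({1..n} \<times> UNIV)"
    and \<phi>: "\<And>i. i \<in> {1..n} \<Longrightarrow> \<phi> i \<in> V"
  obtains c where "\<And>a. a \<in> carrier G \<Longrightarrow> c a \<in> V"
    "\<And>a b. a \<in> carrier G \<Longrightarrow> b \<in> carrier G \<Longrightarrow> c (a \<otimes> b) = act (c a) b + c b"
    "\<And>i. i \<in> {1..n} \<Longrightarrow> c (x i) = \<phi> i"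
proof -
  define \<phi>' where "\<phi>' = \<phi>(Suc n := - act (fox x \<phi> u) (x (Suc n)))"
  have x: "x ` {1..Suc n} \<subseteq> carrier G" using pres by (simp add: presents_def)
  have u': "u \<in> lists ({1..Suc n} \<times> UNIV)" using u by (auto simp: in_lists_conv_set)
  have fu: "fox x \<phi> u \<in> V"
    by (rule fox_in_V[OF _ \<phi> u]) (use x in auto)
  have "x (Suc n) \<in> carrier G" using x by auto
  then have last: "- act (fox x \<phi> u) (x (Suc n)) \<in> V"
    using subrep_uminus[OF subrep_V V_act[OF fu]] by blast
  have \<phi>': "\<phi>' i \<in> V" if "i \<in> {1..Suc n}" for i
    using that \<phi> last by (cases "i = Suc n") (auto simp: \<phi>'_def)
  have "fox x \<phi>' u = fox x \<phi> u"
    by (rule fox_cong) (use u in \<open>auto simp: \<phi>'_def in_lists_conv_set\<close>)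
  then have "fox x \<phi>' (u @ [(Suc n, True)]) = 0"
    using fox_append[OF x u', of "[(Suc n, True)]" \<phi>'] \<open>x (Suc n) \<in> carrier G\<close> act_one[OF last]
    by (simp add: \<phi>'_def)
  then have relator: "fox x \<phi>' r = 0" if "r \<in> {u @ [(Suc n, True)]}" for r using that by simp
  have "{u @ [(Suc n, True)]} \<subseteq> lists ({1..Suc n} \<times> UNIV)" using u' by simp
  from cocycle_extension[OF pres this, of \<phi>', OF \<phi>' relator] obtain c where c:
    "\<And>a. a \<in> carrier G \<Longrightarrow> c a \<in> V"
    "\<And>a b. a \<in> carrier G \<Longrightarrow> b \<in> carrier G \<Longrightarrow> c (a \<otimes> b) = act (c a) b + c b"
    "\<And>i. i \<in> {1..Suc n} \<Longrightarrow> c (x i) = \<phi>' i"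
    by metis
  show thesis
    by (rule that[of c]) (use c in \<open>auto simp: \<phi>'_def\<close>)
qed

lemma generated_by_initial_generators:
  assumes pres: "presents G {1..Suc n} x {u @ [(Suc n, True)]}" and u: "u \<in> lists ({1..n} \<times> UNIV)"
  shows "generate G (x ` {1..n}) = carrier G"
proof -
  have x: "x ` {1..Suc n} \<subseteq> carrier G" and gen: "generate G (x ` {1..Suc n}) = carrier G"
    using pres by (simp_all add: presents_def)
  have xn: "x ` {1..n} \<subseteq> carrier G" using x by auto
  interpret S: subgroup "generate G (x ` {1..n})" G
    by (rule generate_is_subgroup[OF xn])
  have u': "u \<in> lists ({1..Suc n} \<times> UNIV)" using u by (auto simp: in_lists_conv_set)
  have xs: "x (Suc n) \<in> carrier G" using x by auto
  have "eval_word G x w \<in> generate G (x ` {1..n})" if "w \<in> lists ({1..n} \<times> UNIV)" for w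
    using that
  proof (induction w)
    case (Cons a w)
    then show ?case by (cases a) (auto intro!: generate.eng intro: generate.incl generate.inv)
  qed (simp only: eval_word_simps generate.one)
  then have eu: "eval_word G x u \<in> generate G (x ` {1..n})" using u by blast
  have "pres_eq {1..Suc n} {u @ [(Suc n, True)]} ([] @ (u @ [(Suc n, True)]) @ []) ([] @ [])"
    by (rule pres_eq.relator) simp
  then have "eval_word G x (u @ [(Suc n, True)]) = \<one>"
    using pres u' by (auto simp: presents_def)
  then have "eval_word G x u \<otimes> x (Suc n) = \<one>"
    using eval_word_append[OF x u', of "[(Suc n, True)]"] xs by simp
  then have "x (Suc n) = inv (eval_word G x u)"
    using xs eval_word_closed[OF x u'] by (metis inv_equality inv_inv inv_closed)
  then have "x (Suc n) \<in> generate G (x ` {1..n})" using S.m_inv_closed[OF eu] by (simp only:)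
  then have "x ` {1..Suc n} \<subseteq> generate G (x ` {1..n})"
    using generate.incl[of _ "x ` {1..n}" G] by (auto simp: le_Suc_eq)
  then show ?thesis
    using generate_subgroup_incl[OF _ S.subgroup_axioms] gen generate_incl[OF xn] by blast
qed

end

section \<open>Reduction theory of the modular group\<close>

definition mat2 :: "real \<Rightarrow> real \<Rightarrow> real \<Rightarrow> real \<Rightarrow> real^2^2" where
  "mat2 a b c d = (\<chi> i j. if i = 1 then (if j = 1 then a else b) else (if j = 1 then c else d))"

lemma mat2_nth [simp]:
  "mat2 a b c d $ 1 $ 1 = a" "mat2 a b c d $ 1 $ 2 = b"
  "mat2 a b c d $ 2 $ 1 = c" "mat2 a b c d $ 2 $ 2 = d"
  by (simp_all add: mat2_def)

lemma PSL2Z_in_PSL2R: "\<gamma> \<in> PSL2Z \<Longrightarrow> \<gamma> \<in> carrier PSL2R"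
  by (simp add: PSL2Z_def)

lemma rep_PSL2Z: "\<gamma> \<in> PSL2Z \<Longrightarrow> rep \<gamma> $ i $ j \<in> \<int>"
proof -
  assume \<gamma>: "\<gamma> \<in> PSL2Z"
  have "rep \<gamma> \<in> cls (rep \<gamma>)" by (simp add: cls_def)
  also have "cls (rep \<gamma>) = \<gamma>" using \<gamma> by (simp add: rep_PSL2R(2) PSL2Z_in_PSL2R)
  finally show "rep \<gamma> $ i $ j \<in> \<int>" using \<gamma> by (simp add: PSL2Z_def)
qed

lemma cls_in_PSL2Z:
  assumes "det A = 1" "\<And>i j. A $ i $ j \<in> \<int>"
  shows "cls A \<in> PSL2Z"
  using assms by (auto simp: PSL2Z_def cls_def[of A]) (simp flip: cls_def)

lemma mult_PSL2Z:
  assumes "\<alpha> \<in> PSL2Z" "\<beta> \<in> PSL2Z"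
  shows "\<alpha> \<otimes>\<^bsub>PSL2R\<^esub> \<beta> \<in> PSL2Z"
proof -
  have "\<alpha> \<otimes>\<^bsub>PSL2R\<^esub> \<beta> = cls (rep \<alpha> ** rep \<beta>)"
    using assms by (metis mult_PSL2R rep_PSL2R(2) PSL2Z_in_PSL2R)
  moreover have "cls (rep \<alpha> ** rep \<beta>) \<in> PSL2Z"
    using assms by (intro cls_in_PSL2Z)
      (auto simp: det_mul rep_PSL2R PSL2Z_in_PSL2R mat2_mult rep_PSL2Z)
  ultimately show ?thesis by simp
qed

text \<open>An open neighbourhood of the standard fundamental domain of the modular group.\<close>

definition strip :: "complex set" where
  "strip = {w. \<bar>Re w\<bar> < 1 \<and> Im w > 1/2}"

definition inversion :: "(real^2^2) set" where
  "inversion = cls (mat2 0 (- 1) 1 0)"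

lemma inversion_in_PSL2Z: "inversion \<in> PSL2Z"
  unfolding inversion_def by (rule cls_in_PSL2Z) (auto simp: det_2 mat2_def)

lemma moebius_inversion: "moebius inversion z = - 1 / z"
  by (simp add: inversion_def moebius_cls mat_moebius_def num_def den_def)

lemma translation_in_PSL2Z: "cls (mat2 1 (of_int t) 0 1) \<in> PSL2Z"
  by (rule cls_in_PSL2Z) (auto simp: det_2 mat2_def)

lemma moebius_translation: "moebius (cls (mat2 1 (of_int t) 0 1)) z = z + of_int t"
  by (simp add: moebius_cls mat_moebius_def num_def den_def)

text \<open>Inverting a point of height at most \<open>1/2\<close> whose real part is at most \<open>1/2\<close> in absolute value
  at least doubles its height.\<close>

lemma strip_meets_orbit_of_height:
  "(1/2) ^ Suc n < Im z \<Longrightarrow> \<exists>b\<in>PSL2Z. moebius b z \<in> strip"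
proof (induction n arbitrary: z)
  case 0
  have "moebius (cls (mat2 1 (of_int (- round (Re z))) 0 1)) z \<in> strip"
    using 0 of_int_round_abs_le[of "Re z"] unfolding moebius_translation
    by (simp add: strip_def abs_if split: if_splits)
  then show ?case using translation_in_PSL2Z by blast
next
  case (Suc n)
  define t where "t = cls (mat2 1 (of_int (- round (Re z))) 0 1)"
  define z' where "z' = z + of_int (- round (Re z))"
  have t: "t \<in> PSL2Z" "moebius t z = z'"
    using translation_in_PSL2Z[of "- round (Re z)"] moebius_translation[of "- round (Re z)" z]
    by (simp_all add: t_def z'_def)
  have z': "\<bar>Re z'\<bar> \<le> 1/2" "Im z' = Im z"
    using of_int_round_abs_le[of "Re z"] by (simp_all add: z'_def abs_minus_commute)
  have pos: "Im z > 0" using Suc.prems by (meson less_trans zero_less_power half_gt_zero zero_less_one)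
  show ?case
  proof (cases "Im z > 1/2")
    case True
    then have "moebius t z \<in> strip" using z' t by (simp add: strip_def)
    then show ?thesis using t by blast
  next
    case False
    have "(cmod z')\<^sup>2 \<le> 1/2"
    proof -
      have "(Re z')\<^sup>2 \<le> (1/2)\<^sup>2" "(Im z')\<^sup>2 \<le> (1/2)\<^sup>2"
        using z' False pos by (simp_all add: power2_le_iff_abs_le power_mono del: power_divide)
      then show ?thesis unfolding cmod_power2 by (simp add: power_divide)
    qed
    moreover have "(cmod z')\<^sup>2 > 0" using pos z' by auto
    ultimately have "2 * Im z \<le> Im z / (cmod z')\<^sup>2"
      using pos by (simp add: field_simps)
    also have "\<dots> = Im (moebius inversion z')"
      using z' by (simp add: moebius_inversion Im_divide cmod_power2)
    finally have "(1/2) ^ Suc n < Im (moebius inversion z')"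
      using Suc.prems by simp
    then obtain b where b: "b \<in> PSL2Z" "moebius b (moebius inversion z') \<in> strip"
      using Suc.IH by blast
    have "moebius (b \<otimes>\<^bsub>PSL2R\<^esub> (inversion \<otimes>\<^bsub>PSL2R\<^esub> t)) z \<in> strip"
      using b t pos
      by (simp add: moebius_mult PSL2Z_in_PSL2R mult_PSL2Z inversion_in_PSL2Z uhp_def)
    then show ?thesis using b t mult_PSL2Z inversion_in_PSL2Z by blast
  qed
qed

lemma strip_meets_orbit:
  assumes "z \<in> uhp"
  shows "\<exists>b\<in>PSL2Z. moebius b z \<in> strip"
proof -
  obtain n where "(1/2) ^ n < Im z"
    using assms real_arch_pow_inv[of "Im z" "1/2"] by (auto simp: uhp_def)
  then have "(1/2) ^ Suc n < Im z"
    using assms by (simp add: uhp_def)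
  then show ?thesis by (rule strip_meets_orbit_of_height)
qed

lemma finite_integral_matrices:
  "finite {A :: real^2^2. \<forall>i j. A $ i $ j \<in> \<int> \<and> \<bar>A $ i $ j\<bar> \<le> M}"
proof -
  let ?S = "{x \<in> \<int>. - M \<le> x \<and> x \<le> M}"
  have fin: "finite (?S \<times> ?S \<times> ?S \<times> ?S)" by (intro finite_cartesian_product finite_int_segment)
  show ?thesis
  proof (rule inj_on_finite[OF _ _ fin])
    show "inj_on (\<lambda>A. (A$1$1, A$1$2, A$2$1, A$2$2)) {A :: real^2^2. \<forall>i j. A $ i $ j \<in> \<int> \<and> \<bar>A $ i $ j\<bar> \<le> M}"
      by (rule inj_onI) (simp add: mat2_eq_iff)
    show "(\<lambda>A. (A$1$1, A$1$2, A$2$1, A$2$2)) ` {A :: real^2^2. \<forall>i j. A $ i $ j \<in> \<int> \<and> \<bar>A $ i $ j\<bar> \<le> M}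
        \<subseteq> ?S \<times> ?S \<times> ?S \<times> ?S"
    proof (rule image_subsetI)
      fix A :: "real^2^2" assume "A \<in> {A. \<forall>i j. A $ i $ j \<in> \<int> \<and> \<bar>A $ i $ j\<bar> \<le> M}"
      then have "A $ i $ j \<in> ?S" for i j by (simp add: abs_le_iff minus_le_iff)
      then show "(A$1$1, A$1$2, A$2$1, A$2$2) \<in> ?S \<times> ?S \<times> ?S \<times> ?S" by (intro SigmaI)
    qed
  qed
qed

text \<open>The lower row \<open>(c, d)\<close> is nonzero and integral, so \<open>N = |c z + d| \<ge> \<epsilon>\<close>; the height of the image is
  \<open>Im z / N\<^sup>2 > 1/2\<close>, so \<open>N\<close> is bounded above.  As the real part of the image is bounded, so is
  \<open>|a z + b|\<close>.  A bound on \<open>|p z + q|\<close> bounds \<open>p\<close>, through the imaginary part, and then \<open>q\<close>.\<close>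

lemma strip_entries_bound:
  assumes A: "det A = 1" "\<And>i j. A $ i $ j \<in> \<int>" and w: "mat_moebius A z \<in> strip"
    and z: "\<epsilon> \<le> Im z" "cmod z \<le> R" and "0 < \<epsilon>" "\<epsilon> \<le> 1" "1 \<le> R"
  shows "\<bar>A $ i $ j\<bar> \<le> (2 * R + R / \<epsilon>) * (1 / \<epsilon> + R / \<epsilon>)"
proof -
  define N where "N = cmod (den A z)"
  have uhp: "z \<in> uhp" using z assms by (simp add: uhp_def)
  have ImR: "Im z \<le> R" using z abs_Im_le_cmod[of z] by linarith
  have N: "N \<ge> \<epsilon>"
  proof (cases "A $ 2 $ 1 = 0")
    case True
    then have "A $ 2 $ 2 \<noteq> 0" using A(1) by (auto simp: det_2)
    then have "1 \<le> \<bar>A $ 2 $ 2\<bar>" using A(2)[of 2 2] by (simp add: Ints_nonzero_abs_ge1)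
    then show ?thesis using True assms by (simp add: N_def den_def)
  next
    case False
    then have "1 \<le> \<bar>A $ 2 $ 1\<bar>" using A(2)[of 2 1] by (simp add: Ints_nonzero_abs_ge1)
    then have "1 * \<epsilon> \<le> \<bar>A $ 2 $ 1\<bar> * \<bar>Im z\<bar>" using z assms by (intro mult_mono) auto
    also have "\<dots> = \<bar>Im (den A z)\<bar>" by (simp add: den_def abs_mult)
    also have "\<dots> \<le> N" unfolding N_def by (rule abs_Im_le_cmod)
    finally show ?thesis by simp
  qed
  then have N0: "N > 0" using assms by simp
  have Imw: "Im (mat_moebius A z) = Im z / N\<^sup>2" using A by (simp add: Im_mat_moebius N_def)
  have "1/2 * N\<^sup>2 < Im (mat_moebius A z) * N\<^sup>2"
    using w N0 by (intro mult_strict_right_mono) (auto simp: strip_def)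
  then have "N\<^sup>2 < 2 * Im z" using N0 by (simp add: Imw)
  then have "N\<^sup>2 \<le> (2 * R)\<^sup>2"
  proof -
    have "2 * R * 1 \<le> 2 * R * (2 * R)" using \<open>1 \<le> R\<close> by (intro mult_left_mono) auto
    then show ?thesis using ImR \<open>N\<^sup>2 < 2 * Im z\<close> unfolding power2_eq_square[of "2 * R"] by linarith
  qed
  then have N2: "N \<le> 2 * R" using \<open>1 \<le> R\<close> by (intro power2_le_imp_le[of N "2 * R"]) simp_all
  let ?B = "2 * R + R / \<epsilon>"
  have num: "cmod (num A z) \<le> ?B"
  proof -
    have "num A z = mat_moebius A z * den A z" using N0 by (simp add: mat_moebius_def N_def)
    then have "cmod (num A z) = cmod (mat_moebius A z) * N" by (simp add: norm_mult N_def)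
    also have "\<dots> \<le> (1 + Im z / N\<^sup>2) * N"
      using cmod_le[of "mat_moebius A z"] w N0 Imw uhp unfolding strip_def uhp_def
      by (intro mult_right_mono) auto
    also have "\<dots> = N + Im z / N" using N0 by (simp add: field_simps power2_eq_square)
    also have "\<dots> \<le> 2 * R + R / \<epsilon>"
      using N N2 ImR assms uhp by (intro add_mono frac_le) (auto simp: uhp_def)
    finally show ?thesis .
  qed
  have den: "cmod (den A z) \<le> ?B" using N2 assms by (simp add: N_def add_increasing2)
  have row: "\<bar>p\<bar> \<le> ?B * (1 / \<epsilon> + R / \<epsilon>) \<and> \<bar>q\<bar> \<le> ?B * (1 / \<epsilon> + R / \<epsilon>)"
    if pq: "cmod (of_real p * z + of_real q) \<le> ?B" for p q
  proof -
    have B: "0 \<le> ?B" using assms by simp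
    have "\<bar>p\<bar> * \<epsilon> \<le> \<bar>p\<bar> * Im z" using z by (simp add: mult_left_mono)
    also have "\<dots> = \<bar>Im (of_real p * z + of_real q)\<bar>"
      using uhp by (simp add: abs_mult uhp_def)
    also have "\<dots> \<le> ?B" using pq abs_Im_le_cmod order_trans by blast
    finally have p: "\<bar>p\<bar> \<le> ?B / \<epsilon>" using assms by (simp add: field_simps)
    have "\<bar>q\<bar> = cmod ((of_real p * z + of_real q) - of_real p * z)" by simp
    also have "\<dots> \<le> ?B + \<bar>p\<bar> * R"
      using pq z by (intro order_trans[OF norm_triangle_ineq4] add_mono) (auto simp: norm_mult mult_left_mono)
    also have "\<dots> \<le> ?B * 1 + ?B / \<epsilon> * R" using p assms by (intro add_mono mult_right_mono) auto
    also have "?B * 1 \<le> ?B * (1 / \<epsilon>)"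
      using B assms by (intro mult_left_mono) auto
    finally have "\<bar>q\<bar> \<le> ?B * (1 / \<epsilon>) + ?B / \<epsilon> * R" by simp
    moreover have "B * (1 / \<epsilon>) + B / \<epsilon> * R = B * (1 / \<epsilon> + R / \<epsilon>)" for B by (simp add: distrib_left)
    ultimately have "\<bar>q\<bar> \<le> ?B * (1 / \<epsilon> + R / \<epsilon>)" by (simp only:)
    moreover have "?B * (1 / \<epsilon>) \<le> ?B * (1 / \<epsilon> + R / \<epsilon>)"
      using assms by (intro mult_left_mono[OF _ B]) simp
    then have "\<bar>p\<bar> \<le> ?B * (1 / \<epsilon> + R / \<epsilon>)" using p by (simp only: times_divide_eq_right mult_1_right)
    ultimately show ?thesis by blast
  qed
  have "\<bar>A$1$1\<bar> \<le> ?B * (1 / \<epsilon> + R / \<epsilon>) \<and> \<bar>A$1$2\<bar> \<le> ?B * (1 / \<epsilon> + R / \<epsilon>)"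
    using row num unfolding num_def by blast
  moreover have "\<bar>A$2$1\<bar> \<le> ?B * (1 / \<epsilon> + R / \<epsilon>) \<and> \<bar>A$2$2\<bar> \<le> ?B * (1 / \<epsilon> + R / \<epsilon>)"
    using row den unfolding den_def by blast
  ultimately show ?thesis
    using exhaust_2[of i] exhaust_2[of j] by (elim disjE conjE) (simp_all only:)
qed

lemma strip_locally_finite:
  assumes "compact K" "K \<subseteq> uhp"
  shows "finite {b \<in> PSL2Z. \<exists>z\<in>K. moebius b z \<in> strip}"
proof (cases "K = {}")
  case False
  obtain z0 where z0: "z0 \<in> K" "\<And>z. z \<in> K \<Longrightarrow> Im z0 \<le> Im z"
    using continuous_attains_inf[OF assms(1) False continuous_on_Im[OF continuous_on_id]] by auto
  obtain R where R: "\<And>z. z \<in> K \<Longrightarrow> cmod z \<le> R"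
    using compact_imp_bounded[OF assms(1)] by (auto simp: bounded_iff)
  define \<epsilon> where "\<epsilon> = min 1 (Im z0)"
  define R' where "R' = max 1 R"
  have "Im z0 > 0" using z0 assms by (auto simp: uhp_def)
  define M where "M = (2 * R' + R' / \<epsilon>) * (1 / \<epsilon> + R' / \<epsilon>)"
  have "b \<in> cls ` {A. \<forall>i j. A $ i $ j \<in> \<int> \<and> \<bar>A $ i $ j\<bar> \<le> M}"
    if b: "b \<in> PSL2Z" and "z \<in> K" "moebius b z \<in> strip" for b z
  proof -
    have bc: "b \<in> carrier PSL2R" using b by (rule PSL2Z_in_PSL2R)
    have "\<bar>rep b $ i $ j\<bar> \<le> M" for i j
      unfolding M_def
      by (rule strip_entries_bound[OF rep_PSL2R(1)[OF bc] rep_PSL2Z[OF b], of z])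
        (use that z0 R \<open>Im z0 > 0\<close> in \<open>auto simp: moebius_eq_mat_moebius \<epsilon>_def R'_def min_le_iff_disj le_max_iff_disj\<close>)
    then show ?thesis
      using rep_PSL2R(2)[OF bc] rep_PSL2Z[OF b] by (intro image_eqI[of _ _ "rep b"]) auto
  qed
  then show ?thesis
    by (intro finite_subset[OF _ finite_imageI[OF finite_integral_matrices[of M]]]) blast
qed simp

section \<open>Finiteness of the number of cusps\<close>

text \<open>For \<open>b\<close> in the modular group this is the boundary point that \<open>b\<close> maps to infinity, as a line in
  the plane.\<close>

definition ker_line :: "(real^2^2) set \<Rightarrow> (real^2) set" where
  "ker_line b = {v. (rep b *v v) $ 2 = 0}"

lemma matrix_vector_nth: "(A *v v) $ i = A $ i $ 1 * v $ 1 + A $ i $ 2 * v $ 2"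
  for A :: "real^2^2" and v :: "real^2"
  by (simp add: matrix_vector_mult_def sum_2)

lemma uminus_matrix_vector: "(- A) *v v = - (A *v v)"
  for A :: "real^2^2" and v :: "real^2"
  by (simp add: vec_eq_iff matrix_vector_nth)

lemma ker_line_cls: "ker_line (cls A) = {v. (A *v v) $ 2 = 0}"
  using rep_cls[of A] by (auto simp: ker_line_def uminus_matrix_vector)

lemma line_act_ker_line:
  assumes "b \<in> carrier PSL2R" "\<gamma> \<in> carrier PSL2R"
  shows "line_act \<gamma> (ker_line b) = ker_line (b \<otimes>\<^bsub>PSL2R\<^esub> inv\<^bsub>PSL2R\<^esub> \<gamma>)"
proof -
  interpret group PSL2R by (rule group_PSL2R)
  let ?C = "rep (b \<otimes>\<^bsub>PSL2R\<^esub> inv\<^bsub>PSL2R\<^esub> \<gamma>)"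
  have *: "\<alpha> \<otimes>\<^bsub>PSL2R\<^esub> \<gamma> = b \<Longrightarrow> \<alpha> \<in> carrier PSL2R \<Longrightarrow>
     (rep b *v v) $ 2 = 0 \<longleftrightarrow> (rep \<alpha> *v (rep \<gamma> *v v)) $ 2 = 0" for \<alpha> v
    using rep_mult[of \<alpha> \<gamma>] assms by (auto simp: matrix_vector_mul_assoc uminus_matrix_vector)
  have b: "(b \<otimes>\<^bsub>PSL2R\<^esub> inv\<^bsub>PSL2R\<^esub> \<gamma>) \<otimes>\<^bsub>PSL2R\<^esub> \<gamma> = b"
    using assms by (simp add: m_assoc)
  have surj: "\<exists>v. u = rep \<gamma> *v v" for u
  proof -
    obtain B where "rep \<gamma> ** B = mat 1"
      using rep_PSL2R(1)[OF assms(2)] by (metis invertible_det_nz invertible_def zero_neq_one)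
    then have "u = rep \<gamma> *v (B *v u)" by (simp add: matrix_vector_mul_assoc)
    then show ?thesis by blast
  qed
  show ?thesis
  proof (intro equalityI subsetI)
    fix u assume "u \<in> line_act \<gamma> (ker_line b)"
    then show "u \<in> ker_line (b \<otimes>\<^bsub>PSL2R\<^esub> inv\<^bsub>PSL2R\<^esub> \<gamma>)"
      using *[OF b] assms by (auto simp: line_act_def ker_line_def)
  next
    fix u assume u: "u \<in> ker_line (b \<otimes>\<^bsub>PSL2R\<^esub> inv\<^bsub>PSL2R\<^esub> \<gamma>)"
    obtain v where "u = rep \<gamma> *v v" using surj by blast
    then show "u \<in> line_act \<gamma> (ker_line b)"
      using *[OF b, of v] assms u by (auto simp: line_act_def ker_line_def)
  qed
qed

text \<open>The matrix of \<open>\<gamma>\<close> has a double eigenvalue \<open>\<epsilon> = 1\<close> or \<open>-1\<close>, so its fixed line is rational.  Completing a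
  primitive integral equation of the line to a matrix of determinant \<open>1\<close> gives an \<open>\<alpha>\<close> in the modular
  group that moves the fixed point to infinity and so conjugates \<open>\<gamma>\<close> to a translation.\<close>

lemma parabolic_fixed_line:
  assumes \<gamma>: "\<gamma> \<in> PSL2Z" "parabolic \<gamma>" and v: "v \<noteq> 0" "line_act \<gamma> (span {v}) = span {v}"
  obtains \<alpha> t where "\<alpha> \<in> PSL2Z" "span {v} = ker_line \<alpha>" "t \<noteq> 0"
    "\<And>z. z \<in> uhp \<Longrightarrow> moebius (\<alpha> \<otimes>\<^bsub>PSL2R\<^esub> \<gamma>) z = moebius \<alpha> z + of_real t"
proof -
  define P where "P = rep \<gamma>"
  have \<gamma>c: "\<gamma> \<in> carrier PSL2R" using \<gamma> by (simp add: PSL2Z_in_PSL2R)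
  have det: "det P = 1" and \<gamma>P: "\<gamma> = cls P" using rep_PSL2R[OF \<gamma>c] by (simp_all add: P_def)
  have PZ: "P $ i $ j \<in> \<int>" for i j unfolding P_def by (rule rep_PSL2Z[OF \<gamma>(1)])
  obtain \<epsilon> :: real where \<epsilon>: "\<epsilon> = 1 \<or> \<epsilon> = - 1" and tr: "P$1$1 + P$2$2 = 2 * \<epsilon>"
  proof -
    have "\<bar>P$1$1 + P$2$2\<bar> = 2" using \<gamma> by (simp add: parabolic_def trace_def sum_2 P_def)
    then show thesis using that[of 1] that[of "- 1"] by linarith
  qed
  have "P *v v \<in> span {v}" using v span_base[of v "{v}"] by (auto simp: line_act_def P_def)
  then obtain \<mu> where \<mu>: "P *v v = \<mu> *\<^sub>R v" by (auto simp: span_singleton)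
  have e1: "(P$1$1 - \<mu>) * v$1 + P$1$2 * v$2 = 0" and e2: "P$2$1 * v$1 + (P$2$2 - \<mu>) * v$2 = 0"
    using \<mu> by (auto simp: vec_eq_iff matrix_vector_nth forall_2 algebra_simps)
  have d: "P$1$1 * P$2$2 - P$1$2 * P$2$1 = 1" using det by (simp add: det_2)
  have v0: "v$1 \<noteq> 0 \<or> v$2 \<noteq> 0" using v by (auto simp: vec_eq_iff forall_2)
  have "(P$1$1 - \<mu>) * (P$2$2 - \<mu>) - P$1$2 * P$2$1 = 0" (is "?\<Delta> = 0")
  proof -
    have "?\<Delta> * v$1 = (P$2$2 - \<mu>) * ((P$1$1 - \<mu>) * v$1 + P$1$2 * v$2)
        - P$1$2 * (P$2$1 * v$1 + (P$2$2 - \<mu>) * v$2)"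
      "?\<Delta> * v$2 = (P$1$1 - \<mu>) * (P$2$1 * v$1 + (P$2$2 - \<mu>) * v$2)
        - P$2$1 * ((P$1$1 - \<mu>) * v$1 + P$1$2 * v$2)"
      by (simp_all add: algebra_simps)
    then have "?\<Delta> * v$1 = 0" "?\<Delta> * v$2 = 0" unfolding e1 e2 by simp_all
    then show ?thesis using v0 by auto
  qed
  moreover have "?\<Delta> = (P$1$1 * P$2$2 - P$1$2 * P$2$1) - \<mu> * (P$1$1 + P$2$2) + \<mu>\<^sup>2"
    by (simp add: algebra_simps power2_eq_square)
  ultimately have "(\<mu> - \<epsilon>)\<^sup>2 = 0" unfolding d tr using \<epsilon> by (auto simp: power2_eq_square algebra_simps)
  then have \<mu>\<epsilon>: "\<mu> = \<epsilon>" by simp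
  \<comment> \<open>a primitive integral vector orthogonal to the fixed line\<close>
  have \<epsilon>Z: "\<epsilon> \<in> \<int>" using \<epsilon> by auto
  have "\<exists>r q. r \<in> \<int> \<and> q \<in> \<int> \<and> (r \<noteq> 0 \<or> q \<noteq> 0) \<and> r * v$1 + q * v$2 = 0"
  proof (cases "P$1$1 = \<epsilon> \<and> P$1$2 = 0")
    case True
    have "P$2$1 \<noteq> 0 \<or> P$2$2 \<noteq> \<epsilon>"
    proof (rule ccontr)
      assume "\<not> ?thesis"
      then have "P = \<epsilon> *\<^sub>R mat 1" using True by (simp add: mat2_eq_iff mat2_one)
      then have "P = mat 1 \<or> P = - mat 1" using \<epsilon> by (elim disjE) simp_all
      then have "\<gamma> = \<one>\<^bsub>PSL2R\<^esub>" using \<gamma>P by (auto simp: one_PSL2R cls_eq_iff)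
      then show False using \<gamma> by (simp add: parabolic_def)
    qed
    then show ?thesis using e2 \<mu>\<epsilon> \<epsilon>Z PZ
      by (intro exI[of _ "P$2$1"] exI[of _ "P$2$2 - \<epsilon>"]) auto
  next
    case False
    then show ?thesis using e1 \<mu>\<epsilon> \<epsilon>Z PZ
      by (intro exI[of _ "P$1$1 - \<epsilon>"] exI[of _ "P$1$2"]) auto
  qed
  then obtain r1 q1 where rq1: "r1 \<in> \<int>" "q1 \<in> \<int>" "r1 \<noteq> 0 \<or> q1 \<noteq> 0" "r1 * v$1 + q1 * v$2 = 0"
    by blast
  obtain r0 where r0: "r1 = of_int r0" using rq1(1) by (rule Ints_cases)
  obtain q0 where q0: "q1 = of_int q0" using rq1(2) by (rule Ints_cases)
  have rq0: "r0 \<noteq> 0 \<or> q0 \<noteq> 0" "of_int r0 * v$1 + of_int q0 * v$2 = 0"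
    using rq1(3,4) by (simp_all add: r0 q0)
  define h where "h = gcd r0 q0"
  define r q where "r = r0 div h" and "q = q0 div h"
  have h: "h \<noteq> 0" "r0 = h * r" "q0 = h * q" using rq0(1) by (auto simp: h_def r_def q_def)
  have "coprime r q" using rq0(1) unfolding r_def q_def h_def by (intro div_gcd_coprime) auto
  then obtain a b where "a * r + b * q = 1"
    using bezout_int[of r q] by (auto simp: coprime_iff_gcd_eq_1)
  then obtain w u where bez: "w * q - u * r = 1"
    by (metis add.commute diff_minus_eq_add mult_minus_left)
  have "of_int h * (of_int r * v$1 + of_int q * v$2) = 0" using rq0(2) by (simp add: h(2,3) algebra_simps)
  then have rq: "of_int r * v$1 + of_int q * v$2 = 0" using h(1) by simp
  have bez': "real_of_int w * of_int q - of_int u * of_int r = 1"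
    using arg_cong[OF bez, of real_of_int] by simp
  define A where "A = mat2 (of_int w) (of_int u) (of_int r) (of_int q)"
  define A' where "A' = mat2 (of_int q) (- of_int u) (- of_int r) (of_int w)"
  have detA: "det A = 1" using bez' by (simp add: A_def det_2)
  have AA': "A ** A' = mat 1" "A' ** A = mat 1"
    using bez' by (simp_all add: mat2_eq_iff mat2_mult A_def A'_def mat2_one algebra_simps)
  define \<alpha> where "\<alpha> = cls A"
  have \<alpha>: "\<alpha> \<in> PSL2Z" unfolding \<alpha>_def using detA
    by (rule cls_in_PSL2Z) (simp add: A_def mat2_def)
  \<comment> \<open>the fixed line is spanned by \<open>(q, -r)\<close>\<close>
  define k where "k = of_int w * v$1 + of_int u * v$2"
  have solve: "x1 = (of_int w * x1 + of_int u * x2) * of_int q \<and> x2 = - (of_int w * x1 + of_int u * x2) * of_int r"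
    if "of_int r * x1 + of_int q * x2 = 0" for x1 x2 :: real
  proof -
    have "(of_int w * x1 + of_int u * x2) * of_int q
        = (of_int w * of_int q - of_int u * of_int r) * x1 + of_int u * (of_int r * x1 + of_int q * x2)"
      "- (of_int w * x1 + of_int u * x2) * of_int r
        = (of_int w * of_int q - of_int u * of_int r) * x2 - of_int w * (of_int r * x1 + of_int q * x2)"
      by (simp_all add: algebra_simps)
    then show ?thesis unfolding that bez' by simp
  qed
  have vk: "v$1 = k * of_int q" "v$2 = - k * of_int r"
    using solve[OF rq] unfolding k_def by blast+
  have k0: "k \<noteq> 0" using vk v0 by auto
  have span: "span {v} = ker_line \<alpha>"
  proof (intro equalityI subsetI)
    fix x assume "x \<in> span {v}"
    then obtain c where "x = c *\<^sub>R v" by (auto simp: span_singleton)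
    then show "x \<in> ker_line \<alpha>"
      using vk by (simp add: \<alpha>_def ker_line_cls matrix_vector_nth A_def)
  next
    fix x assume "x \<in> ker_line \<alpha>"
    then have x: "of_int r * x$1 + of_int q * x$2 = 0"
      by (simp add: \<alpha>_def ker_line_cls matrix_vector_nth A_def)
    define l where "l = of_int w * x$1 + of_int u * x$2"
    have "x$1 = l * of_int q" "x$2 = - l * of_int r" using solve[OF x] unfolding l_def by blast+
    then have "x = (l / k) *\<^sub>R v" using k0 vk by (simp add: vec_eq_iff forall_2)
    then show "x \<in> span {v}" by (auto simp: span_singleton)
  qed
  \<comment> \<open>conjugation by \<open>\<alpha>\<close> makes \<open>\<gamma>\<close> upper triangular\<close>
  define B where "B = A ** P ** A'"
  have BA: "A ** P = B ** A" by (simp add: B_def AA' flip: matrix_mul_assoc)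
  have "k * (P$1$1 * of_int q - P$1$2 * of_int r) = k * (\<epsilon> * of_int q)"
    "k * (P$2$1 * of_int q - P$2$2 * of_int r) = k * (- \<epsilon> * of_int r)"
    using e1 e2 unfolding \<mu>\<epsilon> vk by (simp_all add: algebra_simps)
  then have Pe: "P$1$1 * of_int q - P$1$2 * of_int r = \<epsilon> * of_int q"
    "P$2$1 * of_int q - P$2$2 * of_int r = - \<epsilon> * of_int r" by (simp_all only: mult_left_cancel[OF k0])
  have "B$1$1 = of_int w * (P$1$1 * of_int q - P$1$2 * of_int r) + of_int u * (P$2$1 * of_int q - P$2$2 * of_int r)"
    "B$2$1 = of_int r * (P$1$1 * of_int q - P$1$2 * of_int r) + of_int q * (P$2$1 * of_int q - P$2$2 * of_int r)"
    unfolding B_def A_def A'_def by (simp_all add: mat2_mult algebra_simps)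
  then have "B$1$1 = \<epsilon> * (of_int w * of_int q - of_int u * of_int r)" and B21: "B$2$1 = 0"
    unfolding Pe by (simp_all add: algebra_simps)
  then have B1: "B$1$1 = \<epsilon>" "B$2$1 = 0" unfolding bez' by simp_all
  have "det B = 1" using detA det AA' by (metis B_def det_I det_mul mult_1)
  then have B2: "B$2$2 = \<epsilon>" using B1 \<epsilon> by (auto simp: det_2)
  have t0: "B$1$2 \<noteq> 0"
  proof
    assume "B$1$2 = 0"
    then have "B = \<epsilon> *\<^sub>R mat 1" using B1 B2 by (simp add: mat2_eq_iff mat2_one)
    then have "B = mat 1 \<or> B = - mat 1" using \<epsilon> by (elim disjE) simp_all
    moreover have "P = A' ** (B ** A)"
      unfolding BA[symmetric] by (simp add: matrix_mul_assoc AA')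
    ultimately have "P = mat 1 \<or> P = - mat 1" using AA' by (elim disjE) simp_all
    then have "\<gamma> = \<one>\<^bsub>PSL2R\<^esub>" using \<gamma>P by (auto simp: one_PSL2R cls_eq_iff)
    then show False using \<gamma> by (simp add: parabolic_def)
  qed
  show thesis
  proof (rule that[OF \<alpha> span, of "\<epsilon> * B$1$2"])
    show "\<epsilon> * B$1$2 \<noteq> 0" using t0 \<epsilon> by auto
    fix z assume z: "z \<in> uhp"
    have "moebius (\<alpha> \<otimes>\<^bsub>PSL2R\<^esub> \<gamma>) z = mat_moebius (B ** A) z"
      by (subst \<gamma>P) (simp add: \<alpha>_def mult_PSL2R moebius_cls BA)
    also have "\<dots> = mat_moebius B (mat_moebius A z)" using den_nonzero[OF detA z] by (rule mat_moebius_mult)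
    also have "\<dots> = mat_moebius A z + of_real (\<epsilon> * B$1$2)"
      using \<epsilon> B1 B2 by (auto simp: mat_moebius_def[of B] num_def[of B] den_def[of B])
    finally show "moebius (\<alpha> \<otimes>\<^bsub>PSL2R\<^esub> \<gamma>) z = moebius \<alpha> z + of_real (\<epsilon> * B$1$2)"
      by (simp add: \<alpha>_def moebius_cls)
  qed
qed

lemma continuous_on_moebius: "\<gamma> \<in> carrier PSL2R \<Longrightarrow> continuous_on uhp (moebius \<gamma>)"
  using td_moebius[of \<gamma> 0] by simp

lemma interval_same_sign:
  assumes "is_interval A" "0 \<notin> A" "u \<in> A" "v \<in> A"
  shows "v > 0 \<longleftrightarrow> u > (0::real)"
  using mem_is_interval_1_I[OF assms(1,3,4), of 0] mem_is_interval_1_I[OF assms(1,4,3), of 0] assms(2)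
  by linarith

lemma convex_uhp: "convex uhp"
  by (simp add: uhp_def convex_halfspace_Im_gt)

text \<open>Let \<open>K\<close> be the union of the segments that join \<open>\<i>\<close> to its images under the generators.  By local
  finiteness only finitely many \<open>b\<close> in the modular group have an image \<open>b K\<close> that meets the imaginary
  axis: a point on the axis, or its image under the inversion, has height at least \<open>1\<close>.  If \<open>\<alpha>\<close> takes a
  cusp to infinity and no \<open>\<alpha> c K\<close> with \<open>c \<in> \<Gamma>\<close> met the axis, then all points \<open>\<alpha> c \<i>\<close> would lie on the same
  side of it, because the translates of \<open>K\<close> connect the orbit of \<open>\<i>\<close>.  But a parabolic element
  fixing the cusp translates these points horizontally, and its powers move them to either side.\<close>

lemma finite_set_meeting_cusp_cosets:
  assumes \<Gamma>: "subgroup \<Gamma> PSL2R" "\<Gamma> \<subseteq> PSL2Z"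
    and X: "finite X" "X \<subseteq> \<Gamma>" "generate PSL2R X = \<Gamma>"
  obtains E where "finite E"
    "\<And>\<alpha> \<gamma> t. \<alpha> \<in> PSL2Z \<Longrightarrow> \<gamma> \<in> \<Gamma> \<Longrightarrow> t \<noteq> 0 \<Longrightarrow>
       (\<And>z. z \<in> uhp \<Longrightarrow> moebius (\<alpha> \<otimes>\<^bsub>PSL2R\<^esub> \<gamma>) z = moebius \<alpha> z + of_real t) \<Longrightarrow>
       \<exists>c\<in>\<Gamma>. \<alpha> \<otimes>\<^bsub>PSL2R\<^esub> c \<in> E"
proof -
  interpret group PSL2R by (rule group_PSL2R)
  interpret \<Gamma>: subgroup \<Gamma> PSL2R by (rule \<Gamma>)
  have iu: "\<i> \<in> uhp" by (simp add: uhp_def)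
  have Xc: "X \<subseteq> carrier PSL2R" using X \<Gamma>.subset by blast
  define K where "K = (\<Union>x\<in>X. closed_segment \<i> (moebius x \<i>)) \<union> {\<i>}"
  have Ku: "K \<subseteq> uhp"
    using closed_segment_subset[OF iu _ convex_uhp] moebius_in_uhp[OF _ iu] Xc iu
    by (auto simp: K_def)
  have Kc: "compact K" unfolding K_def using X by (intro compact_Un compact_UN) auto
  define F where "F = {b \<in> PSL2Z. \<exists>z\<in>K. moebius b z \<in> strip}"
  define E where "E = F \<union> {b \<in> carrier PSL2R. inversion \<otimes>\<^bsub>PSL2R\<^esub> b \<in> F}"
  have finF: "finite F" unfolding F_def by (rule strip_locally_finite[OF Kc Ku])
  have inv: "inversion \<in> carrier PSL2R" by (rule PSL2Z_in_PSL2R[OF inversion_in_PSL2Z])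
  have "inj_on (\<lambda>b. inversion \<otimes>\<^bsub>PSL2R\<^esub> b) {b \<in> carrier PSL2R. inversion \<otimes>\<^bsub>PSL2R\<^esub> b \<in> F}"
    using inv by (auto simp: inj_on_def)
  then have "finite {b \<in> carrier PSL2R. inversion \<otimes>\<^bsub>PSL2R\<^esub> b \<in> F}"
    by (rule inj_on_finite[OF _ _ finF]) auto
  then have finE: "finite E" using finF by (simp add: E_def)
  show thesis
  proof (rule that[OF finE], rule ccontr)
    fix \<alpha> \<gamma> t
    assume \<alpha>: "\<alpha> \<in> PSL2Z" and \<gamma>: "\<gamma> \<in> \<Gamma>" and t: "t \<noteq> 0"
      and shift: "\<And>z. z \<in> uhp \<Longrightarrow> moebius (\<alpha> \<otimes>\<^bsub>PSL2R\<^esub> \<gamma>) z = moebius \<alpha> z + of_real t"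
      and no: "\<not> (\<exists>c\<in>\<Gamma>. \<alpha> \<otimes>\<^bsub>PSL2R\<^esub> c \<in> E)"
    have \<alpha>c: "\<alpha> \<in> carrier PSL2R" using \<alpha> by (rule PSL2Z_in_PSL2R)
    define h where "h c = Re (moebius (\<alpha> \<otimes>\<^bsub>PSL2R\<^esub> c) \<i>)" for c
    have nz: "Re (moebius (\<alpha> \<otimes>\<^bsub>PSL2R\<^esub> c) z) \<noteq> 0" if c: "c \<in> \<Gamma>" and z: "z \<in> K" for c z
    proof
      assume re: "Re (moebius (\<alpha> \<otimes>\<^bsub>PSL2R\<^esub> c) z) = 0"
      have bz: "\<alpha> \<otimes>\<^bsub>PSL2R\<^esub> c \<in> PSL2Z" using \<alpha> c \<Gamma> by (auto intro: mult_PSL2Z)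
      let ?w = "moebius (\<alpha> \<otimes>\<^bsub>PSL2R\<^esub> c) z"
      have zu: "z \<in> uhp" using z Ku by blast
      have wu: "Im ?w > 0" using moebius_in_uhp[OF PSL2Z_in_PSL2R[OF bz] zu] by (simp add: uhp_def)
      show False
      proof (cases "Im ?w > 1/2")
        case True
        then have "?w \<in> strip" using re by (simp add: strip_def)
        then have "\<alpha> \<otimes>\<^bsub>PSL2R\<^esub> c \<in> F" using bz z unfolding F_def by blast
        then show False using no c by (auto simp: E_def)
      next
        case False
        have "moebius (inversion \<otimes>\<^bsub>PSL2R\<^esub> (\<alpha> \<otimes>\<^bsub>PSL2R\<^esub> c)) z = - 1 / ?w"
          using moebius_mult[OF inv PSL2Z_in_PSL2R[OF bz] zu] by (simp add: moebius_inversion)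
        moreover have "Re (- 1 / ?w) = 0" "Im (- 1 / ?w) = 1 / Im ?w"
          using re wu by (simp_all add: Re_divide Im_divide power2_eq_square)
        moreover have "1 / Im ?w > 1/2" using False wu by (simp add: field_simps)
        ultimately have "moebius (inversion \<otimes>\<^bsub>PSL2R\<^esub> (\<alpha> \<otimes>\<^bsub>PSL2R\<^esub> c)) z \<in> strip"
          by (simp only: strip_def mem_Collect_eq) simp
        then have "inversion \<otimes>\<^bsub>PSL2R\<^esub> (\<alpha> \<otimes>\<^bsub>PSL2R\<^esub> c) \<in> F"
          using mult_PSL2Z[OF inversion_in_PSL2Z bz] z unfolding F_def by blast
        then show False using no c PSL2Z_in_PSL2R[OF bz] by (auto simp: E_def)
      qed
    qed
    have step: "h (c \<otimes>\<^bsub>PSL2R\<^esub> x) > 0 \<longleftrightarrow> h c > 0" if c: "c \<in> \<Gamma>" and x: "x \<in> X" for c x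
    proof -
      let ?b = "\<alpha> \<otimes>\<^bsub>PSL2R\<^esub> c" and ?S = "closed_segment \<i> (moebius x \<i>)"
      have bc: "?b \<in> carrier PSL2R" using \<alpha>c c by auto
      have xc: "x \<in> carrier PSL2R" using Xc x by blast
      have SK: "?S \<subseteq> K" using x by (auto simp: K_def)
      have "connected ((\<lambda>z. Re (moebius ?b z)) ` ?S)"
        using continuous_on_subset[OF continuous_on_moebius[OF bc]] SK Ku
        by (intro connected_continuous_image continuous_on_Re) auto
      then have "is_interval ((\<lambda>z. Re (moebius ?b z)) ` ?S)" by (simp add: is_interval_connected_1)
      moreover have "0 \<notin> (\<lambda>z. Re (moebius ?b z)) ` ?S"
      proof
        assume "0 \<in> (\<lambda>z. Re (moebius ?b z)) ` ?S"
        then obtain z where "0 = Re (moebius ?b z)" "z \<in> ?S" by (rule imageE)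
        then show False using nz[OF c, of z] SK by (metis subsetD)
      qed
      moreover have "h c \<in> (\<lambda>z. Re (moebius ?b z)) ` ?S"
        unfolding h_def by (rule imageI) simp
      moreover have "h (c \<otimes>\<^bsub>PSL2R\<^esub> x) = Re (moebius ?b (moebius x \<i>))"
        using moebius_mult[OF bc xc iu] \<alpha>c c xc by (simp add: h_def m_assoc)
      then have "h (c \<otimes>\<^bsub>PSL2R\<^esub> x) \<in> (\<lambda>z. Re (moebius ?b z)) ` ?S"
        by (rule image_eqI) simp
      ultimately show ?thesis by (rule interval_same_sign)
    qed
    have sign: "\<forall>d\<in>\<Gamma>. h (d \<otimes>\<^bsub>PSL2R\<^esub> c) > 0 \<longleftrightarrow> h d > 0" if "c \<in> generate PSL2R X" for c
      using that
    proof induction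
      case one
      then show ?case by simp
    next
      case (incl x)
      then show ?case using step by blast
    next
      case (inv x)
      have x\<Gamma>: "x \<in> \<Gamma>" using inv X by blast
      show ?case
      proof
        fix d assume d: "d \<in> \<Gamma>"
        have "d \<otimes>\<^bsub>PSL2R\<^esub> inv\<^bsub>PSL2R\<^esub> x \<in> \<Gamma>" using d x\<Gamma> by simp
        from step[OF this inv] show "h (d \<otimes>\<^bsub>PSL2R\<^esub> inv\<^bsub>PSL2R\<^esub> x) > 0 \<longleftrightarrow> h d > 0"
          using d x\<Gamma> by (simp add: m_assoc)
      qed
    next
      case (eng a b)
      have a: "a \<in> \<Gamma>" and b: "b \<in> \<Gamma>" using eng.hyps X(3) by blast+
      show ?case
      proof
        fix d assume d: "d \<in> \<Gamma>"
        have "d \<otimes>\<^bsub>PSL2R\<^esub> (a \<otimes>\<^bsub>PSL2R\<^esub> b) = d \<otimes>\<^bsub>PSL2R\<^esub> a \<otimes>\<^bsub>PSL2R\<^esub> b"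
          using a b d by (simp add: m_assoc)
        then show "h (d \<otimes>\<^bsub>PSL2R\<^esub> (a \<otimes>\<^bsub>PSL2R\<^esub> b)) > 0 \<longleftrightarrow> h d > 0"
          using eng.IH d \<Gamma>.m_closed[OF d a] by metis
      qed
    qed
    have const: "h c > 0 \<longleftrightarrow> h \<one>\<^bsub>PSL2R\<^esub> > 0" if "c \<in> \<Gamma>" for c
    proof -
      have "c \<in> generate PSL2R X" using that X(3) by blast
      from bspec[OF sign[OF this] \<Gamma>.one_closed] show ?thesis using that by simp
    qed
    have h\<gamma>: "h (\<gamma> \<otimes>\<^bsub>PSL2R\<^esub> c) = h c + t" if c: "c \<in> \<Gamma>" for c
    proof -
      have "moebius (\<alpha> \<otimes>\<^bsub>PSL2R\<^esub> (\<gamma> \<otimes>\<^bsub>PSL2R\<^esub> c)) \<i> = moebius (\<alpha> \<otimes>\<^bsub>PSL2R\<^esub> \<gamma>) (moebius c \<i>)"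
        using \<alpha>c \<gamma> c moebius_mult[of "\<alpha> \<otimes>\<^bsub>PSL2R\<^esub> \<gamma>" c \<i>, OF _ _ iu] by (simp add: m_assoc)
      also have "\<dots> = moebius (\<alpha> \<otimes>\<^bsub>PSL2R\<^esub> c) \<i> + of_real t"
        using shift[OF moebius_in_uhp[OF _ iu], of c] c moebius_mult[OF \<alpha>c _ iu, of c] by simp
      finally show ?thesis by (simp add: h_def)
    qed
    have h\<gamma>': "h (inv\<^bsub>PSL2R\<^esub> \<gamma> \<otimes>\<^bsub>PSL2R\<^esub> c) = h c - t" if c: "c \<in> \<Gamma>" for c
    proof -
      have "\<gamma> \<otimes>\<^bsub>PSL2R\<^esub> (inv\<^bsub>PSL2R\<^esub> \<gamma> \<otimes>\<^bsub>PSL2R\<^esub> c) = c"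
        using c \<gamma> by (simp flip: m_assoc)
      then show ?thesis using h\<gamma>[of "inv\<^bsub>PSL2R\<^esub> \<gamma> \<otimes>\<^bsub>PSL2R\<^esub> c"] c \<gamma> by simp
    qed
    have up: "\<exists>c\<in>\<Gamma>. h c = h \<one>\<^bsub>PSL2R\<^esub> + N * t" for N :: nat
    proof (induction N)
      case (Suc N)
      then obtain c where "c \<in> \<Gamma>" "h c = h \<one>\<^bsub>PSL2R\<^esub> + N * t" by blast
      then show ?case using h\<gamma>[of c] \<gamma>
        by (intro bexI[of _ "\<gamma> \<otimes>\<^bsub>PSL2R\<^esub> c"]) (simp_all add: distrib_right)
    qed auto
    have down: "\<exists>c\<in>\<Gamma>. h c = h \<one>\<^bsub>PSL2R\<^esub> - N * t" for N :: nat
    proof (induction N)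
      case (Suc N)
      then obtain c where "c \<in> \<Gamma>" "h c = h \<one>\<^bsub>PSL2R\<^esub> - N * t" by blast
      then show ?case using h\<gamma>'[of c] \<gamma>
        by (intro bexI[of _ "inv\<^bsub>PSL2R\<^esub> \<gamma> \<otimes>\<^bsub>PSL2R\<^esub> c"]) (simp_all add: distrib_right)
    qed auto
    obtain N :: nat where "\<bar>h \<one>\<^bsub>PSL2R\<^esub>\<bar> / \<bar>t\<bar> < N" using reals_Archimedean2 by blast
    then have N: "\<bar>h \<one>\<^bsub>PSL2R\<^esub>\<bar> < \<bar>N * t\<bar>" using t by (simp add: field_simps abs_mult)
    obtain c c' where "c \<in> \<Gamma>" "c' \<in> \<Gamma>" "h c = h \<one>\<^bsub>PSL2R\<^esub> + N * t" "h c' = h \<one>\<^bsub>PSL2R\<^esub> - N * t"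
      using up[of N] down[of N] by blast
    then show False using const[of c] const[of c'] N by linarith
  qed
qed

lemma cusp_orbit_ker_line:
  assumes \<Gamma>: "subgroup \<Gamma> PSL2R" and \<alpha>: "\<alpha> \<in> carrier PSL2R" and c: "c \<in> \<Gamma>"
  shows "(\<lambda>\<gamma>. line_act \<gamma> (ker_line \<alpha>)) ` \<Gamma> = (\<lambda>\<gamma>. line_act \<gamma> (ker_line (\<alpha> \<otimes>\<^bsub>PSL2R\<^esub> c))) ` \<Gamma>"
proof -
  interpret group PSL2R by (rule group_PSL2R)
  interpret \<Gamma>: subgroup \<Gamma> PSL2R by (rule \<Gamma>)
  have orb: "(\<lambda>\<gamma>. line_act \<gamma> (ker_line b)) ` \<Gamma> = (\<lambda>\<gamma>. ker_line (b \<otimes>\<^bsub>PSL2R\<^esub> \<gamma>)) ` \<Gamma>"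
    if "b \<in> carrier PSL2R" for b
  proof -
    have "(\<lambda>\<gamma>. line_act \<gamma> (ker_line b)) ` \<Gamma> = (\<lambda>\<gamma>. ker_line (b \<otimes>\<^bsub>PSL2R\<^esub> inv\<^bsub>PSL2R\<^esub> \<gamma>)) ` \<Gamma>"
      using that by (intro image_cong HOL.refl line_act_ker_line) auto
    also have "\<dots> = (\<lambda>\<gamma>. ker_line (b \<otimes>\<^bsub>PSL2R\<^esub> \<gamma>)) ` \<Gamma>"
    proof (intro equalityI subsetI)
      fix l assume "l \<in> (\<lambda>\<gamma>. ker_line (b \<otimes>\<^bsub>PSL2R\<^esub> \<gamma>)) ` \<Gamma>"
      then obtain \<gamma> where "\<gamma> \<in> \<Gamma>" "l = ker_line (b \<otimes>\<^bsub>PSL2R\<^esub> \<gamma>)" by blast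
      then show "l \<in> (\<lambda>\<gamma>. ker_line (b \<otimes>\<^bsub>PSL2R\<^esub> inv\<^bsub>PSL2R\<^esub> \<gamma>)) ` \<Gamma>"
        by (intro image_eqI[of _ _ "inv\<^bsub>PSL2R\<^esub> \<gamma>"]) auto
    qed auto
    finally show ?thesis .
  qed
  have "(\<lambda>\<gamma>. ker_line (\<alpha> \<otimes>\<^bsub>PSL2R\<^esub> \<gamma>)) ` \<Gamma> = (\<lambda>\<gamma>. ker_line (\<alpha> \<otimes>\<^bsub>PSL2R\<^esub> c \<otimes>\<^bsub>PSL2R\<^esub> \<gamma>)) ` \<Gamma>"
  proof (intro equalityI subsetI)
    fix l assume "l \<in> (\<lambda>\<gamma>. ker_line (\<alpha> \<otimes>\<^bsub>PSL2R\<^esub> \<gamma>)) ` \<Gamma>"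
    then obtain \<gamma> where \<gamma>: "\<gamma> \<in> \<Gamma>" "l = ker_line (\<alpha> \<otimes>\<^bsub>PSL2R\<^esub> \<gamma>)" by blast
    have "c \<otimes>\<^bsub>PSL2R\<^esub> (inv\<^bsub>PSL2R\<^esub> c \<otimes>\<^bsub>PSL2R\<^esub> \<gamma>) = \<gamma>"
      using c \<gamma>(1) by (simp flip: m_assoc)
    then show "l \<in> (\<lambda>\<gamma>. ker_line (\<alpha> \<otimes>\<^bsub>PSL2R\<^esub> c \<otimes>\<^bsub>PSL2R\<^esub> \<gamma>)) ` \<Gamma>"
      using \<alpha> c \<gamma> by (intro image_eqI[of _ _ "inv\<^bsub>PSL2R\<^esub> c \<otimes>\<^bsub>PSL2R\<^esub> \<gamma>"]) (auto simp: m_assoc)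
  next
    fix l assume "l \<in> (\<lambda>\<gamma>. ker_line (\<alpha> \<otimes>\<^bsub>PSL2R\<^esub> c \<otimes>\<^bsub>PSL2R\<^esub> \<gamma>)) ` \<Gamma>"
    then show "l \<in> (\<lambda>\<gamma>. ker_line (\<alpha> \<otimes>\<^bsub>PSL2R\<^esub> \<gamma>)) ` \<Gamma>"
      using \<alpha> c by (auto simp: m_assoc)
  qed
  then show ?thesis using orb \<alpha> c by simp
qed

text \<open>For the double eigenvalue \<open>\<epsilon>\<close>, a nonzero row \<open>(p, q)\<close> of the singular matrix \<open>P - \<epsilon>\<close> yields the
  eigenvector \<open>(q, - p)\<close>.\<close>

lemma eigenline_exists:
  assumes "\<gamma> \<in> carrier PSL2R" "parabolic \<gamma>"
  obtains v where "v \<noteq> 0" "line_act \<gamma> (span {v}) = span {v}"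
proof -
  let ?P = "rep \<gamma>"
  have det: "?P$1$1 * ?P$2$2 - ?P$1$2 * ?P$2$1 = 1" using rep_PSL2R[OF assms(1)] by (simp add: det_2)
  obtain \<epsilon> :: real where \<epsilon>: "\<epsilon> = 1 \<or> \<epsilon> = - 1" and tr: "?P$1$1 + ?P$2$2 = 2 * \<epsilon>"
  proof -
    have "\<bar>?P$1$1 + ?P$2$2\<bar> = 2" using assms by (simp add: parabolic_def trace_def sum_2)
    then show thesis using that[of 1] that[of "- 1"] by linarith
  qed
  have "(?P$1$1 - \<epsilon>) * (?P$2$2 - \<epsilon>) - ?P$1$2 * ?P$2$1
      = (?P$1$1 * ?P$2$2 - ?P$1$2 * ?P$2$1) - \<epsilon> * (?P$1$1 + ?P$2$2) + \<epsilon>\<^sup>2"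
    by (simp add: algebra_simps power2_eq_square)
  then have ch: "(?P$1$1 - \<epsilon>) * (?P$2$2 - \<epsilon>) = ?P$1$2 * ?P$2$1"
    unfolding det tr using \<epsilon> by auto
  define v :: "real^2" where
    "v = (if ?P$1$2 = 0 \<and> ?P$1$1 = \<epsilon> then
            (if ?P$2$1 = 0 \<and> ?P$2$2 = \<epsilon> then vector [1, 0] else vector [\<epsilon> - ?P$2$2, ?P$2$1])
          else vector [?P$1$2, \<epsilon> - ?P$1$1])"
  have v0: "v \<noteq> 0" by (auto simp: v_def vec_eq_iff forall_2)
  have ev: "?P *v v = \<epsilon> *\<^sub>R v"
    using ch by (auto simp: v_def vec_eq_iff forall_2 matrix_vector_nth algebra_simps)
  have "line_act \<gamma> (span {v}) = span {v}"
  proof (intro equalityI subsetI)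
    fix x assume "x \<in> line_act \<gamma> (span {v})"
    then show "x \<in> span {v}"
      by (auto simp: line_act_def span_singleton matrix_vector_mult_scaleR ev)
  next
    fix x assume "x \<in> span {v}"
    then obtain c where "x = c *\<^sub>R v" by (auto simp: span_singleton)
    then have "x = ?P *v ((c * \<epsilon>) *\<^sub>R v)" using \<epsilon> by (auto simp: matrix_vector_mult_scaleR ev)
    then show "x \<in> line_act \<gamma> (span {v})" by (auto simp: line_act_def span_singleton)
  qed
  then show thesis using v0 that by blast
qed

text \<open>A cusp is determined up to \<open>\<Gamma>\<close> by any element of the coset \<open>\<alpha> \<Gamma>\<close>, where \<open>\<alpha>\<close> takes it to infinity, and
  each of these cosets meets one fixed finite set.\<close>

theorem number_of_cusps_pos:
  assumes \<Gamma>: "subgroup \<Gamma> PSL2R" "\<Gamma> \<subseteq> PSL2Z"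
    and X: "finite X" "X \<subseteq> \<Gamma>" "generate PSL2R X = \<Gamma>"
    and par: "\<exists>\<delta>\<in>\<Gamma>. parabolic \<delta>"
  shows "number_of_cusps \<Gamma> > 0"
proof -
  let ?o = "\<lambda>L. (\<lambda>\<gamma>. line_act \<gamma> L) ` \<Gamma>"
  obtain E where finE: "finite E" and
    E: "\<And>\<alpha> \<gamma> t. \<alpha> \<in> PSL2Z \<Longrightarrow> \<gamma> \<in> \<Gamma> \<Longrightarrow> t \<noteq> 0 \<Longrightarrow>
       (\<And>z. z \<in> uhp \<Longrightarrow> moebius (\<alpha> \<otimes>\<^bsub>PSL2R\<^esub> \<gamma>) z = moebius \<alpha> z + of_real t) \<Longrightarrow>
       \<exists>c\<in>\<Gamma>. \<alpha> \<otimes>\<^bsub>PSL2R\<^esub> c \<in> E"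
    using finite_set_meeting_cusp_cosets[OF \<Gamma> X] by blast
  have "?o L \<in> ?o ` ker_line ` E" if L: "L \<in> cusp_points \<Gamma>" for L
  proof -
    obtain v \<gamma> where v: "v \<noteq> 0" "L = span {v}" and \<gamma>: "\<gamma> \<in> \<Gamma>" "parabolic \<gamma>" "line_act \<gamma> L = L"
      using L by (auto simp: cusp_points_def)
    obtain \<alpha> t where \<alpha>: "\<alpha> \<in> PSL2Z" "L = ker_line \<alpha>" "t \<noteq> 0"
      "\<And>z. z \<in> uhp \<Longrightarrow> moebius (\<alpha> \<otimes>\<^bsub>PSL2R\<^esub> \<gamma>) z = moebius \<alpha> z + of_real t"
      using parabolic_fixed_line[of \<gamma> v] v \<gamma> \<Gamma>(2) by (metis subsetD)
    obtain c where c: "c \<in> \<Gamma>" "\<alpha> \<otimes>\<^bsub>PSL2R\<^esub> c \<in> E" using E[OF \<alpha>(1) \<gamma>(1) \<alpha>(3,4)] by blast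
    then show ?thesis
      using cusp_orbit_ker_line[OF \<Gamma>(1) PSL2Z_in_PSL2R[OF \<alpha>(1)] c(1)] \<alpha>(2) by blast
  qed
  then have "finite (?o ` cusp_points \<Gamma>)"
    using finE by (meson finite_imageI finite_subset image_subsetI)
  moreover have "cusp_points \<Gamma> \<noteq> {}"
  proof -
    obtain \<delta> where \<delta>: "\<delta> \<in> \<Gamma>" "parabolic \<delta>" using par by blast
    then obtain v where "v \<noteq> 0" "line_act \<delta> (span {v}) = span {v}"
      using eigenline_exists subgroup.subset[OF \<Gamma>(1)] by blast
    then have "span {v} \<in> cusp_points \<Gamma>" using \<delta> by (auto simp: cusp_points_def)
    then show ?thesis by blast
  qed
  ultimately show ?thesis by (simp add: number_of_cusps_def card_gt_0_iff)
qed

section \<open>Cocycles with values in smooth functions are coboundaries\<close>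

definition smooth_functions :: "(complex \<Rightarrow> complex) set" where
  "smooth_functions = {f. smooth_on uhp f \<and> (\<forall>z. z \<notin> uhp \<longrightarrow> f z = 0)}"

lemma function_action_slash:
  assumes \<Gamma>: "subgroup \<Gamma> PSL2R" and k: "even k"
  shows "function_action (PSL2R\<lparr>carrier := \<Gamma>\<rparr>) (slash k) smooth_functions"
proof -
  have sub: "a \<in> carrier PSL2R" if "a \<in> \<Gamma>" for a using that subgroup.subset[OF \<Gamma>] by blast
  have add: "f + h \<in> smooth_functions" if "f \<in> smooth_functions" "h \<in> smooth_functions" for f h
    using that unfolding smooth_functions_def smooth_on_def plus_fun_def by (auto intro: td_add open_uhp)
  have scale: "(\<lambda>z. c * f z) \<in> smooth_functions" if "f \<in> smooth_functions" for f c
    using that unfolding smooth_functions_def smooth_on_def by (auto intro!: td_mult[OF open_uhp td_const[OF open_uhp]])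
  have zero: "0 \<in> smooth_functions"
    unfolding smooth_functions_def smooth_on_def zero_fun_def by (auto intro: td_const open_uhp)
  have stable: "slash k f a \<in> smooth_functions" if "f \<in> smooth_functions" "a \<in> \<Gamma>" for f a
    using that smooth_on_slash[OF sub] by (auto simp: smooth_functions_def slash_def)
  show ?thesis
  proof (intro function_action.intro function_action_axioms.intro)
    show "Group.group (PSL2R\<lparr>carrier := \<Gamma>\<rparr>)"
      by (rule subgroup.subgroup_is_group[OF \<Gamma> group_PSL2R])
  next
    fix f h :: "complex \<Rightarrow> complex" and a
    show "slash k (f + h) a = slash k f a + slash k h a"
      by (simp add: fun_eq_iff slash_def distrib_left)
  next
    fix f :: "complex \<Rightarrow> complex" and c a
    show "slash k (\<lambda>z. c * f z) a = (\<lambda>z. c * slash k f a z)"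
      by (simp add: fun_eq_iff slash_def)
  next
    fix f a b
    assume "a \<in> carrier (PSL2R\<lparr>carrier := \<Gamma>\<rparr>)" "b \<in> carrier (PSL2R\<lparr>carrier := \<Gamma>\<rparr>)"
    then show "slash k (slash k f a) b = slash k f (a \<otimes>\<^bsub>PSL2R\<lparr>carrier := \<Gamma>\<rparr>\<^esub> b)"
      using slash_slash[OF sub sub k] by simp
  next
    fix f assume "f \<in> smooth_functions"
    then show "slash k f \<one>\<^bsub>PSL2R\<lparr>carrier := \<Gamma>\<rparr>\<^esub> = f"
      using slash_one[OF _ k] by (simp add: smooth_functions_def)
  qed (use add scale zero stable in auto)
qed

definition cutoff :: "complex \<Rightarrow> real" where
  "cutoff w = bump 0 (1 - Re w * Re w) * bump 0 (Im w - 1/2)"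

lemma cutoff_nonneg: "cutoff w \<ge> 0"
  by (simp add: cutoff_def bump_def)

lemma cutoff_pos_iff: "cutoff w \<noteq> 0 \<longleftrightarrow> w \<in> strip"
  using abs_square_less_1[of "Re w"]
  by (auto simp: cutoff_def bump_def strip_def power2_eq_square)

lemma td_cutoff: "td n UNIV cutoff"
proof -
  have Re: "td n UNIV Re" and Im: "td n UNIV Im"
    using td_bounded_linear[OF open_UNIV bounded_linear_Re td_ident[OF open_UNIV]]
      td_bounded_linear[OF open_UNIV bounded_linear_Im td_ident[OF open_UNIV]] by auto
  have "td n UNIV (\<lambda>w. 1 + (- 1) * (Re w * Re w))"
    by (intro td_add td_mult td_const open_UNIV Re)
  then have 1: "td n UNIV (\<lambda>w. bump 0 (1 + (- 1) * (Re w * Re w)))"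
    by (rule td_compose[OF open_UNIV open_UNIV UNIV_I td_bump])
  have "td n UNIV (\<lambda>w. Im w + (- 1/2))"
    by (intro td_add td_const open_UNIV Im)
  then have 2: "td n UNIV (\<lambda>w. bump 0 (Im w + (- 1/2)))"
    by (rule td_compose[OF open_UNIV open_UNIV UNIV_I td_bump])
  have "td n UNIV (\<lambda>w. bump 0 (1 + (- 1) * (Re w * Re w)) * bump 0 (Im w + (- 1/2)))"
    by (rule td_mult[OF open_UNIV 1 2])
  then show ?thesis by (simp add: cutoff_def[abs_def])
qed

lemma td_cutoff_moebius:
  assumes "b \<in> PSL2Z"
  shows "td n uhp (\<lambda>z. complex_of_real (cutoff (moebius b z)))"
  by (intro td_bounded_linear[OF open_uhp bounded_linear_of_real]
      td_compose[OF open_uhp open_UNIV UNIV_I td_cutoff] td_moebius PSL2Z_in_PSL2R assms)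

text \<open>Each left coset \<open>b \<Gamma>\<close> gets a representative \<open>r\<close>; then \<open>a b = r\<^sup>-\<^sup>1 b\<close> lies in \<open>\<Gamma>\<close>, and it
  is equivariant because \<open>r\<close> depends on the coset alone.\<close>

lemma equivariant_coset_factor:
  assumes \<Gamma>: "subgroup \<Gamma> PSL2R" "\<Gamma> \<subseteq> PSL2Z"
  obtains a where "\<And>b. b \<in> PSL2Z \<Longrightarrow> a b \<in> \<Gamma>"
    "\<And>b d. b \<in> PSL2Z \<Longrightarrow> d \<in> \<Gamma> \<Longrightarrow> a (b \<otimes>\<^bsub>PSL2R\<^esub> d) = a b \<otimes>\<^bsub>PSL2R\<^esub> d"
proof -
  interpret group PSL2R by (rule group_PSL2R)
  interpret \<Gamma>: subgroup \<Gamma> PSL2R by (rule \<Gamma>)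
  define r where "r b = (SOME x. x \<in> b <#\<^bsub>PSL2R\<^esub> \<Gamma>)" for b
  have r: "\<exists>d\<in>\<Gamma>. r b = b \<otimes>\<^bsub>PSL2R\<^esub> d" for b
  proof -
    have "b \<otimes>\<^bsub>PSL2R\<^esub> \<one>\<^bsub>PSL2R\<^esub> \<in> b <#\<^bsub>PSL2R\<^esub> \<Gamma>" by (auto simp: l_coset_def)
    then have "r b \<in> b <#\<^bsub>PSL2R\<^esub> \<Gamma>" unfolding r_def by (rule someI)
    then show ?thesis by (auto simp: l_coset_def)
  qed
  have rc: "r b \<in> carrier PSL2R" if "b \<in> carrier PSL2R" for b
    using r[of b] that by auto
  have r_coset: "r (b \<otimes>\<^bsub>PSL2R\<^esub> d) = r b" if "b \<in> carrier PSL2R" "d \<in> \<Gamma>" for b d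
  proof -
    have "(b \<otimes>\<^bsub>PSL2R\<^esub> d) <#\<^bsub>PSL2R\<^esub> \<Gamma> = b <#\<^bsub>PSL2R\<^esub> \<Gamma>"
    proof (intro equalityI subsetI)
      fix x assume "x \<in> (b \<otimes>\<^bsub>PSL2R\<^esub> d) <#\<^bsub>PSL2R\<^esub> \<Gamma>"
      then obtain e where "e \<in> \<Gamma>" "x = b \<otimes>\<^bsub>PSL2R\<^esub> d \<otimes>\<^bsub>PSL2R\<^esub> e" by (auto simp: l_coset_def)
      then show "x \<in> b <#\<^bsub>PSL2R\<^esub> \<Gamma>" using that by (auto simp: l_coset_def m_assoc)
    next
      fix x assume "x \<in> b <#\<^bsub>PSL2R\<^esub> \<Gamma>"
      then obtain e where e: "e \<in> \<Gamma>" "x = b \<otimes>\<^bsub>PSL2R\<^esub> e" by (auto simp: l_coset_def)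
      have "d \<otimes>\<^bsub>PSL2R\<^esub> (inv\<^bsub>PSL2R\<^esub> d \<otimes>\<^bsub>PSL2R\<^esub> e) = e" using e that by (simp flip: m_assoc)
      then have "x = b \<otimes>\<^bsub>PSL2R\<^esub> d \<otimes>\<^bsub>PSL2R\<^esub> (inv\<^bsub>PSL2R\<^esub> d \<otimes>\<^bsub>PSL2R\<^esub> e)"
        using e that by (simp add: m_assoc)
      moreover have "inv\<^bsub>PSL2R\<^esub> d \<otimes>\<^bsub>PSL2R\<^esub> e \<in> \<Gamma>" using e that by simp
      ultimately show "x \<in> (b \<otimes>\<^bsub>PSL2R\<^esub> d) <#\<^bsub>PSL2R\<^esub> \<Gamma>" by (auto simp: l_coset_def)
    qed
    then show ?thesis by (simp add: r_def)
  qed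
  show thesis
  proof (rule that[of "\<lambda>b. inv\<^bsub>PSL2R\<^esub> (r b) \<otimes>\<^bsub>PSL2R\<^esub> b"])
    fix b assume "b \<in> PSL2Z"
    then have b: "b \<in> carrier PSL2R" by (rule PSL2Z_in_PSL2R)
    obtain d where d: "d \<in> \<Gamma>" "r b = b \<otimes>\<^bsub>PSL2R\<^esub> d" using r by blast
    have "inv\<^bsub>PSL2R\<^esub> (r b) \<otimes>\<^bsub>PSL2R\<^esub> b = inv\<^bsub>PSL2R\<^esub> d"
      using d b by (simp add: inv_mult_group m_assoc)
    then show "inv\<^bsub>PSL2R\<^esub> (r b) \<otimes>\<^bsub>PSL2R\<^esub> b \<in> \<Gamma>" using d by simp
    fix d assume d: "d \<in> \<Gamma>"
    then show "inv\<^bsub>PSL2R\<^esub> (r (b \<otimes>\<^bsub>PSL2R\<^esub> d)) \<otimes>\<^bsub>PSL2R\<^esub> (b \<otimes>\<^bsub>PSL2R\<^esub> d)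
        = inv\<^bsub>PSL2R\<^esub> (r b) \<otimes>\<^bsub>PSL2R\<^esub> b \<otimes>\<^bsub>PSL2R\<^esub> d"
      using b rc by (simp add: r_coset m_assoc)
  qed
qed

text \<open>For each \<open>b\<close> the function \<open>- c(a b)\<close> solves the equation up to a change of \<open>b\<close> into \<open>b d\<close>, as the cocycle
  identity gives \<open>c(a b)|d = c(a (b d)) - c(d)\<close>.  Averaging over \<open>b\<close> removes the defect: for the weights
  \<open>\<rho>\<^sub>b z = cutoff (b z)\<close>, normalised by their sum \<open>\<Phi>\<close>, passing from \<open>z\<close> to \<open>d z\<close> replaces \<open>\<rho>\<^sub>b\<close> by
  \<open>\<rho>\<^bsub>b d\<^esub>\<close>.\<close>

theorem smooth_cocycle_is_coboundary:
  assumes \<Gamma>: "subgroup \<Gamma> PSL2R" "\<Gamma> \<subseteq> PSL2Z"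
    and c: "\<And>d. d \<in> \<Gamma> \<Longrightarrow> c d \<in> smooth_functions"
    and cocycle: "\<And>d e. d \<in> \<Gamma> \<Longrightarrow> e \<in> \<Gamma> \<Longrightarrow> c (d \<otimes>\<^bsub>PSL2R\<^esub> e) = slash k (c d) e + c e"
  shows "\<exists>f\<in>smooth_functions. \<forall>d\<in>\<Gamma>. slash k f d - f = c d"
proof -
  interpret group PSL2R by (rule group_PSL2R)
  interpret \<Gamma>: subgroup \<Gamma> PSL2R by (rule \<Gamma>)
  obtain a where a: "\<And>b. b \<in> PSL2Z \<Longrightarrow> a b \<in> \<Gamma>"
    and a_mult: "\<And>b d. b \<in> PSL2Z \<Longrightarrow> d \<in> \<Gamma> \<Longrightarrow> a (b \<otimes>\<^bsub>PSL2R\<^esub> d) = a b \<otimes>\<^bsub>PSL2R\<^esub> d"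
    using equivariant_coset_factor[OF \<Gamma>] by blast
  define B where "B z = {b \<in> PSL2Z. moebius b z \<in> strip}" for z
  define \<rho> where "\<rho> b z = complex_of_real (cutoff (moebius b z))" for b z
  define \<Phi> where "\<Phi> z = (\<Sum>b\<in>B z. \<rho> b z)" for z
  define S where "S z = (\<Sum>b\<in>B z. \<rho> b z * c (a b) z)" for z
  define f where "f z = (if z \<in> uhp then - (S z * inverse (\<Phi> z)) else 0)" for z
  have finB: "finite (B z)" if "z \<in> uhp" for z
    using strip_locally_finite[of "{z}"] that by (simp add: B_def)
  have \<Phi>0: "\<Phi> z \<noteq> 0" if z: "z \<in> uhp" for z
  proof -
    have "0 < (\<Sum>b\<in>B z. cutoff (moebius b z))"
    proof (rule sum_pos)
      show "B z \<noteq> {}" using strip_meets_orbit[OF z] by (auto simp: B_def)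
      show "0 < cutoff (moebius b z)" if "b \<in> B z" for b
        using that cutoff_pos_iff[of "moebius b z"] cutoff_nonneg[of "moebius b z"]
        by (auto simp: B_def)
    qed (rule finB[OF z])
    then show ?thesis unfolding \<Phi>_def \<rho>_def of_real_sum[symmetric] by (simp del: of_real_sum)
  qed
  have "td n uhp f" for n
  proof (rule td_local)
    fix z0 assume "z0 \<in> uhp"
    then obtain e where e: "e > 0" "cball z0 e \<subseteq> uhp"
      using open_uhp open_contains_cball by blast
    define U where "U = ball z0 e"
    have U: "open U" "z0 \<in> U" "U \<subseteq> uhp" "U \<subseteq> cball z0 e" using e by (auto simp: U_def)
    define F where "F = {b \<in> PSL2Z. \<exists>z\<in>cball z0 e. moebius b z \<in> strip}"
    have finF: "finite F" unfolding F_def by (rule strip_locally_finite[OF compact_cball e(2)])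
    have BF: "B z \<subseteq> F" if "z \<in> U" for z using that U by (auto simp: B_def F_def)
    have zero: "\<rho> b z = 0" if "b \<in> F" "b \<notin> B z" for b z
      using that cutoff_pos_iff[of "moebius b z"] by (auto simp: \<rho>_def B_def F_def)
    have \<rho>td: "td n U (\<rho> b)" if "b \<in> F" for b
      using td_subset[OF U(1,3) td_cutoff_moebius[of b]] that by (simp add: \<rho>_def[abs_def] F_def)
    have ctd: "td n U (c (a b))" if "b \<in> F" for b
    proof -
      have "c (a b) \<in> smooth_functions" using that a c by (auto simp: F_def)
      then show ?thesis using td_subset[OF U(1,3)] by (auto simp: smooth_functions_def smooth_on_def)
    qed
    have S: "S z = (\<Sum>b\<in>F. \<rho> b z * c (a b) z)" if "z \<in> U" for z
      unfolding S_def by (rule sum.mono_neutral_left[OF finF BF[OF that]]) (simp add: zero)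
    have \<Phi>: "\<Phi> z = (\<Sum>b\<in>F. \<rho> b z)" if "z \<in> U" for z
      unfolding \<Phi>_def by (rule sum.mono_neutral_left[OF finF BF[OF that]]) (simp add: zero)
    have \<Phi>td: "td n U (\<lambda>z. \<Sum>b\<in>F. \<rho> b z)" by (rule td_sum[OF U(1) \<rho>td])
    have Std: "td n U (\<lambda>z. \<Sum>b\<in>F. \<rho> b z * c (a b) z)"
      by (rule td_sum[OF U(1)]) (rule td_mult[OF U(1) \<rho>td ctd])
    have "td n U (\<lambda>z. inverse (\<Sum>b\<in>F. \<rho> b z))"
    proof (rule td_inverse[OF U(1) _ \<Phi>td])
      fix z assume "z \<in> U"
      then show "(\<Sum>b\<in>F. \<rho> b z) \<noteq> 0" using \<Phi>0[of z] \<Phi>[of z] U by auto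
    qed
    then have "td n U (\<lambda>z. (- 1) * ((\<Sum>b\<in>F. \<rho> b z * c (a b) z) * inverse (\<Sum>b\<in>F. \<rho> b z)))"
      by (intro td_mult[OF U(1)] td_const U(1) Std)
    then have "td n U f"
      by (rule td_cong[OF U(1), rotated]) (use U S \<Phi> in \<open>auto simp: f_def\<close>)
    then show "\<exists>U. open U \<and> z0 \<in> U \<and> td n U f" using U by blast
  qed
  then have fV: "f \<in> smooth_functions" by (simp add: smooth_functions_def smooth_on_def f_def)
  have "slash k f d z - f z = c d z" if d: "d \<in> \<Gamma>" for d z
  proof (cases "z \<in> uhp")
    case False
    then show ?thesis using c[OF d] by (simp add: slash_def f_def smooth_functions_def)
  next
    case z: True
    have dc: "d \<in> carrier PSL2R" and dZ: "d \<in> PSL2Z" using d \<Gamma> by auto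
    have dz: "moebius d z \<in> uhp" by (rule moebius_in_uhp[OF dc z])
    have move: "moebius (b \<otimes>\<^bsub>PSL2R\<^esub> d) z = moebius b (moebius d z)" if "b \<in> PSL2Z" for b
      by (rule moebius_mult[OF PSL2Z_in_PSL2R[OF that] dc z])
    have bij: "bij_betw (\<lambda>b. b \<otimes>\<^bsub>PSL2R\<^esub> d) (B (moebius d z)) (B z)"
    proof (rule bij_betwI[where g = "\<lambda>b. b \<otimes>\<^bsub>PSL2R\<^esub> inv\<^bsub>PSL2R\<^esub> d"])
      show "(\<lambda>b. b \<otimes>\<^bsub>PSL2R\<^esub> d) \<in> B (moebius d z) \<rightarrow> B z"
        using move dZ by (auto simp: B_def mult_PSL2Z)
      have "inv\<^bsub>PSL2R\<^esub> d \<in> PSL2Z" using \<Gamma>.m_inv_closed[OF d] \<Gamma>(2) by blast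
      moreover have "moebius (b \<otimes>\<^bsub>PSL2R\<^esub> inv\<^bsub>PSL2R\<^esub> d) (moebius d z) = moebius b z" if "b \<in> PSL2Z" for b
        using moebius_mult[of "b \<otimes>\<^bsub>PSL2R\<^esub> inv\<^bsub>PSL2R\<^esub> d" d z] PSL2Z_in_PSL2R[OF that] dc z
        by (simp add: m_assoc)
      ultimately show "(\<lambda>b. b \<otimes>\<^bsub>PSL2R\<^esub> inv\<^bsub>PSL2R\<^esub> d) \<in> B z \<rightarrow> B (moebius d z)"
        by (auto simp: B_def mult_PSL2Z)
    qed (use dc PSL2Z_in_PSL2R in \<open>auto simp: B_def m_assoc\<close>)
    have \<Phi>d: "\<Phi> (moebius d z) = \<Phi> z"
      unfolding \<Phi>_def \<rho>_def
      by (subst sum.reindex_bij_betw[OF bij, symmetric]) (auto simp: B_def move)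
    let ?j = "autfactor d z powi (- k)"
    have "?j * S (moebius d z) = (\<Sum>b\<in>B (moebius d z). \<rho> b (moebius d z) * slash k (c (a b)) d z)"
      unfolding S_def sum_distrib_left using z by (simp add: slash_def mult_ac)
    also have "\<dots> = (\<Sum>b\<in>B (moebius d z). \<rho> (b \<otimes>\<^bsub>PSL2R\<^esub> d) z * (c (a (b \<otimes>\<^bsub>PSL2R\<^esub> d)) z - c d z))"
    proof (rule sum.cong[OF HOL.refl])
      fix b assume "b \<in> B (moebius d z)"
      then have b: "b \<in> PSL2Z" by (simp add: B_def)
      have "c (a (b \<otimes>\<^bsub>PSL2R\<^esub> d)) z = slash k (c (a b)) d z + c d z"
        unfolding a_mult[OF b d] cocycle[OF a[OF b] d] by simp
      then show "\<rho> b (moebius d z) * slash k (c (a b)) d z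
          = \<rho> (b \<otimes>\<^bsub>PSL2R\<^esub> d) z * (c (a (b \<otimes>\<^bsub>PSL2R\<^esub> d)) z - c d z)"
        by (simp add: \<rho>_def move[OF b])
    qed
    also have "\<dots> = (\<Sum>b\<in>B z. \<rho> b z * (c (a b) z - c d z))"
      by (rule sum.reindex_bij_betw[OF bij])
    also have "\<dots> = S z - \<Phi> z * c d z"
      by (simp add: S_def \<Phi>_def right_diff_distrib sum_subtractf sum_distrib_right)
    finally have "?j * S (moebius d z) = S z - \<Phi> z * c d z" .
    moreover have "slash k f d z = - (?j * S (moebius d z)) * inverse (\<Phi> z)"
      using z dz by (simp add: slash_def f_def \<Phi>d)
    ultimately have "slash k f d z = - (S z - \<Phi> z * c d z) * inverse (\<Phi> z)" by simp
    also have "\<dots> = f z + c d z" using \<Phi>0[OF z] z by (simp add: f_def field_simps)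
    finally show ?thesis by simp
  qed
  then have "slash k f d - f = c d" if "d \<in> \<Gamma>" for d using that by (simp add: fun_eq_iff)
  then show ?thesis using fV by blast
qed

section \<open>Modules and exactness\<close>

lemma cring_complex_ring: "cring complex_ring"
proof (rule cringI)
  show "abelian_group complex_ring"
    by (rule abelian_groupI) (auto simp: complex_ring_def intro: exI[of _ "- x" for x] add.left_inverse)
qed (auto simp: complex_ring_def distrib_right intro!: comm_monoidI)

lemma module_direct_sum:
  assumes N: "module R N" and I: "finite I"
  shows "module R (direct_sum I (\<lambda>_. N))"
proof -
  interpret N: module R N by (rule N)
  let ?D = "direct_sum I (\<lambda>_. N)"
  have carrier: "carrier ?D = (\<Pi>\<^sub>E i\<in>I. carrier N)"
    using I by (simp add: direct_sum_def)
  have ext: "x = y" if "x \<in> carrier ?D" "y \<in> carrier ?D" "\<And>i. i \<in> I \<Longrightarrow> x i = y i" for x y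
    using that PiE_ext unfolding carrier by blast
  have mem: "x i \<in> carrier N" if "x \<in> carrier ?D" "i \<in> I" for x i
    using that unfolding carrier by (rule PiE_mem)
  have add: "x \<oplus>\<^bsub>?D\<^esub> y \<in> carrier ?D" "i \<in> I \<Longrightarrow> (x \<oplus>\<^bsub>?D\<^esub> y) i = x i \<oplus>\<^bsub>N\<^esub> y i"
    if "x \<in> carrier ?D" "y \<in> carrier ?D" for x y i
    using mem[OF that(1)] mem[OF that(2)] unfolding carrier by (auto simp: direct_sum_def)
  have zero: "\<zero>\<^bsub>?D\<^esub> \<in> carrier ?D" "i \<in> I \<Longrightarrow> \<zero>\<^bsub>?D\<^esub> i = \<zero>\<^bsub>N\<^esub>" for i
    unfolding carrier by (auto simp: direct_sum_def)
  have smult: "c \<odot>\<^bsub>?D\<^esub> x \<in> carrier ?D" "i \<in> I \<Longrightarrow> (c \<odot>\<^bsub>?D\<^esub> x) i = c \<odot>\<^bsub>N\<^esub> x i"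
    if "c \<in> carrier R" "x \<in> carrier ?D" for c x i
    using mem[OF that(2)] that(1) unfolding carrier by (auto simp: direct_sum_def)
  show ?thesis
  proof (rule moduleI)
    show "cring R" by (rule N.is_cring)
    show "abelian_group ?D"
    proof (rule abelian_groupI)
      fix x y z assume xyz: "x \<in> carrier ?D" "y \<in> carrier ?D" "z \<in> carrier ?D"
      show "x \<oplus>\<^bsub>?D\<^esub> y \<oplus>\<^bsub>?D\<^esub> z = x \<oplus>\<^bsub>?D\<^esub> (y \<oplus>\<^bsub>?D\<^esub> z)"
        by (rule ext) (use xyz mem in \<open>simp_all add: add N.a_assoc\<close>)
    next
      fix x y assume xy: "x \<in> carrier ?D" "y \<in> carrier ?D"
      show "x \<oplus>\<^bsub>?D\<^esub> y = y \<oplus>\<^bsub>?D\<^esub> x"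
        by (rule ext) (use xy mem in \<open>simp_all add: add N.a_comm\<close>)
    next
      fix x assume x: "x \<in> carrier ?D"
      show "\<zero>\<^bsub>?D\<^esub> \<oplus>\<^bsub>?D\<^esub> x = x"
        by (rule ext) (use x mem zero in \<open>simp_all add: add\<close>)
      define y where "y = (\<lambda>i\<in>I. \<ominus>\<^bsub>N\<^esub> x i)"
      have y: "y \<in> carrier ?D" using mem[OF x] unfolding carrier by (auto simp: y_def)
      have "y \<oplus>\<^bsub>?D\<^esub> x = \<zero>\<^bsub>?D\<^esub>"
        by (rule ext) (use x y mem zero in \<open>simp_all add: add y_def N.l_neg\<close>)
      then show "\<exists>y\<in>carrier ?D. y \<oplus>\<^bsub>?D\<^esub> x = \<zero>\<^bsub>?D\<^esub>" using y by blast
    qed (use add zero in auto)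
  next
    fix a b x assume abx: "a \<in> carrier R" "b \<in> carrier R" "x \<in> carrier ?D"
    show "(a \<oplus>\<^bsub>R\<^esub> b) \<odot>\<^bsub>?D\<^esub> x = a \<odot>\<^bsub>?D\<^esub> x \<oplus>\<^bsub>?D\<^esub> b \<odot>\<^bsub>?D\<^esub> x"
      by (rule ext) (use abx mem in \<open>simp_all add: add smult N.smult_l_distr\<close>)
    show "(a \<otimes>\<^bsub>R\<^esub> b) \<odot>\<^bsub>?D\<^esub> x = a \<odot>\<^bsub>?D\<^esub> (b \<odot>\<^bsub>?D\<^esub> x)"
      by (rule ext) (use abx mem in \<open>simp_all add: smult N.smult_assoc1\<close>)
  next
    fix a x y assume axy: "a \<in> carrier R" "x \<in> carrier ?D" "y \<in> carrier ?D"
    show "a \<odot>\<^bsub>?D\<^esub> (x \<oplus>\<^bsub>?D\<^esub> y) = a \<odot>\<^bsub>?D\<^esub> x \<oplus>\<^bsub>?D\<^esub> a \<odot>\<^bsub>?D\<^esub> y"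
      by (rule ext) (use axy mem in \<open>simp_all add: add smult N.smult_r_distr\<close>)
  next
    fix x assume x: "x \<in> carrier ?D"
    show "\<one>\<^bsub>R\<^esub> \<odot>\<^bsub>?D\<^esub> x = x"
      by (rule ext) (use x mem in \<open>simp_all add: smult\<close>)
  qed (use smult in auto)
qed

lemma (in function_action) module_subrep:
  assumes W: "subrep W" "carrier M = W"
    and M: "zero M = (\<lambda>z. 0)" "add M = (\<lambda>f h z. f z + h z)" "smult M = (\<lambda>c f z. c * f z)"
  shows "module complex_ring M"
proof (rule moduleI)
  have add: "(\<lambda>z. f z + h z) \<in> W" if "f \<in> W" "h \<in> W" for f h
    using subrep_add[OF W(1) that] by (simp add: plus_fun_def)
  have zero: "(\<lambda>z. 0) \<in> W" using W(1) by (simp add: subrep_def zero_fun_def)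
  have scale: "(\<lambda>z. c * f z) \<in> W" if "f \<in> W" for c f
    using W(1) that by (simp add: subrep_def)
  show "cring complex_ring" by (rule cring_complex_ring)
  show "abelian_group M"
  proof (rule abelian_groupI)
    fix f assume "f \<in> carrier M"
    then show "\<exists>h\<in>carrier M. h \<oplus>\<^bsub>M\<^esub> f = \<zero>\<^bsub>M\<^esub>"
      using scale[of f "- 1"] by (intro bexI[of _ "\<lambda>z. - 1 * f z"]) (simp_all add: W M)
  qed (simp_all add: W M add zero ac_simps)
  show "\<And>a x. a \<in> carrier complex_ring \<Longrightarrow> x \<in> carrier M \<Longrightarrow> a \<odot>\<^bsub>M\<^esub> x \<in> carrier M"
    by (simp add: W M scale)
qed (simp_all add: complex_ring_def M algebra_simps)

lemma (in function_action) diffs_add: "diffs \<gamma> is (f + h) = diffs \<gamma> is f + diffs \<gamma> is h"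
proof (induction "is" arbitrary: f h)
  case (Cons i "is")
  have "act (f + h) (\<gamma> i) - (f + h) = (act f (\<gamma> i) - f) + (act h (\<gamma> i) - h)"
    unfolding act_add by (rule add_diff_add)
  then show ?case by (simp only: diffs_simps Cons.IH)
qed (simp only: diffs_simps)

lemma (in function_action) diffs_scale: "diffs \<gamma> is (\<lambda>z. c * f z) = (\<lambda>z. c * diffs \<gamma> is f z)"
proof (induction "is" arbitrary: f)
  case (Cons i "is")
  have "act (\<lambda>z. c * f z) (\<gamma> i) - (\<lambda>z. c * f z) = (\<lambda>z. c * (act f (\<gamma> i) - f) z)"
    unfolding act_scale by (simp add: fun_eq_iff right_diff_distrib)
  then show ?case by (simp only: diffs_simps Cons.IH)
qed (simp only: diffs_simps)

lemma fricke_klein_relator_split: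
  assumes "m \<ge> 1"
  obtains u where "fricke_klein_relator g m = u @ [(Suc (2*g + m - 1), True)]"
    "u \<in> lists ({1..2*g + m - 1} \<times> UNIV)"
proof -
  obtain m' where m': "m = Suc m'" using assms by (cases m) auto
  define u where "u = concat (map (\<lambda>j. [(j, True), (g + j, True), (j, False), (g + j, False)]) [1..<g+1])
     @ map (\<lambda>i. (i, True)) [2*g+1..<2*g+m'+1]"
  have "fricke_klein_relator g m = u @ [(Suc (2*g + m - 1), True)]"
    by (simp add: fricke_klein_relator_def u_def m')
  moreover have "u \<in> lists ({1..2*g + m - 1} \<times> UNIV)"
    by (auto simp: u_def in_lists_conv_set m')
  ultimately show thesis by (rule that)
qed

lemma finite_multi_indices: "finite (multi_indices n s)"
proof -
  have "multi_indices n s = {xs. set xs \<subseteq> {1..n} \<and> length xs = s}" by (auto simp: multi_indices_def)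
  then show ?thesis by (simp add: finite_lists_length_eq)
qed

theorem theorem4p4:
  fixes \<Gamma> :: "(real^2^2) set set" and \<gamma> :: "nat \<Rightarrow> (real^2^2) set"
    and k :: int and s g m :: nat
  assumes "subgroup \<Gamma> PSL2R" and "\<Gamma> \<subseteq> PSL2Z"
    and "fuchsian_first_kind \<Gamma>"
    and "\<exists>\<delta>\<in>\<Gamma>. parabolic \<delta>" and "\<forall>\<delta>\<in>\<Gamma>. \<not> elliptic \<delta>"
    and "g = genus (orbit_space \<Gamma>)" and "m = number_of_cusps \<Gamma>"
    and "fricke_klein_generators \<Gamma> g m \<gamma>"
    and "even k" and "s \<ge> 1"
  shows "short_exact complex_ring
           (M_forms k \<Gamma> s) (M_forms k \<Gamma> (s + 1))
           (direct_sum (multi_indices (2*g + m - 1) s) (\<lambda>_. M_forms k \<Gamma> 1))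
           (\<lambda>f. f) (psi k \<Gamma> \<gamma> (2*g + m - 1) s)"
proof -
  note \<Gamma> = assms(1,2)
  let ?G = "PSL2R\<lparr>carrier := \<Gamma>\<rparr>"
  interpret P: group PSL2R by (rule group_PSL2R)
  interpret \<Gamma>: subgroup \<Gamma> PSL2R by (rule \<Gamma>(1))
  interpret A: function_action ?G "slash k" smooth_functions
    by (rule function_action_slash[OF \<Gamma>(1) assms(9)])
  have pres0: "presents ?G {1..2*g+m} \<gamma> {fricke_klein_relator g m}"
    using assms(8) by (simp add: fricke_klein_generators_def)
  have "number_of_cusps \<Gamma> > 0"
  proof (rule number_of_cusps_pos[OF \<Gamma> _ _ _ assms(4)])
    show sub: "\<gamma> ` {1..2*g+m} \<subseteq> \<Gamma>" using pres0 by (simp add: presents_def)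
    show "generate PSL2R (\<gamma> ` {1..2*g+m}) = \<Gamma>"
      using pres0 P.generate_consistent[OF sub \<Gamma>(1)] by (simp add: presents_def)
  qed simp
  then have m: "m \<ge> 1" using assms(7) by simp
  define n where "n = 2*g + m - 1"
  have n: "2*g + m = Suc n" using m by (simp add: n_def)
  obtain u where u: "fricke_klein_relator g m = u @ [(Suc n, True)]" "u \<in> lists ({1..n} \<times> UNIV)"
    using fricke_klein_relator_split[OF m] unfolding n_def by blast
  have pres: "presents ?G {1..Suc n} \<gamma> {u @ [(Suc n, True)]}"
    using pres0 by (simp only: n u(1))
  have gen: "generate ?G (\<gamma> ` {1..n}) = carrier ?G"
    by (rule A.generated_by_initial_generators[OF pres u(2)])
  have \<gamma>: "\<gamma> i \<in> carrier ?G" if "i \<in> {1..n}" for i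
    using pres that unfolding presents_def by auto
  let ?T = "\<lambda>t. (A.inv_mod ^^ t) {0}"
  have sT: "A.subrep (?T t)" for t by (rule A.subrep_inv_mod_power[OF A.subrep_zero])
  have TV: "?T t \<subseteq> smooth_functions" for t using sT[of t] by (simp add: A.subrep_def)
  have slash_int: "slash_int k f p = A.ring_act f p" for f p
    by (simp add: fun_eq_iff slash_ring_def A.ring_act_def)
  have carrier: "carrier (M_forms k \<Gamma> t) = ?T t" for t
    unfolding A.annihilated_by_augmentation_power[OF A.subrep_zero, symmetric]
    by (auto simp: M_forms_def slash_int smooth_functions_def zero_fun_def)
  have mod: "module complex_ring (M_forms k \<Gamma> t)" for t
    by (rule A.module_subrep[OF sT carrier]) (simp_all add: M_forms_def)
  have psi: "psi k \<Gamma> \<gamma> n s f = (\<lambda>is\<in>multi_indices n s. A.diffs \<gamma> is f)" if "f \<in> smooth_functions" for f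
    unfolding psi_def
  proof (rule restrict_ext)
    fix "is" assume "is \<in> multi_indices n s"
    then have "\<gamma> i \<in> carrier ?G" if "i \<in> set is" for i
      using \<gamma> that by (auto simp: multi_indices_def)
    then show "slash_int k f (gen_prod \<Gamma> \<gamma> is) = A.diffs \<gamma> is f"
      unfolding slash_int gen_prod_def Let_def by (rule A.ring_act_gen_prod[OF that])
  qed
  have T_iff: "f \<in> ?T (s + t) \<longleftrightarrow> (\<forall>is\<in>multi_indices n s. A.diffs \<gamma> is f \<in> ?T t)"
    if "f \<in> smooth_functions" for f t
    using A.inv_mod_power_iff_diffs[OF sT[of t] that \<gamma> gen, of s] by (simp add: funpow_add)
  let ?D = "direct_sum (multi_indices n s) (\<lambda>_. M_forms k \<Gamma> 1)"
  have carrier_D: "carrier ?D = (\<Pi>\<^sub>E is\<in>multi_indices n s. ?T 1)"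
    using finite_multi_indices[of n s] by (simp add: direct_sum_def carrier)
  have ops: "add (M_forms k \<Gamma> t) = (\<lambda>f h z. f z + h z)" "smult (M_forms k \<Gamma> t) = (\<lambda>c f z. c * f z)"
    "zero (M_forms k \<Gamma> t) = (\<lambda>z. 0)" for t
    by (simp_all add: M_forms_def)
  have incl: "?T s \<subseteq> ?T (s + 1)"
    using A.inv_mod_power_mono[of s] by simp
  have psi_in: "psi k \<Gamma> \<gamma> n s f \<in> carrier ?D" if "f \<in> ?T (s + 1)" for f
  proof -
    have fV: "f \<in> smooth_functions" using that TV by blast
    show ?thesis
      unfolding carrier_D psi[OF fV] using T_iff[OF fV, of 1] that by (intro restrict_PiE_iff[THEN iffD2]) blast
  qed
  have lin1: "linear_map complex_ring (M_forms k \<Gamma> s) (M_forms k \<Gamma> (s + 1)) (\<lambda>f. f)"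
    unfolding linear_map_def using mod incl by (auto simp: carrier ops)
  have lin2: "linear_map complex_ring (M_forms k \<Gamma> (s + 1)) ?D (psi k \<Gamma> \<gamma> n s)"
    unfolding linear_map_def
  proof (intro conjI ballI)
    show "module complex_ring (M_forms k \<Gamma> (s + 1))" "module complex_ring ?D"
      by (rule mod, rule module_direct_sum[OF mod finite_multi_indices])
    show "psi k \<Gamma> \<gamma> n s \<in> carrier (M_forms k \<Gamma> (s + 1)) \<rightarrow> carrier ?D"
      unfolding carrier using psi_in by blast
  next
    fix f h assume "f \<in> carrier (M_forms k \<Gamma> (s + 1))" "h \<in> carrier (M_forms k \<Gamma> (s + 1))"
    then have fh: "f \<in> smooth_functions" "h \<in> smooth_functions" using TV unfolding carrier by blast+
    have sum: "f \<oplus>\<^bsub>M_forms k \<Gamma> (s + 1)\<^esub> h = f + h" by (simp add: ops plus_fun_def)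
    show "psi k \<Gamma> \<gamma> n s (f \<oplus>\<^bsub>M_forms k \<Gamma> (s + 1)\<^esub> h) = psi k \<Gamma> \<gamma> n s f \<oplus>\<^bsub>?D\<^esub> psi k \<Gamma> \<gamma> n s h"
      unfolding sum psi[OF fh(1)] psi[OF fh(2)] psi[OF A.V_add[OF fh]] A.diffs_add
      by (simp add: direct_sum_def ops plus_fun_def cong: restrict_cong)
  next
    fix c f assume "f \<in> carrier (M_forms k \<Gamma> (s + 1))"
    then have f: "f \<in> smooth_functions" using TV unfolding carrier by blast
    have "c \<odot>\<^bsub>M_forms k \<Gamma> (s + 1)\<^esub> f = (\<lambda>z. c * f z)" by (simp add: ops)
    then show "psi k \<Gamma> \<gamma> n s (c \<odot>\<^bsub>M_forms k \<Gamma> (s + 1)\<^esub> f) = c \<odot>\<^bsub>?D\<^esub> psi k \<Gamma> \<gamma> n s f"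
      using psi[OF f] psi[OF A.V_scale[OF f]]
      by (auto simp: direct_sum_def ops A.diffs_scale fun_eq_iff)
  qed
  have exact: "(\<lambda>f. f) ` carrier (M_forms k \<Gamma> s) = a_kernel (M_forms k \<Gamma> (s + 1)) ?D (psi k \<Gamma> \<gamma> n s)"
  proof -
    have "f \<in> ?T s \<longleftrightarrow> psi k \<Gamma> \<gamma> n s f = (\<lambda>is\<in>multi_indices n s. (\<lambda>z. 0))" if "f \<in> ?T (s + 1)" for f
    proof -
      have fV: "f \<in> smooth_functions" using that TV by blast
      have "f \<in> ?T s \<longleftrightarrow> (\<forall>is\<in>multi_indices n s. A.diffs \<gamma> is f = (\<lambda>z. 0))"
        using T_iff[OF fV, of 0] by (simp add: zero_fun_def)
      also have "\<dots> \<longleftrightarrow> psi k \<Gamma> \<gamma> n s f = (\<lambda>is\<in>multi_indices n s. (\<lambda>z. 0))"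
      proof
        assume "\<forall>is\<in>multi_indices n s. A.diffs \<gamma> is f = (\<lambda>z. 0)"
        then show "psi k \<Gamma> \<gamma> n s f = (\<lambda>is\<in>multi_indices n s. (\<lambda>z. 0))"
          unfolding psi[OF fV] by (intro restrict_ext) blast
      next
        assume *: "psi k \<Gamma> \<gamma> n s f = (\<lambda>is\<in>multi_indices n s. (\<lambda>z. 0))"
        show "\<forall>is\<in>multi_indices n s. A.diffs \<gamma> is f = (\<lambda>z. 0)"
        proof
          fix js assume "js \<in> multi_indices n s"
          then show "A.diffs \<gamma> js f = (\<lambda>z. 0)"
            using fun_cong[OF *[unfolded psi[OF fV]], of js] by (simp only: restrict_apply')
        qed
      qed
      finally show ?thesis .
    qed
    then show ?thesis
      using incl by (auto simp: a_kernel_def kernel_def carrier ops direct_sum_def)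
  qed
  have "H \<in> psi k \<Gamma> \<gamma> n s ` carrier (M_forms k \<Gamma> (s + 1))" if H: "H \<in> carrier ?D" for H
  proof -
    have H1: "H is \<in> ?T 1" if "is \<in> multi_indices n s" for "is"
      using H that unfolding carrier_D by (rule PiE_mem)
    have solve: "\<exists>f\<in>smooth_functions. \<forall>i\<in>{1..n}. slash k f (\<gamma> i) - f = \<phi> i"
      if \<phi>: "\<And>i. i \<in> {1..n} \<Longrightarrow> \<phi> i \<in> smooth_functions" for \<phi>
    proof -
      obtain c where c: "\<And>a. a \<in> carrier ?G \<Longrightarrow> c a \<in> smooth_functions"
        "\<And>a b. a \<in> carrier ?G \<Longrightarrow> b \<in> carrier ?G \<Longrightarrow> c (a \<otimes>\<^bsub>?G\<^esub> b) = slash k (c a) b + c b"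
        "\<And>i. i \<in> {1..n} \<Longrightarrow> c (\<gamma> i) = \<phi> i"
        by (rule A.cocycle_extension_free[OF pres u(2), of \<phi>, OF \<phi>]) (assumption | rule that)+
      obtain f where f: "f \<in> smooth_functions" "\<forall>d\<in>\<Gamma>. slash k f d - f = c d"
        using smooth_cocycle_is_coboundary[OF \<Gamma>, of c k] c(1,2) by auto
      then have "slash k f (\<gamma> i) - f = \<phi> i" if "i \<in> {1..n}" for i
        using \<gamma>[OF that] c(3)[OF that] by simp
      then show ?thesis using f(1) by blast
    qed
    obtain f where f: "f \<in> smooth_functions" "\<forall>is\<in>multi_indices n s. A.diffs \<gamma> is f = H is"
      using A.diffs_surjective[of n \<gamma> s H, OF solve subsetD[OF TV H1]] by blast
    have "\<forall>is\<in>multi_indices n s. A.diffs \<gamma> is f \<in> ?T 1" using f(2) H1 by simp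
    then have "f \<in> ?T (s + 1)" using T_iff[OF f(1), of 1] by blast
    moreover have "psi k \<Gamma> \<gamma> n s f = H"
    proof (rule extensionalityI)
      show "H \<in> extensional (multi_indices n s)" using H unfolding carrier_D by (simp add: PiE_def)
      fix js assume js: "js \<in> multi_indices n s"
      then show "psi k \<Gamma> \<gamma> n s f js = H js" using f(2) unfolding psi[OF f(1)] by simp
    qed (simp add: psi[OF f(1)])
    ultimately show ?thesis unfolding carrier by blast
  qed
  then have surj: "psi k \<Gamma> \<gamma> n s ` carrier (M_forms k \<Gamma> (s + 1)) = carrier ?D"
    using psi_in unfolding carrier by blast
  show ?thesis
    unfolding short_exact_def n_def[symmetric] using lin1 lin2 exact surj by simp
qed

end
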